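(* For each fixed $0<\beta<2$, the function $B_{Q_2,1/\beta}(w)$ attains its maximum over $w\in[0,\beta]$ at $w=\tfrac{\beta}{2}$. Consequently, for $0<\beta<2$, if $0<\alpha<\dfrac{1}{2\sqrt{M_{Q_2,1/\beta}}}$, then $\mathcal{G}(Q_2,\alpha,\beta)$ forms a frame for $L^2(\mathbb{R})$, where $$M_{Q_2,1/\beta}=\frac{1}{4\pi^2}\,\frac{1-2Q_2\left(\frac{1}{\beta}\right)+Q_2\left(1-\frac{1}{\beta}\right)-Q_2\left(1-\frac{2}{\beta}\right)+Q_2\left(1-\frac{3}{\beta}\right)}{\frac{1}{3}-Q_4\left(\frac{1}{\beta}\right)+Q_4\left(\frac{2}{\beta}\right)-Q_4\left(\frac{3}{\beta}\right)}.$$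
   Context: The B-splines are $Q_1=\chi_{[-1/2,1/2]}$ and $Q_{m+1}=Q_m*Q_1$ for $m\ge1$. Explicitly, $Q_2(x)=\max(0,1-|x|)$, and $Q_4(x)=\frac{1}{3!}\sum_{j=0}^{4}(-1)^j\binom{4}{j}(x+2-j)_+^3$ with $x_+=\max(0,x)$. The Fourier transform is $\widehat f(w)=\int_{-\infty}^{\infty}f(x)e^{-2\pi i wx}\,dx$. For $h>0$, $$B_{\phi,h}(w):=\frac{\sum_{l\in\mathbb{Z}}(w+\frac{l}{h})^2|\widehat\phi(w+\frac{l}{h})|^2}{\sum_{l\in\mathbb{Z}}|\widehat\phi(w+\frac{l}{h})|^2},\qquad M_{\phi,h}:=\operatorname*{ess\,sup}_{w\in[0,1/h]}B_{\phi,h}(w).$$ For $\phi\in L^2(\mathbb{R})$ and $\alpha,\beta>0$, $\mathcal{G}(\phi,\alpha,\beta)=\{e^{2\pi i\beta m\cdot}\phi(\cdot-\alpha k):k,m\in\mathbb{Z}\}$; it is a frame for $L^2(\mathbb{R})$ if there are $A,B>0$ with $A\|f\|^2\le\sum_{k,m\in\mathbb{Z}}|\langle f,e^{2\pi i\beta m\cdot}\phi(\cdot-\alpha k)\rangle|^2\le B\|f\|^2$ for all $f\in L^2(\mathbb{R})$. *)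

theory Defs
  imports "HOL-Analysis.Analysis" "HOL-Probability.Essential_Supremum"
begin

text \<open>The B-splines \<open>Q\<^sub>m\<close> are indexed by \<open>m \<ge> 1\<close>; the value at index \<open>0\<close> is a dummy.\<close>

fun bspline :: "nat \<Rightarrow> real \<Rightarrow> real" where
  "bspline 0 x = 0"
| "bspline (Suc 0) x = indicator {-1/2..1/2} x"
| "bspline (Suc (Suc m)) x =
     (\<integral>y. bspline (Suc m) (x - y) * bspline (Suc 0) y \<partial>lborel)"

abbreviation cbspline :: "nat \<Rightarrow> real \<Rightarrow> complex" where
  "cbspline m \<equiv> (\<lambda>x. complex_of_real (bspline m x))"

definition fourier :: "(real \<Rightarrow> complex) \<Rightarrow> real \<Rightarrow> complex" where
  "fourier f w =
     (\<integral>x. f x * exp (- 2 * complex_of_real pi * \<i> * complex_of_real (w * x)) \<partial>lborel)"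

text \<open>The two sums of nonnegative terms are taken in \<^typ>\<open>ereal\<close>, so that a divergent sum is
  \<open>\<infinity>\<close> and not the default value \<open>0\<close> of \<^const>\<open>infsum\<close> on \<^typ>\<open>real\<close>.\<close>

definition B_quot :: "(real \<Rightarrow> complex) \<Rightarrow> real \<Rightarrow> real \<Rightarrow> ereal" where
  "B_quot \<phi> h w =
     (\<Sum>\<^sub>\<infinity>l\<in>(UNIV :: int set).
        ereal ((w + of_int l / h)\<^sup>2 * (norm (fourier \<phi> (w + of_int l / h)))\<^sup>2)) /
     (\<Sum>\<^sub>\<infinity>l\<in>(UNIV :: int set).
        ereal ((norm (fourier \<phi> (w + of_int l / h)))\<^sup>2))"

definition M_sup :: "(real \<Rightarrow> complex) \<Rightarrow> real \<Rightarrow> ereal" where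
  "M_sup \<phi> h = esssup (restrict_space lborel {0..1/h}) (B_quot \<phi> h)"

text \<open>Elements of \<open>L\<^sup>2(\<real>)\<close> are represented by Borel measurable functions, one or more for each
  almost-everywhere class.\<close>

definition L2 :: "(real \<Rightarrow> complex) set" where
  "L2 = {f. f \<in> borel_measurable lborel \<and> integrable lborel (\<lambda>x. (norm (f x))\<^sup>2)}"

definition L2_inner :: "(real \<Rightarrow> complex) \<Rightarrow> (real \<Rightarrow> complex) \<Rightarrow> complex" where
  "L2_inner f g = (\<integral>x. f x * cnj (g x) \<partial>lborel)"

definition L2_norm :: "(real \<Rightarrow> complex) \<Rightarrow> real" where
  "L2_norm f = sqrt (\<integral>x. (norm (f x))\<^sup>2 \<partial>lborel)"

definition L2_frame :: "('i \<Rightarrow> real \<Rightarrow> complex) \<Rightarrow> bool" where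
  "L2_frame g \<longleftrightarrow> (\<forall>i. g i \<in> L2) \<and>
     (\<exists>A B :: real. A > 0 \<and> B > 0 \<and>
       (\<forall>f\<in>L2. ereal (A * (L2_norm f)\<^sup>2) \<le> (\<Sum>\<^sub>\<infinity>i\<in>UNIV. ereal ((norm (L2_inner f (g i)))\<^sup>2)) \<and>
               (\<Sum>\<^sub>\<infinity>i\<in>UNIV. ereal ((norm (L2_inner f (g i)))\<^sup>2)) \<le> ereal (B * (L2_norm f)\<^sup>2)))"

definition gabor :: "(real \<Rightarrow> complex) \<Rightarrow> real \<Rightarrow> real \<Rightarrow> int \<times> int \<Rightarrow> real \<Rightarrow> complex" where
  "gabor \<phi> \<alpha> \<beta> = (\<lambda>(k, m) x.
     exp (2 * complex_of_real pi * \<i> * complex_of_real (\<beta> * of_int m * x)) * \<phi> (x - \<alpha> * of_int k))"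

end

theory Submission
  imports Defs
begin

text \<open>Write \<open>h = 1 / \<beta>\<close>, so that \<open>\<beta> < 2\<close> means \<open>h > 1/2\<close>, and let \<open>\<phi>\<close> be the hat function \<open>Q\<^sub>2\<close>.

  \<^bold>\<open>The quotient.\<close> The values of the Fourier transform of \<open>\<phi>\<close> at \<open>w + l / h\<close> are, up to
  normalisation, the Fourier coefficients of the \<open>h\<close>-periodisation of \<open>\<phi>(x) exp (-2 \<pi> i w x)\<close>.
  Parseval's identity on \<open>[0,h)\<close> therefore turns the denominator of \<open>B\<close> into \<open>h\<close> times the symbol
  \<open>D(\<theta>) = \<Sum>\<^sub>j Q\<^sub>4(j h) cos (j \<theta>)\<close> at \<open>\<theta> = 2 \<pi> w h\<close>, because \<open>Q\<^sub>4\<close> is the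
  autocorrelation of \<open>\<phi>\<close>. In the same way the numerator is \<open>h / (4 \<pi>\<^sup>2)\<close> times the symbol \<open>N\<close> built from
  the autocorrelation of \<open>\<phi>'\<close>. Both autocorrelations vanish outside \<open>[-2,2]\<close>, so only \<open>\<bar>j\<bar> \<le> 3\<close> occurs and
  \<open>N\<close> and \<open>D\<close> are polynomials of degree at most three in \<open>c = cos \<theta>\<close>. The point \<open>w = \<beta> / 2\<close> is \<open>c = -1\<close>,
  and the difference \<open>N(-1) D(c) - N(c) D(-1)\<close> is \<open>1 + c\<close> times a polynomial that is visibly nonnegative
  when it is expanded in powers of \<open>1 + c\<close> (\<open>symbols_extremal_at_pi\<close>). Hence \<open>B\<close> is largest at
  \<open>\<beta> / 2\<close>; being continuous there, it has its maximum as essential supremum.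

  \<^bold>\<open>The frame.\<close> Parseval's identity in the modulation index gives
  \<open>\<Sum>\<^sub>m \<bar>\<langle>f, g\<^sub>k\<^sub>m\<rangle>\<bar>\<^sup>2 = h \<integral> \<bar>\<Sum>\<^sub>l f(x + l h) \<phi>(x + l h - \<alpha> k)\<bar>\<^sup>2 dx\<close> over one period
  (\<open>gabor_modulation_energy\<close>). As \<open>\<phi>\<close> is even, the inner sum is the value at \<open>\<alpha> k - x\<close> of
  \<open>g = \<Sum>\<^sub>l c\<^sub>l \<phi>(\<cdot> - l h)\<close> with \<open>c\<^sub>l = f(x + l h)\<close>, and the frame bounds follow once
  \<open>\<Sum>\<^sub>k \<bar>g(\<alpha> k - x)\<bar>\<^sup>2\<close> is comparable to \<open>\<Sum>\<^sub>l \<bar>c\<^sub>l\<bar>\<^sup>2\<close>, uniformly in \<open>x\<close>. The upper bound holds because only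
  boundedly many translates overlap. For the lower bound, \<open>0 < D(\<pi>) \<le> D\<close> gives
  \<open>D(\<pi>) \<Sum>\<^sub>l \<bar>c\<^sub>l\<bar>\<^sup>2 \<le> \<parallel>g\<parallel>\<^sup>2\<close> (\<open>riesz_lower_bound\<close>) and \<open>N \<le> 4 \<pi>\<^sup>2 M D\<close> gives
  \<open>\<parallel>g'\<parallel>\<^sup>2 \<le> 4 \<pi>\<^sup>2 M \<parallel>g\<parallel>\<^sup>2\<close> (\<open>bernstein_inequality\<close>), both through positivity of Toeplitz forms.
  Replacing \<open>g\<close> by its nearest sample on each cell of length \<open>\<alpha>\<close> costs, by Wirtinger's inequality on the two
  half cells, at most \<open>(\<alpha> / \<pi>)\<^sup>2 \<parallel>g'\<parallel>\<^sup>2 \<le> 4 \<alpha>\<^sup>2 M \<parallel>g\<parallel>\<^sup>2\<close>, and \<open>4 \<alpha>\<^sup>2 M < 1\<close> is exactly the assumption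
  on \<open>\<alpha>\<close>. So the samples must carry a fixed share of \<open>\<parallel>g\<parallel>\<^sup>2\<close> (\<open>sampling_lower_bound\<close>).\<close>

section \<open>Parseval's identity on an interval\<close>

text \<open>The half-open interval makes the translates \<open>[k T, (k + 1) T)\<close> partition the line exactly and
  makes \<open>x \<mapsto> exp (2 \<pi> i x / T)\<close> injective on the period.\<close>

abbreviation period_space :: "real \<Rightarrow> real measure" where
  "period_space T \<equiv> restrict_space lborel {0..<T}"

abbreviation sqnorm :: "'a measure \<Rightarrow> ('a \<Rightarrow> complex) \<Rightarrow> real" where
  "sqnorm M f \<equiv> (\<integral>x. (norm (f x))\<^sup>2 \<partial>M)"

abbreviation period_sqnorm :: "real \<Rightarrow> (real \<Rightarrow> complex) \<Rightarrow> real" where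
  "period_sqnorm T \<equiv> sqnorm (period_space T)"

text \<open>The frame inequalities are proved for extended nonnegative values, where sums and integrals can be
  exchanged before their finiteness is known.\<close>

abbreviation energy :: "(real \<Rightarrow> complex) \<Rightarrow> ennreal" where
  "energy f \<equiv> (\<integral>\<^sup>+x. ennreal ((norm (f x))\<^sup>2) \<partial>lborel)"

abbreviation sq_sum :: "('i \<Rightarrow> complex) \<Rightarrow> ennreal" where
  "sq_sum c \<equiv> (\<integral>\<^sup>+i. ennreal ((norm (c i))\<^sup>2) \<partial>count_space UNIV)"

definition trig :: "real \<Rightarrow> int \<Rightarrow> real \<Rightarrow> complex" where
  "trig T l x = cis (2 * pi * of_int l * x / T)"

definition sq_integrable :: "'a measure \<Rightarrow> ('a \<Rightarrow> complex) \<Rightarrow> bool" where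
  "sq_integrable M f \<longleftrightarrow> f \<in> borel_measurable M \<and> integrable M (\<lambda>x. (norm (f x))\<^sup>2)"

lemma norm_add_sq_weighted:
  assumes "e > 0"
  shows "(norm (z + w :: complex))\<^sup>2 \<le> (1 + e) * (norm z)\<^sup>2 + (1 + 1 / e) * (norm w)\<^sup>2"
proof -
  have "(norm (z + w))\<^sup>2 \<le> (norm z + norm w)\<^sup>2"
    by (intro power_mono norm_triangle_ineq) auto
  also have "\<dots> = (norm z)\<^sup>2 + 2 * norm z * norm w + (norm w)\<^sup>2" by (simp add: power2_sum)
  also have "2 * norm z * norm w \<le> e * (norm z)\<^sup>2 + (norm w)\<^sup>2 / e"
  proof -
    have "0 \<le> (e * norm z - norm w)\<^sup>2 / e" using assms by simp
    also have "\<dots> = e * (norm z)\<^sup>2 + (norm w)\<^sup>2 / e - 2 * norm z * norm w"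
      using assms by (simp add: power2_eq_square field_simps)
    finally show ?thesis by simp
  qed
  finally show ?thesis by (simp add: algebra_simps)
qed

lemma norm_add_sq_le: "(norm (a + b :: complex))\<^sup>2 \<le> 2 * (norm a)\<^sup>2 + 2 * (norm b)\<^sup>2"
  using norm_add_sq_weighted[of 1 a b] by simp

lemma cnj_measurable [measurable]: "cnj \<in> borel_measurable borel"
  by (intro borel_measurable_continuous_onI continuous_intros)

lemma sq_integrable_measurable [measurable_dest]: "sq_integrable M f \<Longrightarrow> f \<in> borel_measurable M"
  by (simp add: sq_integrable_def)

lemma sq_integrable_add:
  assumes "sq_integrable M f" "sq_integrable M g"
  shows "sq_integrable M (\<lambda>x. f x + g x)"
proof -
  note [measurable] = sq_integrable_measurable[OF assms(1)] sq_integrable_measurable[OF assms(2)]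
  have "integrable M (\<lambda>x. (norm (f x + g x))\<^sup>2)"
  proof (rule Bochner_Integration.integrable_bound)
    show "integrable M (\<lambda>x. 2 * (norm (f x))\<^sup>2 + 2 * (norm (g x))\<^sup>2)"
      using assms by (auto simp: sq_integrable_def)
    show "AE x in M. norm ((norm (f x + g x))\<^sup>2) \<le> norm (2 * (norm (f x))\<^sup>2 + 2 * (norm (g x))\<^sup>2)"
      using norm_add_sq_le by (auto simp: abs_of_nonneg)
  qed measurable
  then show ?thesis by (simp add: sq_integrable_def)
qed

lemma sq_integrable_cmult:
  assumes "sq_integrable M f" shows "sq_integrable M (\<lambda>x. c * f x)"
  using assms by (auto simp: sq_integrable_def norm_mult power_mult_distrib)

lemma sq_integrable_diff:
  assumes "sq_integrable M f" "sq_integrable M g"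
  shows "sq_integrable M (\<lambda>x. f x - g x)"
  using sq_integrable_add[OF assms(1) sq_integrable_cmult[OF assms(2), of "-1"]] by simp

lemma sq_integrable_sum:
  assumes "\<And>i. i \<in> I \<Longrightarrow> sq_integrable M (f i)"
  shows "sq_integrable M (\<lambda>x. \<Sum>i\<in>I. f i x)"
  using assms
proof (induction I rule: infinite_finite_induct)
  case (insert i I)
  then show ?case using sq_integrable_add[of M "f i" "\<lambda>x. \<Sum>i\<in>I. f i x"] by auto
qed (auto simp: sq_integrable_def)

lemma sq_integrable_mult_cnj:
  assumes "sq_integrable M f" "sq_integrable M g"
  shows "integrable M (\<lambda>x. f x * cnj (g x))"
proof (rule Bochner_Integration.integrable_bound)
  note [measurable] = sq_integrable_measurable[OF assms(1)] sq_integrable_measurable[OF assms(2)]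
  show "integrable M (\<lambda>x. (norm (f x))\<^sup>2 + (norm (g x))\<^sup>2)"
    using assms by (auto simp: sq_integrable_def)
  show "(\<lambda>x. f x * cnj (g x)) \<in> borel_measurable M" by measurable
  show "AE x in M. norm (f x * cnj (g x)) \<le> norm ((norm (f x))\<^sup>2 + (norm (g x))\<^sup>2)"
  proof (intro AE_I2)
    fix x
    have "2 * (norm (f x) * norm (g x)) \<le> (norm (f x))\<^sup>2 + (norm (g x))\<^sup>2"
      using sum_squares_bound[of "norm (f x)" "norm (g x)"] by simp
    moreover have "0 \<le> norm (f x) * norm (g x)" by simp
    ultimately have "norm (f x) * norm (g x) \<le> (norm (f x))\<^sup>2 + (norm (g x))\<^sup>2" by linarith
    then show "norm (f x * cnj (g x)) \<le> norm ((norm (f x))\<^sup>2 + (norm (g x))\<^sup>2)"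
      by (simp add: norm_mult)
  qed
qed

lemma finite_measure_period_space: "finite_measure (period_space T)"
proof (rule finite_measureI)
  have "emeasure lborel {0..<T} < \<infinity>"
    by (rule emeasure_bounded_finite) auto
  then show "emeasure (period_space T) (space (period_space T)) \<noteq> \<infinity>"
    by (simp add: emeasure_restrict_space space_restrict_space)
qed

lemma sq_integrable_bounded:
  assumes "finite_measure M" "f \<in> borel_measurable M" "\<And>x. x \<in> space M \<Longrightarrow> norm (f x) \<le> B"
  shows "sq_integrable M f"
proof -
  interpret finite_measure M by fact
  have "integrable M (\<lambda>x. (norm (f x))\<^sup>2)"
  proof (rule integrable_const_bound[where B = "B\<^sup>2"])
    show "AE x in M. norm ((norm (f x))\<^sup>2) \<le> B\<^sup>2"
      using assms(3) by (intro AE_I2) (auto intro!: power_mono)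
  qed (use assms(2) in measurable)
  with assms(2) show ?thesis by (simp add: sq_integrable_def)
qed

lemma sq_integrable_imp_integrable:
  assumes "finite_measure M" "sq_integrable M f"
  shows "integrable M f"
proof -
  interpret finite_measure M by fact
  have "sq_integrable M (\<lambda>x. 1)"
    by (rule sq_integrable_bounded[where B = 1]) (auto intro: assms)
  from sq_integrable_mult_cnj[OF assms(2) this] show ?thesis by simp
qed

lemma continuous_trig: "continuous_on A (trig T l)"
  unfolding trig_def cis_conv_exp by (cases "T = 0") (auto intro!: continuous_intros)

lemma trig_measurable [measurable]: "trig T l \<in> borel_measurable borel"
  by (rule borel_measurable_continuous_onI[OF continuous_trig])

lemma trig_measurable_period [measurable]: "trig T l \<in> borel_measurable (period_space T)"
  by (rule measurable_restrict_space1) simp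

lemma sq_integrable_trig: "sq_integrable (period_space T) (trig T l)"
  by (rule sq_integrable_bounded[where B = 1, OF finite_measure_period_space])
     (auto simp: trig_def)

lemma integral_period_space_Icc:
  fixes f :: "real \<Rightarrow> 'b::{banach, second_countable_topology}"
  assumes "f \<in> borel_measurable borel"
  shows "(\<integral>x. f x \<partial>period_space T) = (\<integral>x. indicator {0..T} x *\<^sub>R f x \<partial>lborel)"
proof -
  have "(\<integral>x. f x \<partial>period_space T) = (\<integral>x. indicator {0..<T} x *\<^sub>R f x \<partial>lborel)"
    by (subst integral_restrict_space) auto
  also have "\<dots> = (\<integral>x. indicator {0..T} x *\<^sub>R f x \<partial>lborel)"
  proof (rule integral_cong_AE)
    show "AE x in lborel. indicator {0..<T} x *\<^sub>R f x = indicator {0..T} x *\<^sub>R f x"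
      using AE_lborel_singleton[of T] by eventually_elim (auto simp: indicator_def)
  qed (use assms in measurable)
  finally show ?thesis .
qed

lemma integral_trig:
  assumes "T > 0"
  shows "(\<integral>x. trig T l x \<partial>period_space T) = (if l = 0 then of_real T else 0)"
proof (cases "l = 0")
  case True
  then show ?thesis using assms
    by (simp add: integral_period_space_Icc trig_def measure_restrict_space scaleR_conv_of_real)
next
  case False
  define F where "F x = trig T l x / (\<i> * (2 * pi * of_int l / T))" for x
  have nz: "\<i> * (2 * pi * of_int l / T) \<noteq> (0::complex)"
    using False assms by simp
  have "(F has_vector_derivative trig T l x) (at x within A)" for x A
  proof -
    let ?c = "\<i> * (2 * pi * of_int l / T) :: complex"
    have "((\<lambda>z. exp (?c * z) / ?c) has_field_derivative exp (?c * of_real x)) (at (of_real x))"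
      using nz by (auto intro!: derivative_eq_intros)
    from has_vector_derivative_real_field[OF this, of A]
    show ?thesis
      by (simp add: F_def[abs_def] trig_def cis_conv_exp mult_ac)
  qed
  then have "has_bochner_integral lborel (\<lambda>x. indicator {0..T} x *\<^sub>R trig T l x) (F T - F 0)"
    using assms by (intro has_bochner_integral_FTC_Icc continuous_trig) auto
  moreover have "F T = F 0"
    using assms by (simp add: F_def trig_def cis_multiple_2pi)
  ultimately show ?thesis
    using False by (subst integral_period_space_Icc) (auto dest: has_bochner_integral_integral_eq)
qed

lemma trig_mult: "trig T l x * trig T m x = trig T (l + m) x"
  by (simp add: trig_def cis_mult add_divide_distrib ring_distribs)

lemma cnj_trig: "cnj (trig T l x) = trig T (- l) x"
  by (simp add: trig_def cis_cnj)

lemma norm_trig [simp]: "norm (trig T l x) = 1"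
  by (simp add: trig_def)

lemma trig_orthogonal:
  assumes "T > 0"
  shows "(\<integral>x. trig T l x * cnj (trig T m x) \<partial>period_space T) = (if l = m then of_real T else 0)"
  using integral_trig[OF assms, of "l - m"] by (simp add: cnj_trig trig_mult)

abbreviation fcoeff :: "real \<Rightarrow> (real \<Rightarrow> complex) \<Rightarrow> int \<Rightarrow> complex" where
  "fcoeff T f l \<equiv> (\<integral>x. f x * cnj (trig T l x) \<partial>period_space T)"

lemma complex_norm_sq: "complex_of_real ((norm z)\<^sup>2) = z * cnj z"
  by (rule complex_norm_square)

text \<open>Completing the square in each coefficient: the distance from \<open>f\<close> to a trigonometric polynomial is
  smallest when its coefficients are those of \<open>f\<close>. This yields Bessel's inequality with that choice and,
  with a good approximation, the converse estimate.\<close>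

lemma trig_distance:
  assumes "T > 0" and f: "sq_integrable (period_space T) f" and S: "finite S"
  shows "period_sqnorm T (\<lambda>x. f x - (\<Sum>l\<in>S. a l * trig T l x)) =
    period_sqnorm T f
    + (\<Sum>l\<in>S. ((norm (of_real T * a l - fcoeff T f l))\<^sup>2 - (norm (fcoeff T f l))\<^sup>2) / T)"
proof -
  let ?M = "period_space T"
  let ?p = "\<lambda>x. \<Sum>l\<in>S. a l * trig T l x"
  have p: "sq_integrable ?M ?p"
    by (intro sq_integrable_sum sq_integrable_cmult sq_integrable_trig)
  have fp: "(\<integral>x. f x * cnj (?p x) \<partial>?M) = (\<Sum>l\<in>S. cnj (a l) * fcoeff T f l)"
  proof -
    have "(\<integral>x. f x * cnj (?p x) \<partial>?M) = (\<integral>x. (\<Sum>l\<in>S. cnj (a l) * (f x * cnj (trig T l x))) \<partial>?M)"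
      by (intro Bochner_Integration.integral_cong refl) (simp add: sum_distrib_left mult_ac)
    also have "\<dots> = (\<Sum>l\<in>S. cnj (a l) * fcoeff T f l)"
      using sq_integrable_mult_cnj[OF f sq_integrable_trig]
      by (subst Bochner_Integration.integral_sum) auto
    finally show ?thesis .
  qed
  have pf: "(\<integral>x. ?p x * cnj (f x) \<partial>?M) = (\<Sum>l\<in>S. a l * cnj (fcoeff T f l))"
  proof -
    have "(\<integral>x. ?p x * cnj (f x) \<partial>?M) = (\<integral>x. cnj (f x * cnj (?p x)) \<partial>?M)"
      by (intro Bochner_Integration.integral_cong refl) (simp add: mult.commute)
    also have "\<dots> = cnj (\<integral>x. f x * cnj (?p x) \<partial>?M)"
      using integral_bounded_linear[OF bounded_linear_cnj sq_integrable_mult_cnj[OF f p]] by simp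
    finally show ?thesis by (simp only: fp) simp
  qed
  have pp: "(\<integral>x. ?p x * cnj (?p x) \<partial>?M) = (\<Sum>l\<in>S. of_real T * (a l * cnj (a l)))"
  proof -
    have "(\<integral>x. ?p x * cnj (?p x) \<partial>?M)
      = (\<integral>x. (\<Sum>l\<in>S. \<Sum>m\<in>S. (a l * cnj (a m)) * (trig T l x * cnj (trig T m x))) \<partial>?M)"
      by (intro Bochner_Integration.integral_cong refl)
         (simp add: sum_product mult_ac)
    also have "\<dots> = (\<Sum>l\<in>S. \<Sum>m\<in>S. (a l * cnj (a m)) * (if l = m then of_real T else 0))"
    proof -
      have "integrable ?M (\<lambda>x. (a l * cnj (a m)) * (trig T l x * cnj (trig T m x)))" for l m
        by (intro integrable_mult_right sq_integrable_mult_cnj sq_integrable_trig)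
      then show ?thesis
        by (subst Bochner_Integration.integral_sum;
            (subst Bochner_Integration.integral_sum)?)
           (auto simp: trig_orthogonal[OF assms(1)])
    qed
    also have "\<dots> = (\<Sum>l\<in>S. of_real T * (a l * cnj (a l)))"
      using S by (intro sum.cong refl) (auto simp: if_distrib sum.delta' cong: if_cong)
    finally show ?thesis .
  qed
  have "complex_of_real (sqnorm ?M (\<lambda>x. f x - ?p x))
     = (\<integral>x. (f x - ?p x) * cnj (f x - ?p x) \<partial>?M)"
    by (simp only: complex_norm_sq flip: integral_complex_of_real)
  also have "\<dots> = (\<integral>x. f x * cnj (f x) - f x * cnj (?p x) - ?p x * cnj (f x) + ?p x * cnj (?p x) \<partial>?M)"
    by (intro Bochner_Integration.integral_cong refl) (simp only: complex_cnj_diff algebra_simps)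
  also have "\<dots> = (\<integral>x. f x * cnj (f x) \<partial>?M) - (\<integral>x. f x * cnj (?p x) \<partial>?M)
        - (\<integral>x. ?p x * cnj (f x) \<partial>?M) + (\<integral>x. ?p x * cnj (?p x) \<partial>?M)"
    by (subst Bochner_Integration.integral_add Bochner_Integration.integral_diff;
        (intro Bochner_Integration.integrable_diff sq_integrable_mult_cnj f p)?)+ simp
  also have "(\<integral>x. f x * cnj (f x) \<partial>?M) = complex_of_real (sqnorm ?M f)"
    by (simp only: complex_norm_sq flip: integral_complex_of_real)
  finally have "complex_of_real (sqnorm ?M (\<lambda>x. f x - ?p x)) = 
     complex_of_real (sqnorm ?M f) + (\<Sum>l\<in>S. of_real T * (a l * cnj (a l)) 
        - a l * cnj (fcoeff T f l) - cnj (a l) * fcoeff T f l)"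
    unfolding fp pf pp by (simp add: sum_subtractf)
  also have "(\<Sum>l\<in>S. of_real T * (a l * cnj (a l)) 
        - a l * cnj (fcoeff T f l) - cnj (a l) * fcoeff T f l) = 
     complex_of_real (\<Sum>l\<in>S. ((norm (of_real T * a l - fcoeff T f l))\<^sup>2 - (norm (fcoeff T f l))\<^sup>2) / T)"
    unfolding of_real_sum of_real_divide of_real_diff complex_norm_sq
    using assms(1) by (intro sum.cong refl) (simp add: field_simps)
  finally show ?thesis
    by (simp only: of_real_eq_iff flip: of_real_add)
qed

lemma bessel_partial:
  assumes "T > 0" and f: "sq_integrable (period_space T) f" and S: "finite S"
  shows "(\<Sum>l\<in>S. (norm (fcoeff T f l))\<^sup>2) \<le> T * period_sqnorm T f"
proof -
  have "0 \<le> period_sqnorm T (\<lambda>x. f x - (\<Sum>l\<in>S. fcoeff T f l / of_real T * trig T l x))"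
    by (rule Bochner_Integration.integral_nonneg) simp
  also have "\<dots> = period_sqnorm T f - (\<Sum>l\<in>S. (norm (fcoeff T f l))\<^sup>2) / T"
    using assms by (subst trig_distance) (auto simp: sum_negf sum_divide_distrib)
  finally show ?thesis using assms(1) by (simp add: field_simps)
qed

definition trig_polynomial :: "real \<Rightarrow> (real \<Rightarrow> complex) \<Rightarrow> bool" where
  "trig_polynomial T p \<longleftrightarrow> (\<exists>S a. finite S \<and> p = (\<lambda>x. \<Sum>l\<in>S. a l * trig T l x))"

lemma trig_polynomial_trig: "trig_polynomial T (\<lambda>x. c * trig T l x)"
  unfolding trig_polynomial_def by (rule exI[of _ "{l}"], rule exI[of _ "\<lambda>_. c"]) simp

lemma trig_polynomial_add:
  assumes "trig_polynomial T p" "trig_polynomial T q"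
  shows "trig_polynomial T (\<lambda>x. p x + q x)"
proof -
  obtain S a where S: "finite S" "p = (\<lambda>x. \<Sum>l\<in>S. a l * trig T l x)"
    using assms(1) by (auto simp: trig_polynomial_def)
  obtain S' a' where S': "finite S'" "q = (\<lambda>x. \<Sum>l\<in>S'. a' l * trig T l x)"
    using assms(2) by (auto simp: trig_polynomial_def)
  let ?b = "\<lambda>l. (if l \<in> S then a l else 0) + (if l \<in> S' then a' l else 0)"
  have "p x + q x = (\<Sum>l\<in>S \<union> S'. ?b l * trig T l x)" for x
  proof -
    have "p x = (\<Sum>l\<in>S \<union> S'. (if l \<in> S then a l else 0) * trig T l x)"
      unfolding S using S S' by (intro sum.mono_neutral_cong_left) auto
    moreover have "q x = (\<Sum>l\<in>S \<union> S'. (if l \<in> S' then a' l else 0) * trig T l x)"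
      unfolding S' using S S' by (intro sum.mono_neutral_cong_left) auto
    ultimately show ?thesis by (simp add: sum.distrib ring_distribs)
  qed
  with S S' show ?thesis
    unfolding trig_polynomial_def by (intro exI[of _ "S \<union> S'"] exI[of _ ?b]) auto
qed

lemma trig_polynomial_sum:
  assumes "finite I" "\<And>i. i \<in> I \<Longrightarrow> trig_polynomial T (p i)"
  shows "trig_polynomial T (\<lambda>x. \<Sum>i\<in>I. p i x)"
  using assms
proof (induction I rule: finite_induct)
  case empty
  show ?case unfolding trig_polynomial_def by (rule exI[of _ "{}"]) simp
next
  case (insert i I)
  then show ?case using trig_polynomial_add[of T "p i" "\<lambda>x. \<Sum>i\<in>I. p i x"] by simp
qed

lemma trig_polynomial_mult:
  assumes "trig_polynomial T p" "trig_polynomial T q"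
  shows "trig_polynomial T (\<lambda>x. p x * q x)"
proof -
  obtain S a where S: "finite S" "p = (\<lambda>x. \<Sum>l\<in>S. a l * trig T l x)"
    using assms(1) by (auto simp: trig_polynomial_def)
  obtain S' a' where S': "finite S'" "q = (\<lambda>x. \<Sum>l\<in>S'. a' l * trig T l x)"
    using assms(2) by (auto simp: trig_polynomial_def)
  have "(\<lambda>x. p x * q x) = (\<lambda>x. \<Sum>l\<in>S. \<Sum>m\<in>S'. (a l * a' m) * trig T (l + m) x)"
    unfolding S S' sum_product trig_mult[symmetric] by (simp only: mult_ac)
  then show ?thesis
    using S S' by (simp add: trig_polynomial_sum trig_polynomial_trig)
qed

text \<open>A real linear form on the complex plane is \<open>z \<mapsto> A z + B (cnj z)\<close>, and on the circle conjugation is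
  the inverse, that is, the character of index \<open>-1\<close>. Polynomials in the two real coordinates thus become
  trigonometric polynomials, which brings the Stone-Weierstrass theorem for polynomials to bear.\<close>

lemma trig_polynomial_real_polynomial:
  fixes g :: "complex \<Rightarrow> real"
  assumes "real_polynomial_function g"
  shows "trig_polynomial T (\<lambda>x. complex_of_real (g (trig T 1 x)))"
  using assms
proof induction
  case (linear g)
  define A where "A = (of_real (g 1) - \<i> * of_real (g \<i>)) / 2"
  define B where "B = (of_real (g 1) + \<i> * of_real (g \<i>)) / 2"
  have gz: "complex_of_real (g z) = A * z + B * cnj z" for z
  proof -
    have "g z = g (Re z *\<^sub>R 1 + Im z *\<^sub>R \<i>)"
      by (rule arg_cong[where f = g]) (simp add: complex_eq_iff)
    also have "\<dots> = Re z * g 1 + Im z * g \<i>"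
      using linear by (simp add: bounded_linear.linear linear_add linear_scale)
    finally have gz: "g z = Re z * g 1 + Im z * g \<i>" .
    show ?thesis unfolding gz A_def B_def by (simp add: complex_eq_iff field_simps)
  qed
  have "(\<lambda>x. complex_of_real (g (trig T 1 x))) = (\<lambda>x. A * trig T 1 x + B * trig T (-1) x)"
    by (rule ext, subst gz) (simp add: cnj_trig)
  then show ?case
    by (simp only:) (intro trig_polynomial_add trig_polynomial_trig)
next
  case (const c)
  then show ?case using trig_polynomial_trig[of T "of_real c" 0] by (simp add: trig_def)
next
  case (add f g)
  then show ?case by (simp add: trig_polynomial_add)
next
  case (mult f g)
  then show ?case by (simp add: trig_polynomial_mult)
qed

definition trig_approximable :: "real \<Rightarrow> (real \<Rightarrow> complex) \<Rightarrow> bool" where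
  "trig_approximable T f \<longleftrightarrow> sq_integrable (period_space T) f \<and>
     (\<forall>e>0. \<exists>p. trig_polynomial T p \<and> period_sqnorm T (\<lambda>x. f x - p x) < e)"

lemma sq_integrable_trig_polynomial:
  "trig_polynomial T p \<Longrightarrow> sq_integrable (period_space T) p"
  by (auto simp: trig_polynomial_def intro!: sq_integrable_sum sq_integrable_cmult sq_integrable_trig)

lemma trig_approximable_polynomial: "trig_polynomial T p \<Longrightarrow> trig_approximable T p"
  unfolding trig_approximable_def
  by (auto intro!: exI[of _ p] sq_integrable_trig_polynomial)

lemma integral_norm_add_sq_le:
  assumes "sq_integrable M f" "sq_integrable M g"
  shows "sqnorm M (\<lambda>x. f x + g x) \<le> 2 * sqnorm M f + 2 * sqnorm M g"
proof -
  have "sqnorm M (\<lambda>x. f x + g x) \<le> (\<integral>x. 2 * (norm (f x))\<^sup>2 + 2 * (norm (g x))\<^sup>2 \<partial>M)"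
    using assms sq_integrable_add[OF assms]
    by (intro integral_mono norm_add_sq_le) (auto simp: sq_integrable_def)
  also have "\<dots> = 2 * sqnorm M f + 2 * sqnorm M g"
    using assms by (simp add: sq_integrable_def)
  finally show ?thesis .
qed

lemma trig_approximable_closed:
  assumes f: "sq_integrable (period_space T) f"
    and app: "\<And>e. e > 0 \<Longrightarrow> \<exists>g. trig_approximable T g \<and> period_sqnorm T (\<lambda>x. f x - g x) < e"
  shows "trig_approximable T f"
  unfolding trig_approximable_def
proof (intro conjI allI impI f)
  fix e :: real assume "e > 0"
  then obtain g where g: "trig_approximable T g" "period_sqnorm T (\<lambda>x. f x - g x) < e / 4"
    using app[of "e / 4"] by auto
  then obtain p where p: "trig_polynomial T p" "period_sqnorm T (\<lambda>x. g x - p x) < e / 4"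
    using \<open>e > 0\<close> unfolding trig_approximable_def by (meson divide_pos_pos zero_less_numeral)
  have gs: "sq_integrable (period_space T) g" using g by (simp add: trig_approximable_def)
  have "period_sqnorm T (\<lambda>x. f x - p x) = period_sqnorm T (\<lambda>x. (f x - g x) + (g x - p x))"
    by simp
  also have "\<dots> \<le> 2 * period_sqnorm T (\<lambda>x. f x - g x) + 2 * period_sqnorm T (\<lambda>x. g x - p x)"
    by (intro integral_norm_add_sq_le sq_integrable_diff f gs sq_integrable_trig_polynomial p)
  also have "\<dots> < e" using g p by linarith
  finally show "\<exists>p. trig_polynomial T p \<and> period_sqnorm T (\<lambda>x. f x - p x) < e"
    using p by blast
qed

text \<open>Dominated convergence in square mean; it carries every limit step below, from polynomials to
  continuous functions, indicators and finally arbitrary square-integrable functions.\<close>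

lemma trig_approximable_dominated:
  assumes G: "\<And>n::nat. trig_approximable T (G n)"
    and f: "f \<in> borel_measurable (period_space T)"
    and lim: "\<And>x. x \<in> {0..<T} \<Longrightarrow> (\<lambda>n. G n x) \<longlonglongrightarrow> f x"
    and bound: "\<And>n x. x \<in> {0..<T} \<Longrightarrow> norm (G n x) \<le> H x"
    and H: "H \<in> borel_measurable (period_space T)" "integrable (period_space T) (\<lambda>x. (H x)\<^sup>2)"
  shows "trig_approximable T f"
proof (rule trig_approximable_closed)
  let ?M = "period_space T"
  have sp: "space ?M = {0..<T}" by (simp add: space_restrict_space)
  have Gm [measurable]: "G n \<in> borel_measurable ?M" for n
    using G[of n] by (simp add: trig_approximable_def sq_integrable_def)
  note [measurable] = f H(1)
  have fb: "norm (f x) \<le> H x" if "x \<in> {0..<T}" for x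
    by (rule LIMSEQ_le_const2[OF tendsto_norm[OF lim[OF that]]]) (auto intro: bound[OF that])
  have H0: "0 \<le> H x" if "x \<in> {0..<T}" for x
    using bound[OF that, of 0] norm_ge_zero order_trans by blast
  show fs: "sq_integrable ?M f"
    unfolding sq_integrable_def
  proof (intro conjI f)
    show "integrable ?M (\<lambda>x. (norm (f x))\<^sup>2)"
      by (rule Bochner_Integration.integrable_bound[OF H(2)])
         (auto simp: sp intro!: AE_I2 power_mono fb)
  qed
  have "(\<lambda>n. \<integral>x. (norm (f x - G n x))\<^sup>2 \<partial>?M) \<longlonglongrightarrow> (\<integral>x. 0 \<partial>?M)"
  proof (rule integral_dominated_convergence[where w = "\<lambda>x. 4 * (H x)\<^sup>2"])
    show "AE x in ?M. (\<lambda>n. (norm (f x - G n x))\<^sup>2) \<longlonglongrightarrow> 0"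
    proof (intro AE_I2)
      fix x assume "x \<in> space ?M"
      then have "(\<lambda>n. (norm (f x - G n x))\<^sup>2) \<longlonglongrightarrow> (norm (f x - f x))\<^sup>2"
        by (intro tendsto_intros lim) (simp add: sp)
      then show "(\<lambda>n. (norm (f x - G n x))\<^sup>2) \<longlonglongrightarrow> 0" by simp
    qed
    show "AE x in ?M. norm ((norm (f x - G n x))\<^sup>2) \<le> 4 * (H x)\<^sup>2" for n
    proof (intro AE_I2)
      fix x assume x: "x \<in> space ?M"
      then have "norm (f x - G n x) \<le> 2 * H x"
        using fb[of x] bound[of x n] norm_triangle_ineq4[of "f x" "G n x"] by (simp add: sp)
      then have "(norm (f x - G n x))\<^sup>2 \<le> (2 * H x)\<^sup>2" by (intro power_mono) auto
      then show "norm ((norm (f x - G n x))\<^sup>2) \<le> 4 * (H x)\<^sup>2" by (simp add: power_mult_distrib)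
    qed
  qed (use H in simp_all)
  then have *: "(\<lambda>n. \<integral>x. (norm (f x - G n x))\<^sup>2 \<partial>?M) \<longlonglongrightarrow> 0" by simp
  fix e :: real assume "e > 0"
  with * have "eventually (\<lambda>n. sqnorm ?M (\<lambda>x. f x - G n x) < e) sequentially"
    by (rule order_tendstoD)
  then show "\<exists>g. trig_approximable T g \<and> sqnorm ?M (\<lambda>x. f x - g x) < e"
    using G eventually_happens'[OF sequentially_bot] by blast
qed

lemma trig_approximable_cmult:
  assumes "trig_approximable T f" shows "trig_approximable T (\<lambda>x. c * f x)"
  unfolding trig_approximable_def
proof (intro conjI allI impI)
  show "sq_integrable (period_space T) (\<lambda>x. c * f x)"
    using assms by (simp add: trig_approximable_def sq_integrable_cmult)
  fix e :: real assume e: "e > 0"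
  define d where "d = (norm c)\<^sup>2 + 1"
  have d: "d > 0" unfolding d_def by (rule add_nonneg_pos) auto
  with e assms obtain p where p: "trig_polynomial T p" "period_sqnorm T (\<lambda>x. f x - p x) < e / d"
    unfolding trig_approximable_def by (meson divide_pos_pos)
  have "period_sqnorm T (\<lambda>x. c * f x - c * p x) = (norm c)\<^sup>2 * period_sqnorm T (\<lambda>x. f x - p x)"
    by (simp add: norm_mult power_mult_distrib flip: right_diff_distrib)
  also have "\<dots> \<le> d * period_sqnorm T (\<lambda>x. f x - p x)"
    by (intro mult_right_mono) (auto simp: d_def)
  also have "\<dots> < e" using p d by (simp add: field_simps)
  finally show "\<exists>q. trig_polynomial T q \<and> period_sqnorm T (\<lambda>x. c * f x - q x) < e"
    using trig_polynomial_mult[OF trig_polynomial_trig[of T c 0] p(1)]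
    by (intro exI[of _ "\<lambda>x. c * p x"]) (simp add: trig_def)
qed

lemma trig_approximable_add:
  assumes f: "trig_approximable T f" and g: "trig_approximable T g"
  shows "trig_approximable T (\<lambda>x. f x + g x)"
  unfolding trig_approximable_def
proof (intro conjI allI impI)
  have fs: "sq_integrable (period_space T) f" and gs: "sq_integrable (period_space T) g"
    using f g by (auto simp: trig_approximable_def)
  then show "sq_integrable (period_space T) (\<lambda>x. f x + g x)" by (rule sq_integrable_add)
  fix e :: real assume "e > 0"
  then have e: "e / 4 > 0" by simp
  obtain p where p: "trig_polynomial T p" "period_sqnorm T (\<lambda>x. f x - p x) < e / 4"
    using f e unfolding trig_approximable_def by meson
  obtain q where q: "trig_polynomial T q" "period_sqnorm T (\<lambda>x. g x - q x) < e / 4"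
    using g e unfolding trig_approximable_def by meson
  have "period_sqnorm T (\<lambda>x. (f x + g x) - (p x + q x))
    = period_sqnorm T (\<lambda>x. (f x - p x) + (g x - q x))" by (simp add: algebra_simps)
  also have "\<dots> \<le> 2 * period_sqnorm T (\<lambda>x. f x - p x) + 2 * period_sqnorm T (\<lambda>x. g x - q x)"
    by (intro integral_norm_add_sq_le sq_integrable_diff fs gs sq_integrable_trig_polynomial p q)
  also have "\<dots> < e" using p q by linarith
  finally show "\<exists>r. trig_polynomial T r \<and> period_sqnorm T (\<lambda>x. (f x + g x) - r x) < e"
    using trig_polynomial_add[OF p(1) q(1)] by blast
qed

lemma trig_approximable_sum:
  assumes "finite I" "\<And>i. i \<in> I \<Longrightarrow> trig_approximable T (f i)"
  shows "trig_approximable T (\<lambda>x. \<Sum>i\<in>I. f i x)"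
  using assms
proof (induction I rule: finite_induct)
  case empty
  show ?case using trig_approximable_polynomial[OF trig_polynomial_trig[of T 0 0]] by simp
next
  case (insert i I)
  then show ?case using trig_approximable_add[of T "f i" "\<lambda>x. \<Sum>i\<in>I. f i x"] by simp
qed


lemma trig_approximable_continuous_circle:
  fixes g :: "complex \<Rightarrow> real"
  assumes "continuous_on (sphere 0 1) g"
  shows "trig_approximable T (\<lambda>x. complex_of_real (g (trig T 1 x)))"
proof -
  have "\<exists>p. real_polynomial_function p \<and> (\<forall>z\<in>sphere 0 1. \<bar>g z - p z\<bar> < 1 / real (Suc n))" for n
    by (rule Stone_Weierstrass_real_polynomial_function[OF compact_sphere assms, of "1 / real (Suc n)"]) auto
  then obtain p :: "nat \<Rightarrow> complex \<Rightarrow> real" where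
    p: "\<And>n. real_polynomial_function (p n)" "\<And>n z. z \<in> sphere 0 1 \<Longrightarrow> \<bar>g z - p n z\<bar> < 1 / real (Suc n)"
    by metis
  have "bounded (g ` sphere 0 1)"
    by (rule compact_imp_bounded[OF compact_continuous_image[OF assms compact_sphere]])
  then obtain B where "\<forall>y\<in>g ` sphere 0 1. norm y \<le> B" unfolding bounded_iff ..
  then have B: "\<bar>g z\<bar> \<le> B" if "z \<in> sphere 0 1" for z
    using that by auto
  show ?thesis
  proof (rule trig_approximable_dominated[where G = "\<lambda>n x. complex_of_real (p n (trig T 1 x))" and H = "\<lambda>_. B + 1"])
    show "trig_approximable T (\<lambda>x. complex_of_real (p n (trig T 1 x)))" for n
      by (intro trig_approximable_polynomial trig_polynomial_real_polynomial p)
    have "continuous_on UNIV (\<lambda>x. g (trig T 1 x))"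
      by (rule continuous_on_compose2[OF assms continuous_trig]) auto
    then have "(\<lambda>x. g (trig T 1 x)) \<in> borel_measurable borel"
      by (rule borel_measurable_continuous_onI)
    then have "(\<lambda>x. complex_of_real (g (trig T 1 x))) \<in> borel_measurable borel" by simp
    then show "(\<lambda>x. complex_of_real (g (trig T 1 x))) \<in> borel_measurable (period_space T)"
      by (intro measurable_restrict_space1) simp
  next
    fix x
    have "(\<lambda>n. p n (trig T 1 x)) \<longlonglongrightarrow> g (trig T 1 x)"
    proof (rule LIMSEQ_I)
      fix r :: real assume "r > 0"
      then obtain N where N: "1 / real (Suc N) < r" using nat_approx_posE by blast
      show "\<exists>no. \<forall>n\<ge>no. norm (p n (trig T 1 x) - g (trig T 1 x)) < r"
      proof (intro exI allI impI)
        fix n assume "N \<le> n"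
        then have "1 / real (Suc n) \<le> 1 / real (Suc N)" by (simp add: frac_le)
        with N p(2)[of "trig T 1 x" n] show "norm (p n (trig T 1 x) - g (trig T 1 x)) < r"
          by (simp add: abs_minus_commute)
      qed
    qed
    then show "(\<lambda>n. complex_of_real (p n (trig T 1 x))) \<longlonglongrightarrow> complex_of_real (g (trig T 1 x))"
      by (rule tendsto_of_real)
  next
    fix n x
    have n1: "1 / real (Suc n) \<le> 1" by simp
    have "\<bar>g (trig T 1 x) - p n (trig T 1 x)\<bar> < 1 / real (Suc n)" "\<bar>g (trig T 1 x)\<bar> \<le> B"
      using p(2) B by simp_all
    with n1 show "norm (complex_of_real (p n (trig T 1 x))) \<le> B + 1"
      unfolding norm_of_real by linarith
  next
    interpret finite_measure "period_space T" by (rule finite_measure_period_space)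
    show "integrable (period_space T) (\<lambda>x. (B + 1)\<^sup>2)" by simp
  qed simp
qed

lemma trig_inj:
  assumes "T > 0" shows "inj_on (trig T 1) {0..<T}"
proof (rule inj_onI)
  fix x y assume xy: "x \<in> {0..<T}" "y \<in> {0..<T}" and eq: "trig T 1 x = trig T 1 y"
  have "\<exists>n::int. 2 * pi * x / T = 2 * pi * y / T + 2 * pi * of_int n"
    using eq by (subst sin_cos_eq_iff[symmetric]) (auto simp: trig_def complex_eq_iff mult_ac)
  then obtain n :: int where "2 * pi * x / T = 2 * pi * y / T + 2 * pi * of_int n" ..
  then have "pi * (x - y) = pi * (of_int n * T)" using assms by (simp add: field_simps)
  then have n: "x - y = of_int n * T" by simp
  have "\<bar>of_int n * T\<bar> < T" using xy n[symmetric] by auto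
  then have "\<bar>of_int n :: real\<bar> < 1" using assms by (simp add: abs_mult)
  then have "n = 0" by linarith
  with n show "x = y" by simp
qed

text \<open>The image of a compact subset of \<open>[0,T)\<close> on the circle is closed, so its indicator is a
  pointwise limit of continuous functions on the circle, and injectivity of the winding map pulls the
  indicator of the image back to that of the original set.\<close>

lemma trig_approximable_indicator_compact:
  assumes "T > 0" and K: "compact K" "K \<subseteq> {0..<T}"
  shows "trig_approximable T (indicator K)"
proof (cases "K = {}")
  case True
  then have "(\<lambda>x. 0 * trig T 0 x) = (indicator K :: real \<Rightarrow> complex)" by (auto simp: fun_eq_iff)
  then show ?thesis using trig_approximable_polynomial[OF trig_polynomial_trig[of T 0 0]] by simp
next
  case False
  define C where "C = trig T 1 ` K"
  have C: "closed C" "C \<noteq> {}"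
    unfolding C_def using False K by (auto intro!: compact_imp_closed compact_continuous_image continuous_trig)
  have mem: "trig T 1 x \<in> C \<longleftrightarrow> x \<in> K" if "x \<in> {0..<T}" for x
    unfolding C_def using trig_inj[OF assms(1)] K that by (auto dest: inj_onD)
  \<comment> \<open>continuous, equal to 1 on the image and decreasing to 0 off it\<close>
  define g where "g n z = max 0 (1 - real n * infdist z C)" for n z
  show ?thesis
  proof (rule trig_approximable_dominated[where G = "\<lambda>n x. complex_of_real (g n (trig T 1 x))" and H = "\<lambda>_. 1"])
    show "trig_approximable T (\<lambda>x. complex_of_real (g n (trig T 1 x)))" for n
      unfolding g_def
      by (intro trig_approximable_continuous_circle continuous_intros)
    have "K \<in> sets borel" using K(1) by (simp add: compact_imp_closed)
    then show "indicator K \<in> borel_measurable (period_space T)"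
      by (intro measurable_restrict_space1) simp
  next
    fix x assume x: "x \<in> {0..<T}"
    have "(\<lambda>n. g n (trig T 1 x)) \<longlonglongrightarrow> (if x \<in> K then 1 else 0)"
    proof (cases "x \<in> K")
      case True
      then show ?thesis using mem[OF x] by (simp add: g_def)
    next
      case False
      let ?d = "infdist (trig T 1 x) C"
      have d: "?d > 0" using mem[OF x] False C by (simp add: infdist_pos_not_in_closed)
      obtain N where N: "1 < real N * ?d" using reals_Archimedean3[OF d] by blast
      have "g n (trig T 1 x) = 0" if "n \<ge> N" for n
      proof -
        have "real N * ?d \<le> real n * ?d" using that d by simp
        with N show ?thesis by (simp add: g_def)
      qed
      then have "eventually (\<lambda>n. g n (trig T 1 x) = 0) sequentially"
        using eventually_sequentially by auto
      then show ?thesis using False by (simp add: tendsto_eventually)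
    qed
    then have "(\<lambda>n. complex_of_real (g n (trig T 1 x))) \<longlonglongrightarrow> complex_of_real (if x \<in> K then 1 else 0)"
      by (rule tendsto_of_real)
    then show "(\<lambda>n. complex_of_real (g n (trig T 1 x))) \<longlonglongrightarrow> indicator K x"
      by (cases "x \<in> K") auto
  next
    fix n x
    show "norm (complex_of_real (g n (trig T 1 x))) \<le> 1"
      by (simp add: g_def infdist_nonneg)
  next
    interpret finite_measure "period_space T" by (rule finite_measure_period_space)
    show "integrable (period_space T) (\<lambda>x. 1\<^sup>2 :: real)" by simp
  qed simp
qed

text \<open>Closed sets generate the Borel sets and are stable under intersection, so a Dynkin argument
  applies. A closed set may accumulate at the missing endpoint \<open>T\<close>; it is exhausted by compact pieces.\<close>

lemma trig_approximable_indicator: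
  assumes T: "T > 0" and "A \<in> sets borel"
  shows "trig_approximable T (indicator A)"
proof -
  interpret finite_measure "period_space T" by (rule finite_measure_period_space)
  have int1: "integrable (period_space T) (\<lambda>x. 1\<^sup>2 :: real)" by simp
  have closed_case: "trig_approximable T (indicator K)" if K: "closed K" for K :: "real set"
  proof (rule trig_approximable_dominated[where G = "\<lambda>n. indicator (K \<inter> {0..T - T / real (Suc n)})" and H = "\<lambda>_. 1"])
    show "trig_approximable T (indicator (K \<inter> {0..T - T / real (Suc n)}))" for n
    proof (intro trig_approximable_indicator_compact closed_Int_compact K T)
      have "T - T / real (Suc n) < T" using T by simp
      then show "K \<inter> {0..T - T / real (Suc n)} \<subseteq> {0..<T}" by (auto intro: le_less_trans)
    qed simp
    show "indicator K \<in> borel_measurable (period_space T)"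
      using K by (intro measurable_restrict_space1) simp
    show "(\<lambda>n. indicator (K \<inter> {0..T - T / real (Suc n)}) x) \<longlonglongrightarrow> (indicator K x :: complex)"
      if x: "x \<in> {0..<T}" for x
    proof (rule tendsto_eventually)
      have "(\<lambda>n. T * inverse (real (Suc n))) \<longlonglongrightarrow> T * 0"
        by (intro tendsto_intros LIMSEQ_inverse_real_of_nat)
      then have "eventually (\<lambda>n. T * inverse (real (Suc n)) < T - x) sequentially"
        using x by (intro order_tendstoD(2)[where y = "T * 0"]) auto
      then show "eventually (\<lambda>n. indicator (K \<inter> {0..T - T / real (Suc n)}) x = (indicator K x :: complex)) sequentially"
      proof eventually_elim
        case (elim n)
        then have "x \<le> T - T / real (Suc n)" by (simp add: divide_inverse)
        then show ?case using x by (auto simp: indicator_def)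
      qed
    qed
  qed (use int1 in \<open>auto simp: indicator_def\<close>)
  have stable: "Int_stable (Collect (closed :: real set \<Rightarrow> bool))" by (auto simp: Int_stable_def)
  have sub: "Collect (closed :: real set \<Rightarrow> bool) \<subseteq> Pow UNIV" by simp
  have "A \<in> sigma_sets UNIV (Collect closed)"
    using assms(2) by (simp add: borel_eq_closed)
  from stable sub this show ?thesis
  proof (induct rule: sigma_sets_induct_disjoint)
    case (basic A)
    then show ?case using closed_case by simp
  next
    case empty
    show ?case using closed_case by blast
  next
    case (compl A)
    from trig_approximable_add[OF closed_case[OF closed_UNIV] trig_approximable_cmult[OF compl(2), of "-1"]]
    show ?case
      by (rule back_subst[of "trig_approximable T"]) (auto simp: indicator_def)
  next
    case D: (union D)
    have Dm: "D i \<in> sets borel" for i using D(2) by (auto simp: borel_eq_closed)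
    show "trig_approximable T (indicator (\<Union>i. D i))"
    proof (rule trig_approximable_dominated[where G = "\<lambda>n x. \<Sum>i<n. indicator (D i) x" and H = "\<lambda>_. 1"])
      show "trig_approximable T (\<lambda>x. \<Sum>i<n. indicator (D i) x)" for n
        using D by (intro trig_approximable_sum) auto
      have eq: "(\<Sum>i<n. indicator (D i) x) = (indicator (\<Union>i<n. D i) x :: complex)" for n x
        using D(1) by (subst indicator_UN_disjoint) (auto simp: disjoint_family_on_def)
      show "norm (\<Sum>i<n. indicator (D i) x :: complex) \<le> 1" for n x
        unfolding eq by (simp add: indicator_def)
      show "(\<lambda>n. \<Sum>i<n. indicator (D i) x) \<longlonglongrightarrow> (indicator (\<Union>i. D i) x :: complex)" for x
        unfolding eq by (rule LIMSEQ_indicator_UN)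
      show "indicator (\<Union>i. D i) \<in> borel_measurable (period_space T)"
        using Dm by (intro measurable_restrict_space1 borel_measurable_indicator sets.countable_UN) auto
    qed (use int1 in auto)
  qed
qed

lemma trig_approximable_cong:
  assumes "trig_approximable T f" "\<And>x. x \<in> {0..<T} \<Longrightarrow> f x = g x"
  shows "trig_approximable T g"
proof -
  have sp: "space (period_space T) = {0..<T}" by (simp add: space_restrict_space)
  have "period_sqnorm T (\<lambda>x. f x - p x) = period_sqnorm T (\<lambda>x. g x - p x)" for p
    by (intro Bochner_Integration.integral_cong refl) (simp add: sp assms(2))
  moreover have "sq_integrable (period_space T) f = sq_integrable (period_space T) g"
    unfolding sq_integrable_def
    by (intro arg_cong2[where f = "(\<and>)"] measurable_cong Bochner_Integration.integrable_cong) (auto simp: sp assms(2))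
  ultimately show ?thesis using assms(1) by (simp add: trig_approximable_def)
qed

theorem trig_polynomials_dense:
  assumes T: "T > 0" and f: "sq_integrable (period_space T) f"
  shows "trig_approximable T f"
proof -
  let ?M = "period_space T"
  have sp: "space ?M = {0..<T}" by (simp add: space_restrict_space)
  from borel_measurable_implies_sequence_metric[OF sq_integrable_measurable[OF f], of 0]
  obtain s where s: "\<And>i. simple_function ?M (s i)" "\<And>x. x \<in> {0..<T} \<Longrightarrow> (\<lambda>i. s i x) \<longlonglongrightarrow> f x"
    "\<And>i x. x \<in> {0..<T} \<Longrightarrow> norm (s i x) \<le> 2 * norm (f x)"
    unfolding sp dist_0_norm dist_commute[of _ 0] by blast
  show ?thesis
  proof (rule trig_approximable_dominated[where G = s and H = "\<lambda>x. 2 * norm (f x)"])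
    show "trig_approximable T (s n)" for n
    proof (rule trig_approximable_cong)
      show "trig_approximable T (\<lambda>x. \<Sum>y\<in>s n ` space ?M. y * indicator (s n -` {y} \<inter> space ?M) x)"
      proof (intro trig_approximable_sum trig_approximable_cmult trig_approximable_indicator T)
        show "finite (s n ` space ?M)" using s(1) by (rule simple_functionD)
        fix y
        have "s n -` {y} \<inter> space ?M \<in> sets ?M" using s(1) by (rule simple_functionD)
        then show "s n -` {y} \<inter> space ?M \<in> sets borel"
          by (simp add: sets_restrict_space_iff)
      qed
      show "(\<Sum>y\<in>s n ` space ?M. y * indicator (s n -` {y} \<inter> space ?M) x) = s n x" if "x \<in> {0..<T}" for x
      proof -
        have "(\<Sum>y\<in>s n ` space ?M. y * indicator (s n -` {y} \<inter> space ?M) x)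
            = (\<Sum>y\<in>s n ` space ?M. indicator (s n -` {y} \<inter> space ?M) x *\<^sub>R y)"
          by (intro sum.cong refl) (simp split: split_indicator)
        also have "\<dots> = s n x"
          by (rule simple_function_indicator_representation_banach[OF s(1), symmetric]) (use that in \<open>simp add: sp\<close>)
        finally show ?thesis .
      qed
    qed
    show "f \<in> borel_measurable ?M" using f by (simp add: sq_integrable_def)
    then show "(\<lambda>x. 2 * norm (f x)) \<in> borel_measurable ?M" by simp
    show "integrable ?M (\<lambda>x. (2 * norm (f x))\<^sup>2)"
      using f by (simp add: sq_integrable_def power_mult_distrib)
  qed (use s in auto)
qed

text \<open>In \<open>trig_distance\<close> the squares \<open>\<bar>T a\<^sub>l - c\<^sub>l\<bar>\<^sup>2\<close> only help, so a polynomial close to \<open>f\<close> forces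
  the coefficients of \<open>f\<close> at its frequencies to exhaust the norm.\<close>

lemma bessel_almost_attained:
  assumes T: "T > 0" and f: "sq_integrable (period_space T) f" and e: "e > 0"
  shows "\<exists>S. finite S \<and> T * period_sqnorm T f - e < (\<Sum>l\<in>S. (norm (fcoeff T f l))\<^sup>2)"
proof -
  have "e / T > 0" using T e by simp
  then obtain S a where S: "finite S"
    "period_sqnorm T (\<lambda>x. f x - (\<Sum>l\<in>S. a l * trig T l x)) < e / T"
    using trig_polynomials_dense[OF T f] unfolding trig_approximable_def trig_polynomial_def by blast
  let ?A = "period_sqnorm T f" and ?B = "\<Sum>l\<in>S. (norm (fcoeff T f l))\<^sup>2"
  have "(\<Sum>l\<in>S. ((norm (of_real T * a l - fcoeff T f l))\<^sup>2 - (norm (fcoeff T f l))\<^sup>2) / T)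
      \<ge> (\<Sum>l\<in>S. - (norm (fcoeff T f l))\<^sup>2 / T)"
    using T by (intro sum_mono divide_right_mono) auto
  also have "(\<Sum>l\<in>S. - (norm (fcoeff T f l))\<^sup>2 / T) = - ?B / T"
    by (simp add: sum_negf sum_divide_distrib)
  finally have "?A - ?B / T < e / T"
    using S(2) unfolding trig_distance[OF T f S(1)] by simp
  then have "T * (?A - ?B / T) < T * (e / T)" using T by (intro mult_strict_left_mono)
  then have "T * ?A - e < ?B"
    using T by (simp add: right_diff_distrib)
  with S(1) show ?thesis by blast
qed

theorem parseval:
  assumes T: "T > 0" and f: "sq_integrable (period_space T) f"
  shows "((\<lambda>l. (norm (fcoeff T f l))\<^sup>2) has_sum T * period_sqnorm T f) UNIV"
proof -
  let ?I = "T * period_sqnorm T f"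
  let ?c = "\<lambda>l. (norm (fcoeff T f l))\<^sup>2"
  have "(sum ?c \<longlongrightarrow> ?I) (finite_subsets_at_top UNIV)"
  proof (rule order_tendstoI)
    fix a assume "a < ?I"
    then obtain S where S: "finite S" "a < sum ?c S"
      using bessel_almost_attained[OF T f, of "?I - a"] by auto
    have "a < sum ?c S'" if "finite S'" "S \<subseteq> S'" for S'
    proof -
      have "sum ?c S \<le> sum ?c S'" by (rule sum_mono2[OF that]) simp
      with S(2) show ?thesis by (rule less_le_trans)
    qed
    with S(1) show "eventually (\<lambda>S. a < sum ?c S) (finite_subsets_at_top UNIV)"
      unfolding eventually_finite_subsets_at_top by blast
  next
    fix a assume "?I < a"
    show "eventually (\<lambda>S. sum ?c S < a) (finite_subsets_at_top UNIV)"
    proof (rule eventually_finite_subsets_at_top_weakI)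
      fix S :: "int set" assume "finite S"
      from bessel_partial[OF T f this] \<open>?I < a\<close> show "sum ?c S < a" by (rule le_less_trans)
    qed
  qed
  then show ?thesis by (simp add: has_sum_def)
qed

section \<open>The hat function, its derivative and their autocorrelations\<close>

definition hat :: "real \<Rightarrow> real" where
  "hat x = max 0 (1 - \<bar>x\<bar>)"

text \<open>With closed intervals the two values at \<open>0\<close> cancel, so the function is odd at every point; the
  reflection of half cells relies on this.\<close>

definition hat_deriv :: "real \<Rightarrow> real" where
  "hat_deriv x = indicator {-1..0} x - indicator {0..1} x"

lemma interval_overlap:
  "has_bochner_integral lborel (\<lambda>x. indicator {a..b} x * indicator {c..d} x :: real)
     (max 0 (min b d - max a c))"
proof -
  have "has_bochner_integral lborel (indicator {max a c..min b d} :: real \<Rightarrow> real)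
      (measure lborel {max a c..min b d})"
    by (rule has_bochner_integral_real_indicator) (auto simp: emeasure_lborel_Icc_eq)
  moreover have "indicator {max a c..min b d} = (\<lambda>x. indicator {a..b} x * indicator {c..d} x :: real)"
    by (auto simp: fun_eq_iff indicator_def)
  moreover have "measure lborel {max a c..min b d} = max 0 (min b d - max a c)"
    by (cases "max a c \<le> min b d") (auto simp: max_def)
  ultimately show ?thesis by simp
qed

lemma bspline_2: "bspline 2 = hat"
proof
  fix x :: real
  have "bspline 2 x = (\<integral>y. indicator {x - 1/2..x + 1/2} y * indicator {-1/2..1/2} y \<partial>lborel)"
    unfolding numeral_2_eq_2 bspline.simps
    by (intro Bochner_Integration.integral_cong refl) (auto simp: indicator_def)
  also have "\<dots> = max 0 (min (x + 1/2) (1/2) - max (x - 1/2) (-1/2))"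
    by (rule has_bochner_integral_integral_eq[OF interval_overlap])
  also have "\<dots> = hat x"
    by (auto simp: hat_def max_def min_def abs_if field_simps)
  finally show "bspline 2 x = hat x" .
qed

lemma hat_conv_ramp: "hat x = max 0 (x + 1) - 2 * max 0 x + max 0 (x - 1)"
  by (auto simp: hat_def max_def abs_if)

text \<open>At the kink \<open>0\<close> the difference quotient equals \<open>max 0 x ^ (n + 1)\<close>, which tends to \<open>0\<close>; elsewhere the
  function is locally a power or zero.\<close>

lemma ramp_power_deriv:
  "((\<lambda>x. max 0 x ^ Suc (Suc n)) has_real_derivative (real (Suc (Suc n)) * max 0 z ^ Suc n)) (at z)"
proof -
  consider "z < 0" | "z > 0" | "z = 0" by linarith
  then show ?thesis
  proof cases
    case 1
    have "((\<lambda>x. 0) has_real_derivative 0) (at z)" by simp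
    from has_field_derivative_transform_within_open[OF this, of "{..<0}" "\<lambda>x. max 0 x ^ Suc (Suc n)"] 1
    show ?thesis by simp
  next
    case 2
    have "((\<lambda>x. x ^ Suc (Suc n)) has_real_derivative (real (Suc (Suc n)) * z ^ Suc n)) (at z)"
      using DERIV_pow[of "Suc (Suc n)" z] by simp
    from has_field_derivative_transform_within_open[OF this, of "{0<..}" "\<lambda>x. max 0 x ^ Suc (Suc n)"] 2
    show ?thesis by simp
  next
    case 3
    have "((\<lambda>h. max 0 h ^ Suc n) \<longlongrightarrow> max 0 0 ^ Suc n) (at (0::real))"
      by (intro tendsto_intros)
    then have "((\<lambda>h. (max 0 (z + h) ^ Suc (Suc n) - max 0 z ^ Suc (Suc n)) / h) \<longlongrightarrow> max 0 0 ^ Suc n) (at (0::real))"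
      by (rule Lim_transform_within[OF _ zero_less_one]) (use 3 in \<open>auto simp: max_def\<close>)
    then show ?thesis
      unfolding DERIV_def using 3 by simp
  qed
qed

lemma ramp_deriv [derivative_intros]:
  assumes "(f has_real_derivative f') (at z)"
  shows "((\<lambda>x. max 0 (f x) ^ 2) has_real_derivative 2 * max 0 (f z) * f') (at z)"
    and "((\<lambda>x. max 0 (f x) ^ 3) has_real_derivative 3 * max 0 (f z) ^ 2 * f') (at z)"
  using DERIV_chain2[OF ramp_power_deriv[of 0] assms] DERIV_chain2[OF ramp_power_deriv[of 1] assms]
  by (simp_all add: eval_nat_numeral)

text \<open>Convolution with \<open>Q\<^sub>1\<close> is a difference of antiderivatives. Since truncated powers integrate to
  truncated powers, two applications to \<open>Q\<^sub>2\<close> give explicit formulas for \<open>Q\<^sub>3\<close> and \<open>Q\<^sub>4\<close>.\<close>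

lemma box_convolution:
  assumes F: "\<And>z. (F has_real_derivative f z) (at z)" and f: "continuous_on UNIV f"
  shows "(\<integral>y. f (x - y) * indicator {-1/2..1/2} y \<partial>lborel) = F (x + 1/2) - F (x - 1/2)"
proof -
  have "(\<integral>y. f (x - y) * indicator {-1/2..1/2} y \<partial>lborel) = - F (x - 1/2) - (- F (x - (-1/2)))"
  proof (rule integral_FTC_Icc_real)
    fix y :: real
    show "((\<lambda>y. - F (x - y)) has_real_derivative f (x - y)) (at y)"
      by (auto intro!: derivative_eq_intros DERIV_chain2[OF F])
    show "isCont (\<lambda>y. f (x - y)) y"
      using f by (intro isCont_o2[where f = "\<lambda>y. x - y" and g = f]) (auto simp: continuous_on_eq_continuous_at)
  qed simp
  then show ?thesis by simp
qed

lemma bspline_3: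
  "bspline 3 x = (max 0 (x + 3/2) ^ 2 - 3 * max 0 (x + 1/2) ^ 2 + 3 * max 0 (x - 1/2) ^ 2
     - max 0 (x - 3/2) ^ 2) / 2"
proof -
  have "bspline 3 x = (\<integral>y. hat (x - y) * indicator {-1/2..1/2} y \<partial>lborel)"
    using bspline_2 by (simp add: numeral_3_eq_3 numeral_2_eq_2)
  also have "\<dots> = (\<lambda>x. (max 0 (x + 1) ^ 2 - 2 * max 0 x ^ 2 + max 0 (x - 1) ^ 2) / 2) (x + 1/2)
     - (\<lambda>x. (max 0 (x + 1) ^ 2 - 2 * max 0 x ^ 2 + max 0 (x - 1) ^ 2) / 2) (x - 1/2)"
    by (rule box_convolution)
       (auto intro!: derivative_eq_intros continuous_intros simp: hat_conv_ramp)
  also have "\<dots> = (max 0 (x + 3/2) ^ 2 - 3 * max 0 (x + 1/2) ^ 2 + 3 * max 0 (x - 1/2) ^ 2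
     - max 0 (x - 3/2) ^ 2) / 2"
    by (simp add: field_simps)
  finally show ?thesis .
qed

lemma bspline_4:
  "bspline 4 x = (max 0 (x + 2) ^ 3 - 4 * max 0 (x + 1) ^ 3 + 6 * max 0 x ^ 3
     - 4 * max 0 (x - 1) ^ 3 + max 0 (x - 2) ^ 3) / 6"
proof -
  let ?f = "\<lambda>x::real. (max 0 (x + 3/2) ^ 2 - 3 * max 0 (x + 1/2) ^ 2 + 3 * max 0 (x - 1/2) ^ 2
     - max 0 (x - 3/2) ^ 2) / 2"
  let ?F = "\<lambda>x::real. (max 0 (x + 3/2) ^ 3 - 3 * max 0 (x + 1/2) ^ 3 + 3 * max 0 (x - 1/2) ^ 3
     - max 0 (x - 3/2) ^ 3) / 6"
  have four: "4 = Suc (Suc 2)" by simp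
  have "bspline 4 x = (\<integral>y. bspline 3 (x - y) * indicator {-1/2..1/2} y \<partial>lborel)"
    unfolding four numeral_2_eq_2 numeral_3_eq_3 by simp
  also have "\<dots> = (\<integral>y. ?f (x - y) * indicator {-1/2..1/2} y \<partial>lborel)"
    unfolding bspline_3 ..
  also have "\<dots> = ?F (x + 1/2) - ?F (x - 1/2)"
    by (rule box_convolution) (auto intro!: derivative_eq_intros continuous_intros simp: field_simps)
  also have "\<dots> = (max 0 (x + 2) ^ 3 - 4 * max 0 (x + 1) ^ 3 + 6 * max 0 x ^ 3
     - 4 * max 0 (x - 1) ^ 3 + max 0 (x - 2) ^ 3) / 6"
    by (simp add: algebra_simps add_divide_distrib diff_divide_distrib)
  finally show ?thesis .
qed

text \<open>The two closed pieces overlap in \<open>0\<close>, where the sum is twice the hat; hence equality only almost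
  everywhere.\<close>

lemma hat_pieces:
  fixes f :: "real \<Rightarrow> 'a::{banach, second_countable_topology}"
  shows "AE x in lborel. indicator {-1..0} x *\<^sub>R ((1 + x) *\<^sub>R f x) + indicator {0..1} x *\<^sub>R ((1 - x) *\<^sub>R f x) = hat x *\<^sub>R f x"
  using AE_lborel_singleton[of 0]
  by eventually_elim (auto simp: hat_def indicator_def abs_if)

lemma continuous_hat: "continuous_on A hat"
  unfolding hat_def[abs_def] by (intro continuous_intros)

lemma hat_measurable [measurable]: "hat \<in> borel_measurable borel"
  by (rule borel_measurable_continuous_onI[OF continuous_hat])

lemma hat_deriv_measurable [measurable]: "hat_deriv \<in> borel_measurable borel"
  unfolding hat_deriv_def[abs_def] by measurable

lemma hat_nonneg: "0 \<le> hat x" and hat_le_1: "hat x \<le> 1" and hat_eq_0: "\<bar>x\<bar> \<ge> 1 \<Longrightarrow> hat x = 0"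
  and hat_minus: "hat (- x) = hat x"
  by (auto simp: hat_def)

text \<open>Integration by parts on both linear pieces: if \<open>G'' = \<phi>\<close>, then
  \<open>\<integral> \<phi>(x) G''(x + s) dx = G(s + 1) - 2 G(s) + G(s - 1)\<close>. With the cubic \<open>G\<close> this is
  the truncated power formula for \<open>Q\<^sub>4(s)\<close>.\<close>

lemma hat_autocorrelation: "(\<integral>x. hat x * hat (x + s) \<partial>lborel) = bspline 4 s"
proof -
  define G where "G x = (max 0 (x + 1) ^ 3 - 2 * max 0 x ^ 3 + max 0 (x - 1) ^ 3) / 6" for x :: real
  define G' where "G' x = (max 0 (x + 1) ^ 2 - 2 * max 0 x ^ 2 + max 0 (x - 1) ^ 2) / 2" for x :: real
  have G: "(G has_real_derivative G' x) (at x)" for x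
    unfolding G_def[abs_def] G'_def by (auto intro!: derivative_eq_intros simp: field_simps)
  have G': "(G' has_real_derivative hat x) (at x)" for x
    unfolding G'_def[abs_def] hat_conv_ramp by (auto intro!: derivative_eq_intros simp: field_simps)
  have "has_bochner_integral lborel (\<lambda>x. indicator {-1..0} x *\<^sub>R ((1 + x) *\<^sub>R hat (x + s)))
     ((1 + 0) * G' (0 + s) - G (0 + s) - ((1 + (-1)) * G' (-1 + s) - G (-1 + s)))"
  proof (rule has_bochner_integral_FTC_Icc)
    fix x
    show "((\<lambda>x. (1 + x) * G' (x + s) - G (x + s)) has_vector_derivative (1 + x) *\<^sub>R hat (x + s)) (at x within {-1..0})"
      unfolding has_real_derivative_iff_has_vector_derivative[symmetric]
      by (rule DERIV_subset[where s = UNIV])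
         (auto intro!: derivative_eq_intros DERIV_chain2[OF G] DERIV_chain2[OF G'])
  qed (auto intro!: continuous_intros continuous_on_compose2[OF continuous_hat])
  moreover have "has_bochner_integral lborel (\<lambda>x. indicator {0..1} x *\<^sub>R ((1 - x) *\<^sub>R hat (x + s)))
     ((1 - 1) * G' (1 + s) + G (1 + s) - ((1 - 0) * G' (0 + s) + G (0 + s)))"
  proof (rule has_bochner_integral_FTC_Icc)
    fix x
    show "((\<lambda>x. (1 - x) * G' (x + s) + G (x + s)) has_vector_derivative (1 - x) *\<^sub>R hat (x + s)) (at x within {0..1})"
      unfolding has_real_derivative_iff_has_vector_derivative[symmetric]
      by (rule DERIV_subset[where s = UNIV])
         (auto intro!: derivative_eq_intros DERIV_chain2[OF G] DERIV_chain2[OF G'])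
  qed (auto intro!: continuous_intros continuous_on_compose2[OF continuous_hat])
  ultimately have "has_bochner_integral lborel (\<lambda>x. indicator {-1..0} x *\<^sub>R ((1 + x) *\<^sub>R hat (x + s)) + indicator {0..1} x *\<^sub>R ((1 - x) *\<^sub>R hat (x + s)))
     (G (s + 1) - 2 * G s + G (s - 1))"
    by (rule has_bochner_integral_add[THEN back_subst[of "has_bochner_integral lborel _"]]) (simp add: algebra_simps)
  then have "(\<integral>x. indicator {-1..0} x *\<^sub>R ((1 + x) *\<^sub>R hat (x + s)) + indicator {0..1} x *\<^sub>R ((1 - x) *\<^sub>R hat (x + s)) \<partial>lborel) = G (s + 1) - 2 * G s + G (s - 1)"
    by (rule has_bochner_integral_integral_eq)
  moreover have "(\<integral>x. indicator {-1..0} x *\<^sub>R ((1 + x) *\<^sub>R hat (x + s)) + indicator {0..1} x *\<^sub>R ((1 - x) *\<^sub>R hat (x + s)) \<partial>lborel) = (\<integral>x. hat x *\<^sub>R hat (x + s) \<partial>lborel)"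
    by (rule integral_cong_AE[OF _ _ hat_pieces]) measurable
  moreover have "G (s + 1) - 2 * G s + G (s - 1) = bspline 4 s"
    unfolding G_def bspline_4 by (simp add: field_simps)
  ultimately show ?thesis by simp
qed

lemma bspline_4_minus: "bspline 4 (- s) = bspline 4 s"
proof -
  have "(\<integral>x. hat x * hat (x + - s) \<partial>lborel) = (\<integral>x. hat (s + x) * hat x \<partial>lborel)"
    using lborel_integral_real_affine[of 1 "\<lambda>x. hat x * hat (x + - s)" s] by simp
  moreover have "(\<integral>x. hat (s + x) * hat x \<partial>lborel) = bspline 4 s"
    using hat_autocorrelation[of s] by (simp only: mult.commute add.commute)
  ultimately show ?thesis by (simp only: hat_autocorrelation)
qed

lemma bspline_4_values:
  "0 \<le> s \<Longrightarrow> s \<le> 1 \<Longrightarrow> bspline 4 s = (4 - 6 * s ^ 2 + 3 * s ^ 3) / 6"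
  "1 \<le> s \<Longrightarrow> s \<le> 2 \<Longrightarrow> bspline 4 s = (2 - s) ^ 3 / 6"
  "2 \<le> s \<Longrightarrow> bspline 4 s = 0"
  unfolding bspline_4 by (auto simp: max_def power3_eq_cube power2_eq_square field_simps)

text \<open>Expanding the product leaves four overlaps of unit intervals, each of them a hat function.\<close>

lemma hat_deriv_autocorrelation:
  "(\<integral>x. hat_deriv x * hat_deriv (x + s) \<partial>lborel) = 2 * hat s - hat (s - 1) - hat (s + 1)"
proof -
  let ?I = "\<lambda>a b x. indicator {a..b} x :: real"
  have eq: "hat_deriv x * hat_deriv (x + s) =
      ?I (-1) 0 x * ?I (-1 - s) (-s) x - ?I (-1) 0 x * ?I (-s) (1-s) x
      - ?I 0 1 x * ?I (-1 - s) (-s) x + ?I 0 1 x * ?I (-s) (1-s) x" for x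
    unfolding hat_deriv_def by (auto simp: indicator_def algebra_simps)
  have "has_bochner_integral lborel (\<lambda>x. hat_deriv x * hat_deriv (x + s))
     (max 0 (min 0 (-s) - max (-1) (-1-s)) - max 0 (min 0 (1-s) - max (-1) (-s))
       - max 0 (min 1 (-s) - max 0 (-1-s)) + max 0 (min 1 (1-s) - max 0 (-s)))"
    unfolding eq by (intro has_bochner_integral_add has_bochner_integral_diff interval_overlap)
  then have "(\<integral>x. hat_deriv x * hat_deriv (x + s) \<partial>lborel) =
     (max 0 (min 0 (-s) - max (-1) (-1-s)) - max 0 (min 0 (1-s) - max (-1) (-s))
       - max 0 (min 1 (-s) - max 0 (-1-s)) + max 0 (min 1 (1-s) - max 0 (-s)))"
    by (rule has_bochner_integral_integral_eq)
  also have "\<dots> = 2 * hat s - hat (s - 1) - hat (s + 1)"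
    by (auto simp: hat_def max_def min_def abs_if)
  finally show ?thesis .
qed

lemma hat_increment:
  assumes "0 \<le> s"
  shows "has_bochner_integral lborel (\<lambda>t. indicator {0..s} t * hat_deriv (y + t)) (hat (y + s) - hat y)"
proof -
  let ?I = "\<lambda>a b x. indicator {a..b} x :: real"
  have eq: "indicator {0..s} t * hat_deriv (y + t) =
      ?I 0 s t * ?I (-1 - y) (-y) t - ?I 0 s t * ?I (-y) (1-y) t" for t
    unfolding hat_deriv_def by (auto simp: indicator_def algebra_simps)
  have "has_bochner_integral lborel (\<lambda>t. indicator {0..s} t * hat_deriv (y + t))
     (max 0 (min s (-y) - max 0 (-1-y)) - max 0 (min s (1-y) - max 0 (-y)))"
    unfolding eq by (intro has_bochner_integral_diff interval_overlap)
  also have "(max 0 (min s (-y) - max 0 (-1-y)) - max 0 (min s (1-y) - max 0 (-y))) = hat (y + s) - hat y"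
    using assms by (auto simp: hat_def max_def min_def abs_if)
  finally show ?thesis .
qed

text \<open>The fundamental theorem on \<open>[-1,0]\<close> and \<open>[0,1]\<close> for \<open>\<phi> e\<close>, where \<open>e' = -2 \<pi> i w e\<close>: the boundary
  values of the two pieces cancel.\<close>

lemma fourier_hat_deriv:
  "fourier (\<lambda>x. complex_of_real (hat_deriv x)) w = 2 * pi * \<i> * w * fourier (\<lambda>x. complex_of_real (hat x)) w"
proof -
  define c where "c = 2 * complex_of_real pi * \<i> * w"
  define e where "e x = exp (- c * complex_of_real x)" for x
  have e: "(e has_vector_derivative - c * e x) (at x within A)" for x A
  proof -
    have "((\<lambda>z. exp (- c * z)) has_field_derivative - c * exp (- c * complex_of_real x)) (at (complex_of_real x))"
      by (auto intro!: derivative_eq_intros)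
    from has_vector_derivative_real_field[OF this, of A] show ?thesis unfolding e_def[abs_def] .
  qed
  have ce: "continuous_on A e" for A
    unfolding e_def by (intro continuous_intros)
  have left: "has_bochner_integral lborel (\<lambda>x. indicator {-1..0} x *\<^sub>R (e x - c * ((1 + x) *\<^sub>R e x)))
     ((1 + 0) *\<^sub>R e 0 - (1 + (-1)) *\<^sub>R e (-1))"
    by (rule has_bochner_integral_FTC_Icc)
       (auto intro!: derivative_eq_intros e continuous_intros ce simp: algebra_simps)
  have right: "has_bochner_integral lborel (\<lambda>x. indicator {0..1} x *\<^sub>R (- e x - c * ((1 - x) *\<^sub>R e x)))
     ((1 - 1) *\<^sub>R e 1 - (1 - 0) *\<^sub>R e 0)"
    by (rule has_bochner_integral_FTC_Icc)
       (auto intro!: derivative_eq_intros e continuous_intros ce simp: algebra_simps)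
  have eb [measurable]: "e \<in> borel_measurable borel" by (rule borel_measurable_continuous_onI[OF ce])
  have norm_e: "norm (e x) = 1" for x unfolding e_def c_def by (simp add: norm_exp_eq_Re)
  have int: "integrable lborel (\<lambda>x. complex_of_real (f x) * e x)"
    if f: "f \<in> borel_measurable borel" "\<And>x. \<bar>f x\<bar> \<le> indicator {-1..1} x" for f
  proof (rule Bochner_Integration.integrable_bound)
    show "integrable lborel (indicator {-1..1::real} :: real \<Rightarrow> real)" by simp
    show "AE x in lborel. norm (complex_of_real (f x) * e x) \<le> norm (indicator {-1..1} x :: real)"
      using f(2) by (auto simp: norm_mult norm_e)
  qed (use f in measurable)
  have i1: "integrable lborel (\<lambda>x. complex_of_real (hat_deriv x) * e x)"
    by (rule int) (auto simp: hat_deriv_def indicator_def)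
  have i2: "integrable lborel (\<lambda>x. complex_of_real (hat x) * e x)"
    by (rule int) (auto simp: hat_def indicator_def)
  have "has_bochner_integral lborel (\<lambda>x. indicator {-1..0} x *\<^sub>R (e x - c * ((1 + x) *\<^sub>R e x)) +
      indicator {0..1} x *\<^sub>R (- e x - c * ((1 - x) *\<^sub>R e x))) 0"
    using has_bochner_integral_add[OF left right] by simp
  then have "(\<integral>x. indicator {-1..0} x *\<^sub>R (e x - c * ((1 + x) *\<^sub>R e x)) +
      indicator {0..1} x *\<^sub>R (- e x - c * ((1 - x) *\<^sub>R e x)) \<partial>lborel) = 0"
    by (rule has_bochner_integral_integral_eq)
  also have "(\<integral>x. indicator {-1..0} x *\<^sub>R (e x - c * ((1 + x) *\<^sub>R e x)) +
      indicator {0..1} x *\<^sub>R (- e x - c * ((1 - x) *\<^sub>R e x)) \<partial>lborel)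
     = (\<integral>x. complex_of_real (hat_deriv x) * e x - c * (complex_of_real (hat x) * e x) \<partial>lborel)"
  proof (rule integral_cong_AE)
    show "AE x in lborel. indicator {-1..0} x *\<^sub>R (e x - c * ((1 + x) *\<^sub>R e x)) +
      indicator {0..1} x *\<^sub>R (- e x - c * ((1 - x) *\<^sub>R e x))
      = complex_of_real (hat_deriv x) * e x - c * (complex_of_real (hat x) * e x)"
      using AE_lborel_singleton[of 0]
      by eventually_elim (auto simp: hat_def hat_deriv_def indicator_def abs_if scaleR_conv_of_real)
  qed measurable
  also have "\<dots> = (\<integral>x. complex_of_real (hat_deriv x) * e x \<partial>lborel) - c * (\<integral>x. complex_of_real (hat x) * e x \<partial>lborel)"
    using i1 i2 by simp
  finally show ?thesis
    unfolding fourier_def e_def c_def by (simp add: mult_ac)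
qed

section \<open>The symbols are extremal at \<open>\<pi>\<close>\<close>

text \<open>The autocorrelation of \<open>\<phi>'\<close>, which is \<open>-Q\<^sub>4''\<close>.\<close>

definition deriv_corr :: "real \<Rightarrow> real" where
  "deriv_corr s = 2 * hat s - hat (s - 1) - hat (s + 1)"

text \<open>The range \<open>\<bar>j\<bar> \<le> 3\<close> suffices for a function that vanishes outside \<open>(-2,2)\<close> as long as \<open>h > 1/2\<close>.\<close>

definition symbol :: "(real \<Rightarrow> real) \<Rightarrow> real \<Rightarrow> real \<Rightarrow> real" where
  "symbol a h \<theta> = (\<Sum>j\<in>{-3..3::int}. a (of_int j * h) * cos (of_int j * \<theta>))"

lemma deriv_corr_minus: "deriv_corr (- s) = deriv_corr s"
  using hat_minus[of s] hat_minus[of "s + 1"] hat_minus[of "s - 1"]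
  by (simp add: deriv_corr_def)

text \<open>A cosine polynomial of degree three in the variable \<open>c = cos \<theta>\<close>, that is,
  \<open>a\<^sub>0 + 2 (a\<^sub>1 T\<^sub>1(c) + a\<^sub>2 T\<^sub>2(c) + a\<^sub>3 T\<^sub>3(c))\<close> with Chebyshev polynomials \<open>T\<^sub>j\<close>.\<close>

definition cheb3 :: "real \<Rightarrow> real \<Rightarrow> real \<Rightarrow> real \<Rightarrow> real \<Rightarrow> real" where
  "cheb3 a0 a1 a2 a3 c = a0 + 2 * (a1 * c + a2 * (2 * c ^ 2 - 1) + a3 * (4 * c ^ 3 - 3 * c))"

lemma symbol_cheb3:
  assumes "\<And>s. a (- s) = a s"
  shows "symbol a h \<theta> = cheb3 (a 0) (a h) (a (2 * h)) (a (3 * h)) (cos \<theta>)"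
proof -
  have "{-3..3::int} = {-3,-2,-1,0,1,2,3}" by auto
  then have "symbol a h \<theta> = a 0 + 2 * (a h * cos \<theta> + a (2 * h) * cos (2 * \<theta>) + a (3 * h) * cos (3 * \<theta>))"
    using assms[of h] assms[of "2 * h"] assms[of "3 * h"] by (simp add: symbol_def algebra_simps)
  then show ?thesis by (simp add: cheb3_def cos_double_cos cos_treble_cos)
qed

lemma cheb3_add_1_factor:
  "cheb3 a0 a1 a2 a3 c = cheb3 a0 a1 a2 a3 (-1) + (1 + c) * (2 * a1 - 4 * a2 + 2 * a3 + (4 * a2 - 8 * a3) * c + 8 * a3 * c ^ 2)"
  by (simp add: cheb3_def power2_eq_square power3_eq_cube algebra_simps)

definition extremal_at_minus_one :: "(real \<Rightarrow> real) \<Rightarrow> (real \<Rightarrow> real) \<Rightarrow> bool" where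
  "extremal_at_minus_one N D \<longleftrightarrow> D (-1) > 0 \<and>
     (\<forall>c. -1 \<le> c \<longrightarrow> c \<le> 1 \<longrightarrow> D (-1) \<le> D c \<and> N c * D (-1) \<le> N (-1) * D c)"

text \<open>The range \<open>1 \<le> h \<le> 2\<close> with \<open>r = 2 - h\<close>, where only neighbouring translates interact. Taking \<open>r = 0\<close>
  covers \<open>h \<ge> 2\<close>.\<close>

lemma extremal_wide:
  assumes "0 \<le> r" "r \<le> 1"
  shows "extremal_at_minus_one (cheb3 2 (- r) 0 0) (cheb3 (2/3) (r ^ 3 / 6) 0 0)"
  unfolding extremal_at_minus_one_def
proof (intro conjI allI impI)
  have r3: "r ^ 3 \<le> 1" "0 \<le> r ^ 3" using assms by (auto intro: power_le_one)
  show "cheb3 (2/3) (r ^ 3 / 6) 0 0 (-1) > 0" using r3 by (simp add: cheb3_def)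
  fix c :: real assume "-1 \<le> c" "c \<le> 1"
  then obtain d where d: "1 + c = d" "0 \<le> d" by auto
  have "0 \<le> r ^ 3 * (1 + c)" using d r3 by simp
  then show "cheb3 (2/3) (r ^ 3 / 6) 0 0 (-1) \<le> cheb3 (2/3) (r ^ 3 / 6) 0 0 c"
    by (simp add: cheb3_def algebra_simps)
  have "cheb3 2 (- r) 0 0 (-1) * cheb3 (2/3) (r ^ 3 / 6) 0 0 c - cheb3 2 (- r) 0 0 c * cheb3 (2/3) (r ^ 3 / 6) 0 0 (-1)
     = (1 + c) * (4 / 3 * r + 2 / 3 * r ^ 3)"
    by (simp add: cheb3_def field_simps power3_eq_cube)
  moreover have "0 \<le> (1 + c) * (4 / 3 * r + 2 / 3 * r ^ 3)" using d assms by simp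
  ultimately show "cheb3 2 (- r) 0 0 c * cheb3 (2/3) (r ^ 3 / 6) 0 0 (-1) \<le> cheb3 2 (- r) 0 0 (-1) * cheb3 (2/3) (r ^ 3 / 6) 0 0 c"
    by linarith
qed

text \<open>The range \<open>2/3 \<le> h \<le> 1\<close> with \<open>a = 1 - h\<close>. After division by \<open>1 + c\<close> the difference is linear in
  \<open>c\<close>; written in terms of \<open>1 + c\<close>, both of its coefficients are nonnegative.\<close>

lemma extremal_middle:
  assumes "0 \<le> a" "a \<le> 1/3"
  shows "extremal_at_minus_one (cheb3 2 (3 * a - 1) (- 2 * a) 0)
     (cheb3 (2/3) ((1 + 3 * a + 3 * a ^ 2 - 3 * a ^ 3) / 6) (4 * a ^ 3 / 3) 0)"
    (is "extremal_at_minus_one ?N ?D")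
  unfolding extremal_at_minus_one_def
proof (intro conjI allI impI)
  have a2: "0 \<le> a ^ 2" "a ^ 2 \<le> a / 3" and a3: "0 \<le> a ^ 3" "a ^ 3 \<le> a ^ 2 / 3" and a4: "0 \<le> a ^ 4" "a ^ 4 \<le> a ^ 3 / 3"
    using assms mult_left_mono[of a "1/3" a] mult_left_mono[of a "1/3" "a ^ 2"] mult_left_mono[of a "1/3" "a ^ 3"]
    by (simp_all add: eval_nat_numeral algebra_simps)
  have "?D (-1) = (1 - 3 * a) * (1 / 3 - a ^ 2) + 2 / 3 * a ^ 3"
    by (simp add: cheb3_def field_simps eval_nat_numeral)
  moreover have "0 \<le> (1 - 3 * a) * (1 / 3 - a ^ 2)" using assms a2 by simp
  moreover have "1 / 3 - a ^ 2 > 0" "1 - 3 * a > 0 \<or> a ^ 3 > 0" using assms a2 by auto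
  ultimately show "?D (-1) > 0"
    using a3 assms mult_pos_pos[of "1 - 3 * a" "1 / 3 - a ^ 2"] by linarith
  fix c :: real assume "-1 \<le> c" "c \<le> 1"
  then obtain d where d: "1 + c = d" "0 \<le> d" by auto
  have "?D c = ?D (-1) + (1 + c) * ((1 / 3 + a + a ^ 2 - 35 / 3 * a ^ 3) + 16 / 3 * a ^ 3 * (1 + c))"
    unfolding cheb3_add_1_factor[of _ _ _ _ c] by (simp add: field_simps)
  moreover have "0 \<le> (1 + c) * ((1 / 3 + a + a ^ 2 - 35 / 3 * a ^ 3) + 16 / 3 * a ^ 3 * (1 + c))"
    unfolding d(1) using d a2 a3 assms by (intro mult_nonneg_nonneg add_nonneg_nonneg) auto
  ultimately show "?D (-1) \<le> ?D c" by linarith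
  have "?N (-1) * ?D c - ?N c * ?D (-1) =
      (1 + c) * (((1 - 3 * a) * (2 - 8 / 3 * a + 6 * a ^ 2 - 28 / 3 * a ^ 3) + 8 * a ^ 4)
        + 8 / 3 * a * (1 - 3 * a + a ^ 2 * (5 - 9 * a)) * (1 + c))"
    by (simp add: cheb3_def field_simps eval_nat_numeral)
  moreover have "0 \<le> (1 - 3 * a) * (2 - 8 / 3 * a + 6 * a ^ 2 - 28 / 3 * a ^ 3) + 8 * a ^ 4"
  proof -
    have "0 \<le> 2 - 8 / 3 * a + 6 * a ^ 2 - 28 / 3 * a ^ 3" using a2 a3 assms by linarith
    then show ?thesis using a4 assms by (intro mult_nonneg_nonneg add_nonneg_nonneg) auto
  qed
  moreover have "0 \<le> 8 / 3 * a * (1 - 3 * a + a ^ 2 * (5 - 9 * a)) * (1 + c)"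
    unfolding d(1) using d assms by (intro mult_nonneg_nonneg add_nonneg_nonneg) auto
  ultimately show "?N c * ?D (-1) \<le> ?N (-1) * ?D c"
    using d by (smt (verit) mult_nonneg_nonneg)
qed

text \<open>The range \<open>1/2 < h \<le> 2/3\<close> with \<open>a = 1 - h\<close>. After division by \<open>1 + c\<close> the difference is quadratic
  in \<open>c\<close>. In its expansion in powers of \<open>1 + c\<close> every coefficient carries the factor \<open>1 - 2 a = 2 h - 1\<close>,
  because \<open>N\<close> and \<open>D\<close> both vanish at \<open>c = -1\<close> in the limiting case \<open>h = 1/2\<close>; the remaining factors are
  nonnegative by completed squares and \<open>1/3 \<le> a < 1/2\<close>.\<close>

lemma extremal_narrow:
  assumes "1/3 \<le> a" "a < 1/2"
  shows "extremal_at_minus_one (cheb3 2 (3 * a - 1) (- 2 * a) (1 - 3 * a))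
     (cheb3 (2/3) ((1 + 3 * a + 3 * a ^ 2 - 3 * a ^ 3) / 6) (4 * a ^ 3 / 3) ((3 * a - 1) ^ 3 / 6))"
    (is "extremal_at_minus_one ?N ?D")
  unfolding extremal_at_minus_one_def
proof (intro conjI allI impI)
  have "?D (-1) = 2 / 3 * (1 - 2 * a) ^ 3"
    by (simp add: cheb3_def field_simps eval_nat_numeral)
  moreover have "0 < (1 - 2 * a) ^ 3" using assms by simp
  ultimately show "?D (-1) > 0" by linarith
  fix c :: real assume "-1 \<le> c" "c \<le> 1"
  then obtain d where d: "1 + c = d" "0 \<le> d" by auto
  have "?D c = ?D (-1) + (1 + c) * ((1 - 2 * a) ^ 2 * (52 * a - 8) / 3
      + (1 + c) * (16 / 3 * a ^ 3 - 4 * (3 * a - 1) ^ 3) + 4 / 3 * (3 * a - 1) ^ 3 * (1 + c) ^ 2)" (is "_ = _ + ?d")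
    unfolding cheb3_add_1_factor[of _ _ _ _ c] by (simp add: field_simps eval_nat_numeral)
  moreover have "(3 * a - 1) ^ 3 \<le> a ^ 3" "0 \<le> (3 * a - 1) ^ 3" "0 \<le> a ^ 3"
    using assms by (auto intro!: power_mono)
  then have k: "0 \<le> 16 / 3 * a ^ 3 - 4 * (3 * a - 1) ^ 3" "0 \<le> (3 * a - 1) ^ 3" by linarith+
  have "0 \<le> ?d"
    unfolding d(1) using d assms by (intro k mult_nonneg_nonneg add_nonneg_nonneg divide_nonneg_nonneg) auto
  ultimately show "?D (-1) \<le> ?D c" by linarith
  have "?N (-1) * ?D c - ?N c * ?D (-1) = (1 + c) * (8 / 3 * (1 - 2 * a) * (
       3 * (1 - 2 * a) ^ 2 * (7 * a - 2)
       + (1 + c) * ((1 - 2 * a) * ((142 * a - 49) ^ 2 + 155) / 284 + a ^ 3)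
       + (1 + c) ^ 2 * ((3 * a - 1) * ((17 * a - 7) ^ 2 + 2) / 17)))" (is "_ = ?q")
    by (simp add: cheb3_def field_simps eval_nat_numeral)
  moreover have "0 \<le> ?q"
    unfolding d(1) using d assms by (intro mult_nonneg_nonneg add_nonneg_nonneg divide_nonneg_nonneg) auto
  ultimately show "?N c * ?D (-1) \<le> ?N (-1) * ?D c" by linarith
qed

lemma deriv_corr_values:
  "deriv_corr 0 = 2"
  "0 \<le> s \<Longrightarrow> s \<le> 1 \<Longrightarrow> deriv_corr s = 2 - 3 * s"
  "1 \<le> s \<Longrightarrow> s \<le> 2 \<Longrightarrow> deriv_corr s = s - 2"
  "2 \<le> s \<Longrightarrow> deriv_corr s = 0"
  by (auto simp: deriv_corr_def hat_def)

lemma bspline_4_0: "bspline 4 0 = 2/3"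
  by (simp add: bspline_4_values(1))

theorem symbols_extremal_at_pi:
  assumes h: "1/2 < h"
  shows "symbol (bspline 4) h pi > 0"
    and "symbol (bspline 4) h pi \<le> symbol (bspline 4) h \<theta>"
    and "symbol deriv_corr h \<theta> * symbol (bspline 4) h pi \<le> symbol deriv_corr h pi * symbol (bspline 4) h \<theta>"
proof -
  note coeffs = deriv_corr_values bspline_4_0 bspline_4_values
  have "extremal_at_minus_one (cheb3 (deriv_corr 0) (deriv_corr h) (deriv_corr (2 * h)) (deriv_corr (3 * h)))
     (cheb3 (bspline 4 0) (bspline 4 h) (bspline 4 (2 * h)) (bspline 4 (3 * h)))"
  proof -
    consider "2 \<le> h" | "1 \<le> h" "h \<le> 2" | "2/3 \<le> h" "h \<le> 1" | "h \<le> 2/3" by linarith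
    then show ?thesis
    proof cases
      case 1
      then show ?thesis using extremal_wide[of 0] by (simp add: coeffs)
    next
      case 2
      then show ?thesis using extremal_wide[of "2 - h"] by (simp add: coeffs)
    next
      case 3
      have "bspline 4 h = (1 + 3 * (1 - h) + 3 * (1 - h) ^ 2 - 3 * (1 - h) ^ 3) / 6"
        using 3 by (simp add: bspline_4_values power2_eq_square power3_eq_cube field_simps)
      moreover have "bspline 4 (2 * h) = 4 * (1 - h) ^ 3 / 3"
        using 3 by (simp add: bspline_4_values(2) power2_eq_square power3_eq_cube field_simps)
      moreover have "deriv_corr h = 3 * (1 - h) - 1" "deriv_corr (2 * h) = - 2 * (1 - h)" "deriv_corr (3 * h) = 0"
        "bspline 4 (3 * h) = 0"
        using 3 by (simp_all add: deriv_corr_values bspline_4_values(3))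
      ultimately show ?thesis
        using 3 extremal_middle[of "1 - h"] by (simp only: deriv_corr_values(1) bspline_4_0)
    next
      case 4
      have "bspline 4 h = (1 + 3 * (1 - h) + 3 * (1 - h) ^ 2 - 3 * (1 - h) ^ 3) / 6"
        using 4 h by (simp add: bspline_4_values power2_eq_square power3_eq_cube field_simps)
      moreover have "bspline 4 (2 * h) = 4 * (1 - h) ^ 3 / 3"
        using 4 h by (simp add: bspline_4_values(2) power2_eq_square power3_eq_cube field_simps)
      moreover have "bspline 4 (3 * h) = (3 * (1 - h) - 1) ^ 3 / 6"
        using 4 h by (simp add: bspline_4_values(2))
      moreover have "deriv_corr h = 3 * (1 - h) - 1" "deriv_corr (2 * h) = - 2 * (1 - h)"
        "deriv_corr (3 * h) = 1 - 3 * (1 - h)"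
        using 4 h by (simp_all add: deriv_corr_values)
      ultimately show ?thesis
        using 4 h extremal_narrow[of "1 - h"] by (simp only: deriv_corr_values(1) bspline_4_0)
    qed
  qed
  then show "symbol (bspline 4) h pi > 0"
    and "symbol (bspline 4) h pi \<le> symbol (bspline 4) h \<theta>"
    and "symbol deriv_corr h \<theta> * symbol (bspline 4) h pi \<le> symbol deriv_corr h pi * symbol (bspline 4) h \<theta>"
    unfolding symbol_cheb3[of "bspline 4", OF bspline_4_minus] symbol_cheb3[of deriv_corr, OF deriv_corr_minus]
    by (auto simp: extremal_at_minus_one_def)
qed

section \<open>Periodisation\<close>

lemma nn_integral_lborel_shift:
  assumes [measurable]: "f \<in> borel_measurable borel"
  shows "(\<integral>\<^sup>+x. f (x + t) \<partial>lborel) = (\<integral>\<^sup>+x. f (x::real) \<partial>lborel)"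
  using nn_integral_real_affine[of f 1 t] by (simp add: add.commute)

lemma integral_lborel_shift:
  fixes f :: "real \<Rightarrow> 'a::{banach, second_countable_topology}"
  shows "(\<integral>x. f (x + t) \<partial>lborel) = (\<integral>x. f x \<partial>lborel)"
  using lborel_integral_real_affine[of 1 f t] by (simp add: add.commute)

lemma integrable_lborel_shift:
  fixes f :: "real \<Rightarrow> 'a::{banach, second_countable_topology}"
  shows "integrable lborel (\<lambda>x. f (x + t)) \<longleftrightarrow> integrable lborel f"
  using lborel_integrable_real_affine_iff[of 1 f t] by (simp add: add.commute)

lemma in_cell_iff_floor:
  assumes "T > 0"
  shows "x \<in> {of_int k * T..<of_int k * T + T} \<longleftrightarrow> \<lfloor>x / T\<rfloor> = k"
  using assms by (auto simp: floor_eq_iff field_simps)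

lemma nn_integral_cells:
  fixes F :: "real \<Rightarrow> ennreal"
  assumes "T > 0" and F [measurable]: "F \<in> borel_measurable borel"
  shows "(\<integral>\<^sup>+x. F x \<partial>lborel) =
    (\<integral>\<^sup>+k. (\<integral>\<^sup>+x. F (x + of_int k * T) * indicator {a..<a + T} x \<partial>lborel) \<partial>count_space (UNIV::int set))"
proof -
  have cell: "(\<integral>\<^sup>+k. indicator {a + of_int k * T..<a + T + of_int k * T} x \<partial>count_space UNIV) = (1::ennreal)" for x
  proof -
    have *: "x \<in> {a + of_int k * T..<a + T + of_int k * T} \<longleftrightarrow> k = \<lfloor>(x - a) / T\<rfloor>" for k
      using in_cell_iff_floor[OF assms(1), of "x - a" k] by auto
    have "(\<integral>\<^sup>+k. indicator {a + of_int k * T..<a + T + of_int k * T} x \<partial>count_space UNIV)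
      = (\<Sum>k\<in>{\<lfloor>(x - a) / T\<rfloor>}. indicator {a + of_int k * T..<a + T + of_int k * T} x :: ennreal)"
      by (rule nn_integral_count_space') (use * in \<open>auto simp del: atLeastLessThan_iff simp: indicator_def\<close>)
    also have "\<dots> = 1" using * by (simp del: atLeastLessThan_iff)
    finally show ?thesis .
  qed
  have "(\<integral>\<^sup>+x. F x \<partial>lborel) = (\<integral>\<^sup>+x. F x * (\<integral>\<^sup>+k. indicator {a + of_int k * T..<a + T + of_int k * T} x \<partial>count_space (UNIV::int set)) \<partial>lborel)"
    by (simp add: cell)
  also have "\<dots> = (\<integral>\<^sup>+x. (\<integral>\<^sup>+k. F x * indicator {a + of_int k * T..<a + T + of_int k * T} x \<partial>count_space (UNIV::int set)) \<partial>lborel)"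
    by (simp add: nn_integral_cmult)
  also have "\<dots> = (\<integral>\<^sup>+k. (\<integral>\<^sup>+x. F x * indicator {a + of_int k * T..<a + T + of_int k * T} x \<partial>lborel) \<partial>count_space (UNIV::int set))"
    by (rule nn_integral_count_space_nn_integral) auto
  also have "\<dots> = (\<integral>\<^sup>+k. (\<integral>\<^sup>+x. F (x + of_int k * T) * indicator {a..<a + T} x \<partial>lborel) \<partial>count_space (UNIV::int set))"
  proof (rule nn_integral_cong)
    fix k :: int
    have "(\<integral>\<^sup>+x. F x * indicator {a + of_int k * T..<a + T + of_int k * T} x \<partial>lborel)
       = (\<integral>\<^sup>+x. F (x + of_int k * T) * indicator {a + of_int k * T..<a + T + of_int k * T} (x + of_int k * T) \<partial>lborel)"
      by (rule nn_integral_lborel_shift[symmetric]) simp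
    also have "\<dots> = (\<integral>\<^sup>+x. F (x + of_int k * T) * indicator {a..<a + T} x \<partial>lborel)"
      by (intro nn_integral_cong) (auto simp: indicator_def)
    finally show "(\<integral>\<^sup>+x. F x * indicator {a + of_int k * T..<a + T + of_int k * T} x \<partial>lborel)
       = (\<integral>\<^sup>+x. F (x + of_int k * T) * indicator {a..<a + T} x \<partial>lborel)" .
  qed
  finally show ?thesis .
qed

lemma integral_period_space_Ico:
  fixes f :: "real \<Rightarrow> 'b::{banach, second_countable_topology}"
  shows "(\<integral>x. f x \<partial>period_space T) = (\<integral>x. indicator {0..<T} x *\<^sub>R f x \<partial>lborel)"
  by (subst integral_restrict_space) auto

lemma integrable_period_space:
  fixes f :: "real \<Rightarrow> 'b::{banach, second_countable_topology}"
  shows "integrable lborel f \<Longrightarrow> integrable (period_space T) f"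
  by (subst integrable_restrict_space) (auto intro!: integrable_mult_indicator)

text \<open>The finite set \<open>K\<close> collects the cells that meet the support. Finiteness keeps the periodisation
  an honest finite sum.\<close>

lemma integral_fold:
  fixes F :: "real \<Rightarrow> complex"
  assumes T: "T > 0" and F: "integrable lborel F" and K: "finite K" and supp: "\<And>x. F x \<noteq> 0 \<Longrightarrow> \<lfloor>x / T\<rfloor> \<in> K"
  shows "(\<integral>x. F x \<partial>lborel) = (\<integral>x. (\<Sum>k\<in>K. F (x + of_int k * T)) \<partial>period_space T)"
proof -
  let ?I = "\<lambda>k x. indicator {of_int k * T..<of_int k * T + T} x :: real"
  have "F x = (\<Sum>k\<in>K. ?I k x *\<^sub>R F x)" for x
  proof -
    have "(\<Sum>k\<in>K. ?I k x *\<^sub>R F x) = (\<Sum>k\<in>K. if k = \<lfloor>x / T\<rfloor> then F x else 0)"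
      by (intro sum.cong refl) (auto simp: indicator_def in_cell_iff_floor[OF T] simp del: atLeastLessThan_iff)
    also have "\<dots> = F x" using K supp[of x] by auto
    finally show ?thesis ..
  qed
  then have "(\<integral>x. F x \<partial>lborel) = (\<integral>x. (\<Sum>k\<in>K. ?I k x *\<^sub>R F x) \<partial>lborel)"
    by (metis (no_types))
  also have "\<dots> = (\<Sum>k\<in>K. \<integral>x. ?I k x *\<^sub>R F x \<partial>lborel)"
    by (intro Bochner_Integration.integral_sum integrable_mult_indicator F) auto
  also have "\<dots> = (\<Sum>k\<in>K. \<integral>x. indicator {0..<T} x *\<^sub>R F (x + of_int k * T) \<partial>lborel)"
  proof (rule sum.cong[OF refl])
    fix k
    have "(\<integral>x. ?I k x *\<^sub>R F x \<partial>lborel) = (\<integral>x. ?I k (x + of_int k * T) *\<^sub>R F (x + of_int k * T) \<partial>lborel)"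
      by (rule integral_lborel_shift[symmetric])
    also have "\<dots> = (\<integral>x. indicator {0..<T} x *\<^sub>R F (x + of_int k * T) \<partial>lborel)"
      by (intro Bochner_Integration.integral_cong refl) (auto simp: indicator_def)
    finally show "(\<integral>x. ?I k x *\<^sub>R F x \<partial>lborel) = (\<integral>x. indicator {0..<T} x *\<^sub>R F (x + of_int k * T) \<partial>lborel)" .
  qed
  also have "\<dots> = (\<Sum>k\<in>K. \<integral>x. F (x + of_int k * T) \<partial>period_space T)"
    by (simp add: integral_period_space_Ico)
  also have "\<dots> = (\<integral>x. (\<Sum>k\<in>K. F (x + of_int k * T)) \<partial>period_space T)"
    using F by (intro Bochner_Integration.integral_sum[symmetric] integrable_period_space) (simp add: integrable_lborel_shift)
  finally show ?thesis .
qed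

lemma sq_integrable_shift:
  fixes F :: "real \<Rightarrow> complex"
  assumes "sq_integrable lborel F" shows "sq_integrable lborel (\<lambda>x. F (x + t))"
proof -
  have [measurable]: "F \<in> borel_measurable borel" using assms by (simp add: sq_integrable_def)
  show ?thesis
    using assms integrable_lborel_shift[of "\<lambda>x. (norm (F x))\<^sup>2" t]
    by (simp add: sq_integrable_def)
qed

lemma sq_integrable_period_space: "sq_integrable lborel F \<Longrightarrow> sq_integrable (period_space T) F"
  unfolding sq_integrable_def by (auto intro: integrable_period_space measurable_restrict_space1)

lemma trig_periodic: "T > 0 \<Longrightarrow> trig T l (x + of_int k * T) = trig T l x"
proof -
  assume T: "T > 0"
  have "2 * pi * of_int l * (x + of_int k * T) / T = 2 * pi * of_int l * x / T + 2 * pi * of_int (l * k)"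
    using T by (simp add: field_simps)
  then have "trig T l (x + of_int k * T) = cis (2 * pi * of_int l * x / T) * cis (2 * pi * of_int (l * k))"
    unfolding trig_def by (simp only: cis_mult)
  also have "cis (2 * pi * of_int (l * k)) = 1" by (rule cis_multiple_2pi) simp
  finally show ?thesis by (simp add: trig_def)
qed

lemma sq_integrable_bounded_support:
  fixes F :: "real \<Rightarrow> complex" and T :: real
  assumes T: "T > 0" and F: "sq_integrable lborel F" and K: "finite K" and supp: "\<And>x. F x \<noteq> 0 \<Longrightarrow> \<lfloor>x / T\<rfloor> \<in> K"
    and g: "g \<in> borel_measurable borel" "\<And>x. norm (g x) \<le> 1"
  shows "integrable lborel (\<lambda>x. F x * cnj (g x))"
proof -
  note [measurable] = g(1)
  define A where "A = (\<Union>k\<in>K. {of_int k * T..<of_int k * T + T})"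
  have A [measurable]: "A \<in> sets borel" unfolding A_def by (intro sets.finite_UN K) auto
  have mem: "x \<in> A \<longleftrightarrow> \<lfloor>x / T\<rfloor> \<in> K" for x
    unfolding A_def using in_cell_iff_floor[OF T] by (auto simp del: atLeastLessThan_iff)
  have "bounded A" unfolding A_def using K by (intro bounded_UN) auto
  then have "emeasure lborel A < \<infinity>" by (rule emeasure_bounded_finite)
  then have intA: "integrable lborel (indicator A :: real \<Rightarrow> real)"
    by (intro integrable_real_indicator) simp_all
  have "integrable lborel (\<lambda>x. (norm (indicator A x * g x))\<^sup>2)"
  proof (rule Bochner_Integration.integrable_bound[OF intA])
    show "AE x in lborel. norm ((norm (indicator A x * g x))\<^sup>2) \<le> norm (indicator A x :: real)"
      using g(2) by (auto simp: indicator_def norm_mult power_le_one)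
  qed measurable
  then have "sq_integrable lborel (\<lambda>x. indicator A x * g x)"
    unfolding sq_integrable_def by simp
  from sq_integrable_mult_cnj[OF F this] have "integrable lborel (\<lambda>x. F x * cnj (indicator A x * g x))" .
  moreover have "F x * cnj (indicator A x * g x) = F x * cnj (g x)" for x
  proof (cases "F x = 0")
    case False
    then have "x \<in> A" using supp mem by blast
    then show ?thesis by (simp only: indicator_simps mult_1)
  qed simp
  ultimately show ?thesis by (simp only:)
qed

lemma integral_trig_fold:
  fixes F :: "real \<Rightarrow> complex" and T :: real
  assumes T: "T > 0" and F: "sq_integrable lborel F" and K: "finite K" and supp: "\<And>x. F x \<noteq> 0 \<Longrightarrow> \<lfloor>x / T\<rfloor> \<in> K"
  shows "(\<integral>x. F x * cnj (trig T l x) \<partial>lborel) = fcoeff T (\<lambda>x. \<Sum>k\<in>K. F (x + of_int k * T)) l"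
proof -
  have "(\<integral>x. F x * cnj (trig T l x) \<partial>lborel) = (\<integral>x. (\<Sum>k\<in>K. F (x + of_int k * T) * cnj (trig T l (x + of_int k * T))) \<partial>period_space T)"
  proof (rule integral_fold[OF T _ K])
    show "integrable lborel (\<lambda>x. F x * cnj (trig T l x))"
      by (rule sq_integrable_bounded_support[OF T F K supp]) simp_all
  qed (use supp in auto)
  also have "\<dots> = fcoeff T (\<lambda>x. \<Sum>k\<in>K. F (x + of_int k * T)) l"
    unfolding trig_periodic[OF T] sum_distrib_right ..
  finally show ?thesis .
qed

text \<open>The Fourier transform of \<open>F\<close> on the lattice \<open>1/T\<close> consists of the Fourier coefficients of the
  periodisation of \<open>F\<close>. This serves twice: for the two sums in the quotient, and for the sum over the
  modulations of the Gabor system.\<close>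

theorem parseval_fold:
  fixes F :: "real \<Rightarrow> complex" and T :: real
  assumes T: "T > 0" and F: "sq_integrable lborel F" and K: "finite K" and supp: "\<And>x. F x \<noteq> 0 \<Longrightarrow> \<lfloor>x / T\<rfloor> \<in> K"
  shows "((\<lambda>l. (norm (\<integral>x. F x * cnj (trig T l x) \<partial>lborel))\<^sup>2) has_sum
     T * period_sqnorm T (\<lambda>x. \<Sum>k\<in>K. F (x + of_int k * T))) UNIV"
proof -
  have "sq_integrable (period_space T) (\<lambda>x. \<Sum>k\<in>K. F (x + of_int k * T))"
    by (intro sq_integrable_sum sq_integrable_period_space sq_integrable_shift F)
  note parseval[OF T this]
  moreover have "(\<integral>x. F x * cnj (trig T l x) \<partial>lborel) = fcoeff T (\<lambda>x. \<Sum>k\<in>K. F (x + of_int k * T)) l" for l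
    by (rule integral_trig_fold[OF T F K]) (rule supp)
  ultimately show ?thesis by presburger
qed

text \<open>Unfolding one factor of \<open>\<bar>\<Sum>\<^sub>k F(x + k T)\<bar>\<^sup>2\<close> over the line turns the square of the periodisation into
  correlations of \<open>F\<close> with its own translates.\<close>

lemma fold_square_integral:
  fixes F :: "real \<Rightarrow> complex" and T :: real
  assumes T: "T > 0" and F: "sq_integrable lborel F" and K: "finite K" and supp: "\<And>x. F x \<noteq> 0 \<Longrightarrow> \<lfloor>x / T\<rfloor> \<in> K"
    and J: "finite J" "\<And>k m. k \<in> K \<Longrightarrow> m \<in> K \<Longrightarrow> m - k \<in> J"
  shows "complex_of_real (period_sqnorm T (\<lambda>x. \<Sum>k\<in>K. F (x + of_int k * T))) =
    (\<Sum>j\<in>J. \<integral>x. F x * cnj (F (x + of_int j * T)) \<partial>lborel)"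
proof -
  have sp: "space (period_space T) = {0..<T}" by (simp add: space_restrict_space)
  have int: "integrable lborel (\<lambda>x. F x * cnj (F (x + of_int j * T)))" for j
    by (intro sq_integrable_mult_cnj F sq_integrable_shift)
  have inner: "(\<Sum>j\<in>J. F (x + of_int k * T + of_int j * T)) = (\<Sum>m\<in>K. F (x + of_int m * T))"
    if x: "x \<in> {0..<T}" and k: "k \<in> K" for x k
  proof -
    \<comment> \<open>a point of the period shifted by \<open>m\<close> periods lies in cell \<open>m\<close>, so \<open>supp\<close> decides which shifts vanish\<close>
    have floor: "\<lfloor>(x + of_int m * T) / T\<rfloor> = m" for m
      using x T by (subst in_cell_iff_floor[symmetric]) auto
    have "(\<Sum>m\<in>K. F (x + of_int m * T)) = (\<Sum>j\<in>(\<lambda>m. m - k) ` K. F (x + of_int k * T + of_int j * T))"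
      by (subst sum.reindex) (auto simp: inj_on_def algebra_simps)
    also have "\<dots> = (\<Sum>j\<in>J. F (x + of_int k * T + of_int j * T))"
    proof (rule sum.mono_neutral_left)
      show "\<forall>j\<in>J - (\<lambda>m. m - k) ` K. F (x + of_int k * T + of_int j * T) = 0"
      proof
        fix j assume j: "j \<in> J - (\<lambda>m. m - k) ` K"
        have "x + of_int k * T + of_int j * T = x + of_int (k + j) * T" by (simp add: algebra_simps)
        moreover have "F (x + of_int (k + j) * T) = 0"
        proof (rule ccontr)
          assume "F (x + of_int (k + j) * T) \<noteq> 0"
          from supp[OF this] have "k + j \<in> K" by (simp only: floor)
          then have "j \<in> (\<lambda>m. m - k) ` K" by (intro image_eqI[of _ _ "k + j"]) auto
          with j show False by simp
        qed
        ultimately show "F (x + of_int k * T + of_int j * T) = 0" by (simp only:)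
      qed
    qed (use J k in auto)
    finally show ?thesis ..
  qed
  have "(\<Sum>j\<in>J. \<integral>x. F x * cnj (F (x + of_int j * T)) \<partial>lborel) = (\<integral>x. (\<Sum>j\<in>J. F x * cnj (F (x + of_int j * T))) \<partial>lborel)"
    using int by (intro Bochner_Integration.integral_sum[symmetric]) auto
  also have "\<dots> = (\<integral>x. (\<Sum>k\<in>K. \<Sum>j\<in>J. F (x + of_int k * T) * cnj (F (x + of_int k * T + of_int j * T))) \<partial>period_space T)"
  proof (subst integral_fold[OF T _ K])
    show "integrable lborel (\<lambda>x. \<Sum>j\<in>J. F x * cnj (F (x + of_int j * T)))"
      using int by (intro Bochner_Integration.integrable_sum)
    show "\<lfloor>x / T\<rfloor> \<in> K" if "(\<Sum>j\<in>J. F x * cnj (F (x + of_int j * T))) \<noteq> 0" for x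
      using that supp[of x] by (cases "F x = 0") auto
  qed (rule refl)
  also have "\<dots> = (\<integral>x. complex_of_real ((norm (\<Sum>k\<in>K. F (x + of_int k * T)))\<^sup>2) \<partial>period_space T)"
  proof (rule Bochner_Integration.integral_cong[OF refl])
    fix x assume "x \<in> space (period_space T)"
    then have x: "x \<in> {0..<T}" by (simp only: sp)
    let ?P = "\<Sum>k\<in>K. F (x + of_int k * T)"
    have "(\<Sum>j\<in>J. F (x + of_int k * T) * cnj (F (x + of_int k * T + of_int j * T))) = F (x + of_int k * T) * cnj ?P"
      if "k \<in> K" for k
      unfolding sum_distrib_left[symmetric] cnj_sum[symmetric] inner[OF x that] ..
    then have "(\<Sum>k\<in>K. \<Sum>j\<in>J. F (x + of_int k * T) * cnj (F (x + of_int k * T + of_int j * T))) = (\<Sum>k\<in>K. F (x + of_int k * T) * cnj ?P)"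
      by (rule sum.cong[OF refl])
    also have "\<dots> = complex_of_real ((norm ?P)\<^sup>2)"
      unfolding complex_norm_sq sum_distrib_right ..
    finally show "(\<Sum>k\<in>K. \<Sum>j\<in>J. F (x + of_int k * T) * cnj (F (x + of_int k * T + of_int j * T))) = complex_of_real ((norm ?P)\<^sup>2)" .
  qed
  also have "\<dots> = complex_of_real (period_sqnorm T (\<lambda>x. \<Sum>k\<in>K. F (x + of_int k * T)))"
    by (rule integral_complex_of_real)
  finally show ?thesis ..
qed

section \<open>The quotient and its essential supremum\<close>

lemma infsum_ereal_of_has_sum:
  assumes "(f has_sum s) A"
  shows "(\<Sum>\<^sub>\<infinity>i\<in>A. ereal (f i)) = ereal s"
proof (rule infsumI)
  have "((\<lambda>F. ereal (sum f F)) \<longlongrightarrow> ereal s) (finite_subsets_at_top A)"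
    using assms unfolding has_sum_def by (rule tendsto_ereal)
  then show "((\<lambda>i. ereal (f i)) has_sum ereal s) A"
    unfolding has_sum_def by (simp add: sum_ereal[abs_def])
qed

lemma hat_deriv_bounded: "\<bar>hat_deriv x\<bar> \<le> indicator {-1..1} x"
  by (auto simp: hat_deriv_def indicator_def)

lemma hat_bounded: "\<bar>hat x\<bar> \<le> indicator {-1..1} x"
  by (auto simp: hat_def indicator_def)

lemma sq_integrable_unit_support:
  assumes [measurable]: "F \<in> borel_measurable borel" and F: "\<And>x. norm (F x) \<le> indicator {-1..1::real} x"
  shows "sq_integrable lborel F"
proof -
  have "integrable lborel (\<lambda>x. (norm (F x))\<^sup>2)"
  proof (rule Bochner_Integration.integrable_bound)
    show "integrable lborel (indicator {-1..1::real} :: real \<Rightarrow> real)" by simp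
    show "AE x in lborel. norm ((norm (F x))\<^sup>2) \<le> norm (indicator {-1..1} x :: real)"
    proof (intro AE_I2)
      fix x
      have "(norm (F x))\<^sup>2 \<le> (indicator {-1..1} x)\<^sup>2" by (intro power_mono F) simp
      then show "norm ((norm (F x))\<^sup>2) \<le> norm (indicator {-1..1} x :: real)"
        by (auto simp: indicator_def power_le_one)
    qed
  qed measurable
  then show ?thesis by (simp add: sq_integrable_def)
qed

text \<open>Parseval for \<open>F(x) = f(x) exp (-2 \<pi> i w x)\<close>: the correlation of \<open>F\<close> with its translate by \<open>j h\<close> is that of
  \<open>f\<close> times the phase \<open>exp (i j \<theta>)\<close>, \<open>\<theta> = 2 \<pi> w h\<close>, and the total is real.\<close>

lemma periodized_fourier_square:
  fixes f :: "real \<Rightarrow> real"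
  assumes h: "h > 1/2" and fm [measurable]: "f \<in> borel_measurable borel" and f: "\<And>x. \<bar>f x\<bar> \<le> indicator {-1..1} x"
    and a: "\<And>s. (\<integral>x. f x * f (x + s) \<partial>lborel) = a s"
  shows "((\<lambda>l. (norm (fourier (\<lambda>x. complex_of_real (f x)) (w + of_int l / h)))\<^sup>2) has_sum
     h * symbol a h (2 * pi * w * h)) UNIV"
proof -
  have h0: "h > 0" using h by simp
  define F where "F x = complex_of_real (f x) * cis (- 2 * pi * w * x)" for x
  have [measurable]: "(\<lambda>x. cis (- 2 * pi * w * x)) \<in> borel_measurable borel"
    unfolding cis_conv_exp by (intro borel_measurable_continuous_onI continuous_intros)
  have Fm [measurable]: "F \<in> borel_measurable borel" unfolding F_def by measurable
  have F0: "x \<in> {-1..1}" if "F x \<noteq> 0" for x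
  proof (rule ccontr)
    assume "x \<notin> {-1..1}"
    then have "\<bar>f x\<bar> \<le> 0" using f[of x] by (simp del: atLeastAtMost_iff)
    with that show False by (simp add: F_def)
  qed
  have F: "sq_integrable lborel F"
    by (rule sq_integrable_unit_support[OF Fm]) (use f in \<open>simp add: F_def norm_mult\<close>)
  \<comment> \<open>as \<open>h > 1/2\<close>, the support \<open>[-1,1]\<close> meets only the cells \<open>-2, -1, 0, 1\<close>, whose differences are at most 3\<close>
  define K :: "int set" where "K = {-2..1}"
  define J :: "int set" where "J = {-3..3}"
  let ?e = "\<lambda>j. cis (of_int j * (2 * pi * w * h))" and ?C = "\<lambda>j. \<integral>x. F x * cnj (F (x + of_int j * h)) \<partial>lborel"
  have supp: "\<lfloor>x / h\<rfloor> \<in> K" if "F x \<noteq> 0" for x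
  proof -
    have "-2 \<le> x / h" "x / h < 2" using F0[OF that] h by (auto simp: field_simps)
    then show ?thesis unfolding K_def by (simp add: le_floor_iff floor_le_iff)
  qed
  have coeff: "fourier (\<lambda>x. complex_of_real (f x)) (w + of_int l / h) = (\<integral>x. F x * cnj (trig h l x) \<partial>lborel)" for l
    unfolding fourier_def
  proof (rule Bochner_Integration.integral_cong[OF refl])
    fix x
    have "exp (- 2 * complex_of_real pi * \<i> * of_real ((w + of_int l / h) * x)) = cis (- 2 * pi * w * x + - (2 * pi * of_int l * x / h))"
      unfolding cis_conv_exp by (rule arg_cong[where f = exp]) (simp add: complex_eq_iff algebra_simps)
    then show "complex_of_real (f x) * exp (- 2 * complex_of_real pi * \<i> * of_real ((w + of_int l / h) * x)) = F x * cnj (trig h l x)"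
      by (simp only: F_def trig_def cis_cnj cis_mult[symmetric] mult.assoc)
  qed
  let ?S = "sqnorm (period_space h) (\<lambda>x. \<Sum>k\<in>K. F (x + of_int k * h))"
  have "complex_of_real ?S = (\<Sum>j\<in>J. \<integral>x. F x * cnj (F (x + of_int j * h)) \<partial>lborel)"
    by (rule fold_square_integral[OF h0 F _ supp]) (auto simp: K_def J_def)
  also have "\<dots> = (\<Sum>j\<in>J. complex_of_real (a (of_int j * h)) * ?e j)"
  proof (rule sum.cong[OF refl])
    fix j
    have "F x * cnj (F (x + of_int j * h)) = complex_of_real (f x * f (x + of_int j * h)) * ?e j" for x
    proof -
      have c: "cis (- 2 * pi * w * x) * cis (- (- 2 * pi * w * (x + of_int j * h))) = ?e j"
        unfolding cis_mult by (rule arg_cong[where f = cis]) (simp add: algebra_simps)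
      have "(u * v) * (u' * v') = (u * u') * (v * v')" for u v u' v' :: complex
        by (simp only: mult_ac)
      then show ?thesis
        unfolding F_def complex_cnj_mult cis_cnj complex_cnj_complex_of_real of_real_mult c[symmetric] .
    qed
    then have "?C j = (\<integral>x. complex_of_real (f x * f (x + of_int j * h)) * ?e j \<partial>lborel)"
      by (simp only:)
    also have "\<dots> = complex_of_real (a (of_int j * h)) * ?e j"
      by (subst integral_mult_left_zero, subst integral_complex_of_real, subst a) (rule refl)
    finally show "?C j = complex_of_real (a (of_int j * h)) * ?e j" .
  qed
  finally have "complex_of_real ?S = (\<Sum>j\<in>J. complex_of_real (a (of_int j * h)) * ?e j)" .
  then have "?S = Re (\<Sum>j\<in>J. complex_of_real (a (of_int j * h)) * ?e j)"
    by (rule arg_cong[where f = Re, THEN trans[OF Re_complex_of_real[symmetric]]])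
  also have "\<dots> = symbol a h (2 * pi * w * h)"
    unfolding symbol_def J_def Re_sum by (intro sum.cong refl) simp
  finally have S: "?S = symbol a h (2 * pi * w * h)" .
  have "finite K" by (simp add: K_def)
  from parseval_fold[OF h0 F this supp]
  have "((\<lambda>l. (norm (\<integral>x. F x * cnj (trig h l x) \<partial>lborel))\<^sup>2) has_sum h * ?S) UNIV" .
  then show ?thesis unfolding S coeff .
qed

lemma fourier_hat_has_sum:
  assumes "h > 1/2"
  shows "((\<lambda>l. (norm (fourier (cbspline 2) (w + of_int l / h)))\<^sup>2) has_sum
     h * symbol (bspline 4) h (2 * pi * w * h)) UNIV"
  unfolding bspline_2 using hat_bounded hat_autocorrelation
  by (intro periodized_fourier_square assms) auto

lemma fourier_hat_moment_has_sum:
  assumes "h > 1/2"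
  shows "((\<lambda>l. (w + of_int l / h)\<^sup>2 * (norm (fourier (cbspline 2) (w + of_int l / h)))\<^sup>2) has_sum
     h * symbol deriv_corr h (2 * pi * w * h) / (4 * pi\<^sup>2)) UNIV"
proof -
  have "((\<lambda>l. (norm (fourier (\<lambda>x. complex_of_real (hat_deriv x)) (w + of_int l / h)))\<^sup>2) has_sum
     h * symbol deriv_corr h (2 * pi * w * h)) UNIV"
    using hat_deriv_bounded hat_deriv_autocorrelation
    by (intro periodized_fourier_square assms) (auto simp: deriv_corr_def)
  from has_sum_cmult_right[OF this, of "1 / (4 * pi\<^sup>2)"]
  have *: "((\<lambda>l. 1 / (4 * pi\<^sup>2) * (norm (2 * complex_of_real pi * \<i> * of_real (w + of_int l / h) *
      fourier (\<lambda>x. complex_of_real (hat x)) (w + of_int l / h)))\<^sup>2) has_sum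
     1 / (4 * pi\<^sup>2) * (h * symbol deriv_corr h (2 * pi * w * h))) UNIV"
    by (simp only: fourier_hat_deriv of_real_mult of_real_numeral)
  have eq: "1 / (4 * pi\<^sup>2) * (norm (2 * complex_of_real pi * \<i> * complex_of_real x * z))\<^sup>2 = x\<^sup>2 * (norm z)\<^sup>2" for x z
    by (simp add: norm_mult power_mult_distrib)
  show ?thesis
    using * unfolding bspline_2 eq by simp
qed

lemma B_quot_hat:
  assumes h: "h > 1/2"
  shows "B_quot (cbspline 2) h w =
    ereal (symbol deriv_corr h (2 * pi * w * h) / (4 * pi\<^sup>2 * symbol (bspline 4) h (2 * pi * w * h)))"
proof -
  have "symbol (bspline 4) h (2 * pi * w * h) > 0"
    using symbols_extremal_at_pi(1,2)[OF h] less_le_trans by blast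
  then show ?thesis
    using h unfolding B_quot_def infsum_ereal_of_has_sum[OF fourier_hat_has_sum[OF h]]
      infsum_ereal_of_has_sum[OF fourier_hat_moment_has_sum[OF h]]
    by simp
qed

text \<open>The value of the quotient at \<open>w = 1 / (2 h)\<close>.\<close>

definition bandwidth :: "real \<Rightarrow> real" where
  "bandwidth h = symbol deriv_corr h pi / (4 * pi\<^sup>2 * symbol (bspline 4) h pi)"

lemma B_quot_hat_le:
  assumes h: "h > 1/2"
  shows "B_quot (cbspline 2) h w \<le> ereal (bandwidth h)"
proof -
  let ?\<theta> = "2 * pi * w * h"
  have pos: "symbol (bspline 4) h pi > 0" "symbol (bspline 4) h ?\<theta> > 0"
    using symbols_extremal_at_pi(1,2)[OF h] less_le_trans by blast+
  have "symbol deriv_corr h ?\<theta> / symbol (bspline 4) h ?\<theta> \<le> symbol deriv_corr h pi / symbol (bspline 4) h pi"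
  proof -
    have "a / b \<le> c / d" if "0 < b" "0 < d" "a * d \<le> c * b" for a b c d :: real
      using that by (simp add: field_simps)
    then show ?thesis using pos symbols_extremal_at_pi(3)[OF h] by blast
  qed
  then have "symbol deriv_corr h ?\<theta> / symbol (bspline 4) h ?\<theta> / (4 * pi\<^sup>2) \<le> symbol deriv_corr h pi / symbol (bspline 4) h pi / (4 * pi\<^sup>2)"
    by (rule divide_right_mono) simp
  then show ?thesis
    unfolding B_quot_hat[OF h] bandwidth_def by (simp add: mult.commute)
qed

lemma B_quot_hat_half:
  assumes h: "h > 1/2"
  shows "B_quot (cbspline 2) h (1 / (2 * h)) = ereal (bandwidth h)"
  unfolding B_quot_hat[OF h] bandwidth_def using h by (simp add: field_simps)

lemma continuous_symbol: "continuous_on UNIV (\<lambda>w. symbol a h (c * w))"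
  unfolding symbol_def by (intro continuous_intros)

text \<open>A value exceeded only on a null set cannot lie below the maximum, since by continuity the
  quotient stays above any smaller number on a whole ball around the maximiser \<open>1 / (2 h)\<close>, which
  lies in the interior of the period.\<close>

theorem M_sup_hat:
  assumes h: "h > 1/2"
  shows "M_sup (cbspline 2) h = ereal (bandwidth h)"
proof -
  let ?M = "restrict_space lborel {0..1/h}"
  let ?E = "esssup ?M (B_quot (cbspline 2) h)"
  let ?g = "\<lambda>w. symbol deriv_corr h (2 * pi * h * w) / (4 * pi\<^sup>2 * symbol (bspline 4) h (2 * pi * h * w))"
  have g: "B_quot (cbspline 2) h = (\<lambda>w. ereal (?g w))"
    unfolding B_quot_hat[OF h] fun_eq_iff by (simp add: mult_ac)
  have "symbol (bspline 4) h \<theta> \<noteq> 0" for \<theta>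
    using symbols_extremal_at_pi(1)[OF h] symbols_extremal_at_pi(2)[OF h, of \<theta>] by linarith
  then have cont: "continuous_on UNIV ?g"
    by (intro continuous_intros continuous_symbol) auto
  then have "?g \<in> borel_measurable borel" by (rule borel_measurable_continuous_onI)
  then have meas: "B_quot (cbspline 2) h \<in> borel_measurable ?M"
    unfolding g by (intro measurable_restrict_space1) simp
  show ?thesis
    unfolding M_sup_def
  proof (rule antisym)
    show "?E \<le> ereal (bandwidth h)"
      using B_quot_hat_le[OF h] meas by (intro esssup_I) auto
    show "ereal (bandwidth h) \<le> ?E"
    proof (rule ccontr)
      assume "\<not> ereal (bandwidth h) \<le> ?E"
      then have less: "?E < ereal (bandwidth h)" by simp
      then obtain r where r: "?E < ereal r" "r < bandwidth h"
        using ereal_dense2 by (metis ereal_less_eq(3) less_ereal.simps(1) linorder_not_less)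
      let ?U = "{w. r < ?g w} \<inter> {0<..<1/h}"
      have "?g (1 / (2 * h)) = bandwidth h"
        using B_quot_hat_half[OF h] unfolding g by simp
      then have "1 / (2 * h) \<in> ?U" using r h by (simp add: field_simps)
      moreover have "open ?U"
        using cont by (intro open_Int open_Collect_less continuous_on_const) auto
      ultimately obtain e where e: "e > 0" "ball (1 / (2 * h)) e \<subseteq> ?U"
        using open_contains_ball by blast
      have "AE w in ?M. B_quot (cbspline 2) h w \<le> ?E"
        by (rule esssup_AE)
      then have "AE w in ?M. ?g w \<le> r"
      proof eventually_elim
        case (elim w)
        then have "B_quot (cbspline 2) h w < ereal r" using r(1) by (rule le_less_trans)
        then show ?case unfolding g by simp
      qed
      then have "AE w in lborel. w \<in> {0..1/h} \<longrightarrow> ?g w \<le> r"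
        by (subst (asm) AE_restrict_space_iff) auto
      then have "AE w in lborel. w \<notin> ball (1 / (2 * h)) e"
        by eventually_elim (use e(2) in \<open>force\<close>)
      then have "emeasure lborel (ball (1 / (2 * h)) e) = 0"
        by (subst (asm) AE_iff_measurable[OF _ refl]) (auto simp: ball_def)
      then show False using e(1)
        by (simp add: ball_eq_greaterThanLessThan)
    qed
  qed
qed

lemma bandwidth_eq:
  assumes h: "h > 1/2"
  shows "bandwidth h = 1 / (4 * pi\<^sup>2) *
        ((1 - 2 * bspline 2 h + bspline 2 (1 - h) - bspline 2 (1 - 2 * h) + bspline 2 (1 - 3 * h)) /
         (1/3 - bspline 4 h + bspline 4 (2 * h) - bspline 4 (3 * h)))"
proof -
  have hm: "hat (s - 1) = hat (1 - s)" for s using hat_minus[of "1 - s"] by simp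
  have "symbol deriv_corr h pi = 2 * (1 - 2 * hat h + hat (1 - h) - hat (1 - 2 * h) + hat (1 - 3 * h))"
    unfolding symbol_cheb3[of deriv_corr, OF deriv_corr_minus] deriv_corr_def hm
    using h by (simp add: cheb3_def hat_def)
  moreover have "symbol (bspline 4) h pi = 2 * (1/3 - bspline 4 h + bspline 4 (2 * h) - bspline 4 (3 * h))"
    unfolding symbol_cheb3[of "bspline 4", OF bspline_4_minus] bspline_4_0
    by (simp add: cheb3_def)
  moreover have "2 * x / (4 * pi\<^sup>2 * (2 * y)) = 1 / (4 * pi\<^sup>2) * (x / y)" for x y
    by simp
  ultimately show ?thesis
    unfolding bandwidth_def bspline_2 by (simp only:)
qed

section \<open>Toeplitz forms, the Riesz bound and the Bernstein inequality\<close>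

definition toeplitz :: "(real \<Rightarrow> real) \<Rightarrow> real \<Rightarrow> int set \<Rightarrow> (int \<Rightarrow> complex) \<Rightarrow> complex" where
  "toeplitz a h S c = (\<Sum>l\<in>S. \<Sum>m\<in>S. c l * cnj (c m) * of_real (a (of_int (l - m) * h)))"

definition band_supported :: "(real \<Rightarrow> real) \<Rightarrow> bool" where
  "band_supported a \<longleftrightarrow> (\<forall>s. 2 \<le> \<bar>s\<bar> \<longrightarrow> a s = 0)"

text \<open>The form is \<open>\<integral> \<bar>\<Sum>\<^sub>l c\<^sub>l exp (2 \<pi> i l x)\<bar>\<^sup>2 \<sigma>(2 \<pi> x) dx\<close> over \<open>[0,1)\<close>, up to its imaginary part, where \<open>\<sigma>\<close> is
  the symbol.\<close>

lemma toeplitz_nonneg: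
  assumes h: "h > 1/2" and supp: "band_supported a" and pos: "\<And>\<theta>. 0 \<le> symbol a h \<theta>"
    and S: "finite S"
  shows "0 \<le> Re (toeplitz a h S c)"
proof -
  let ?M = "period_space 1"
  let ?z = "\<lambda>l m j. c l * cnj (c m) * of_real (a (of_int j * h))"
  define C where "C x = (\<Sum>l\<in>S. c l * trig 1 l x)" for x
  define A where "A x = (\<Sum>j\<in>{-3..3}. complex_of_real (a (of_int j * h)) * trig 1 (- j) x)" for x
  have ReA: "Re (A x) = symbol a h (2 * pi * x)" for x
    unfolding A_def symbol_def Re_sum by (intro sum.cong refl) (simp add: trig_def mult_ac)
  have tri: "integrable ?M (\<lambda>x. z * trig 1 l x)" for z l
    by (intro integrable_mult_right sq_integrable_imp_integrable[OF finite_measure_period_space] sq_integrable_trig)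
  have CA: "C x * cnj (C x) * A x = (\<Sum>l\<in>S. \<Sum>m\<in>S. \<Sum>j\<in>{-3..3}. ?z l m j * trig 1 (l - m - j) x)" for x
  proof -
    have "C x * cnj (C x) * A x = (\<Sum>l\<in>S. \<Sum>m\<in>S. \<Sum>j\<in>{-3..3}. (c l * trig 1 l x * cnj (c m * trig 1 m x)) * (of_real (a (of_int j * h)) * trig 1 (- j) x))"
    proof -
      have "C x * cnj (C x) = (\<Sum>l\<in>S. \<Sum>m\<in>S. c l * trig 1 l x * cnj (c m * trig 1 m x))"
        unfolding C_def cnj_sum sum_product ..
      then show ?thesis
        unfolding A_def by (simp only: sum_distrib_right) (simp only: sum_distrib_left)
    qed
    also have "\<dots> = (\<Sum>l\<in>S. \<Sum>m\<in>S. \<Sum>j\<in>{-3..3}. ?z l m j * trig 1 (l - m - j) x)"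
    proof (intro sum.cong refl)
      fix l m j
      have "trig 1 (l - m - j) x = trig 1 l x * trig 1 (- m) x * trig 1 (- j) x"
        by (simp add: trig_mult)
      then show "(c l * trig 1 l x * cnj (c m * trig 1 m x)) * (of_real (a (of_int j * h)) * trig 1 (- j) x) = ?z l m j * trig 1 (l - m - j) x"
        by (simp add: cnj_trig)
    qed
    finally show ?thesis .
  qed
  have int: "integrable ?M (\<lambda>x. C x * cnj (C x) * A x)"
    unfolding CA by (intro Bochner_Integration.integrable_sum tri)
  have "(\<integral>x. C x * cnj (C x) * A x \<partial>?M) = (\<Sum>l\<in>S. \<Sum>m\<in>S. \<Sum>j\<in>{-3..3}. ?z l m j * (if l - m - j = 0 then 1 else 0))"
  proof -
    have "(\<integral>x. C x * cnj (C x) * A x \<partial>?M) = (\<Sum>l\<in>S. \<integral>x. (\<Sum>m\<in>S. \<Sum>j\<in>{-3..3}. ?z l m j * trig 1 (l - m - j) x) \<partial>?M)"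
      unfolding CA by (intro Bochner_Integration.integral_sum Bochner_Integration.integrable_sum tri)
    also have "\<dots> = (\<Sum>l\<in>S. \<Sum>m\<in>S. \<integral>x. (\<Sum>j\<in>{-3..3}. ?z l m j * trig 1 (l - m - j) x) \<partial>?M)"
      by (intro sum.cong refl Bochner_Integration.integral_sum Bochner_Integration.integrable_sum tri)
    also have "\<dots> = (\<Sum>l\<in>S. \<Sum>m\<in>S. \<Sum>j\<in>{-3..3}. \<integral>x. ?z l m j * trig 1 (l - m - j) x \<partial>?M)"
      by (intro sum.cong refl Bochner_Integration.integral_sum Bochner_Integration.integrable_sum tri)
    also have "\<dots> = (\<Sum>l\<in>S. \<Sum>m\<in>S. \<Sum>j\<in>{-3..3}. ?z l m j * (if l - m - j = 0 then 1 else 0))"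
      by (intro sum.cong refl) (subst integral_mult_right_zero, simp add: integral_trig)
    finally show ?thesis .
  qed
  also have "\<dots> = toeplitz a h S c"
    unfolding toeplitz_def
  proof (intro sum.cong refl)
    fix l m
    have "(\<Sum>j\<in>{-3..3}. ?z l m j * (if l - m - j = 0 then 1 else 0))
      = (\<Sum>j\<in>{-3..3::int}. if j = l - m then c l * cnj (c m) * of_real (a (of_int (l - m) * h)) else 0)"
      by (intro sum.cong refl) auto
    also have "\<dots> = c l * cnj (c m) * of_real (a (of_int (l - m) * h))"
    proof (cases "l - m \<in> {-3..3}")
      case False
      then have "4 \<le> \<bar>of_int (l - m) :: real\<bar>" by auto
      then have "4 * (1/2) \<le> \<bar>of_int (l - m) :: real\<bar> * h" using h by (intro mult_mono) auto
      then have "2 \<le> \<bar>of_int (l - m) * h\<bar>" using h by (simp add: abs_mult)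
      then have "a (of_int (l - m) * h) = 0" using supp by (simp add: band_supported_def)
      then show ?thesis by (simp only: of_real_0 mult_zero_right if_cancel sum.neutral_const)
    next
      case True
      then show ?thesis by (subst sum.delta) auto
    qed
    finally show "(\<Sum>j\<in>{-3..3}. ?z l m j * (if l - m - j = 0 then 1 else 0)) = c l * cnj (c m) * of_real (a (of_int (l - m) * h))" .
  qed
  finally have "Re (toeplitz a h S c) = (\<integral>x. Re (C x * cnj (C x) * A x) \<partial>?M)"
    using integral_bounded_linear[OF bounded_linear_Re int] by simp
  also have "0 \<le> \<dots>"
  proof (rule Bochner_Integration.integral_nonneg)
    fix x
    have "Re (C x * cnj (C x) * A x) = (norm (C x))\<^sup>2 * symbol a h (2 * pi * x)"
      unfolding complex_norm_sq[symmetric] using ReA[of x] by simp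
    then show "0 \<le> Re (C x * cnj (C x) * A x)" using pos by simp
  qed
  finally show ?thesis .
qed

lemma toeplitz_diff: "toeplitz (\<lambda>s. u * a s - b s) h S c = of_real u * toeplitz a h S c - toeplitz b h S c"
  unfolding toeplitz_def by (simp add: sum_subtractf sum_distrib_left algebra_simps)

lemma symbol_diff: "symbol (\<lambda>s. u * a s - b s) h \<theta> = u * symbol a h \<theta> - symbol b h \<theta>"
  unfolding symbol_def by (simp add: sum_subtractf sum_distrib_left algebra_simps)

text \<open>The coefficients of the constant symbol \<open>u\<close>, with form \<open>u \<Sum>\<^sub>l \<bar>c\<^sub>l\<bar>\<^sup>2\<close>.\<close>

definition delta_coeff :: "real \<Rightarrow> real \<Rightarrow> real" where
  "delta_coeff u s = (if s = 0 then u else 0)"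

lemma toeplitz_delta:
  assumes "h \<noteq> 0" "finite S"
  shows "toeplitz (delta_coeff u) h S c = of_real (u * (\<Sum>l\<in>S. (norm (c l))\<^sup>2))"
proof -
  have "toeplitz (delta_coeff u) h S c = (\<Sum>l\<in>S. \<Sum>m\<in>S. if l = m then c l * cnj (c l) * of_real u else 0)"
    unfolding toeplitz_def delta_coeff_def using assms by (intro sum.cong refl) auto
  also have "\<dots> = (\<Sum>l\<in>S. c l * cnj (c l) * of_real u)"
    using assms by simp
  finally show ?thesis
    unfolding complex_norm_sq[symmetric] by (simp add: sum_distrib_left mult.commute)
qed

lemma symbol_delta: "h \<noteq> 0 \<Longrightarrow> symbol (delta_coeff u) h \<theta> = u"
proof -
  assume h: "h \<noteq> 0"
  have "symbol (delta_coeff u) h \<theta> = (\<Sum>j\<in>{-3..3::int}. if j = 0 then u else 0)"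
    unfolding symbol_def delta_coeff_def using h by (intro sum.cong refl) auto
  then show ?thesis by simp
qed

lemma band_supported_bspline_4: "band_supported (bspline 4)"
  unfolding band_supported_def
proof (intro allI impI)
  fix s :: real assume "2 \<le> \<bar>s\<bar>"
  then show "bspline 4 s = 0"
    using bspline_4_values(3)[of s] bspline_4_values(3)[of "- s"] unfolding bspline_4_minus by linarith
qed

lemma band_supported_deriv_corr: "band_supported deriv_corr"
  by (auto simp: band_supported_def deriv_corr_def hat_def)

lemma band_supported_delta: "band_supported (delta_coeff u)"
  by (auto simp: band_supported_def delta_coeff_def)

lemma band_supported_diff: "band_supported a \<Longrightarrow> band_supported b \<Longrightarrow> band_supported (\<lambda>s. u * a s - b s)"
  by (auto simp: band_supported_def)

definition spline_sum :: "(real \<Rightarrow> real) \<Rightarrow> real \<Rightarrow> int set \<Rightarrow> (int \<Rightarrow> complex) \<Rightarrow> real \<Rightarrow> complex" where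
  "spline_sum f h S c y = (\<Sum>l\<in>S. c l * of_real (f (y - of_int l * h)))"

text \<open>Inner products of translates depend only on the difference of the shifts, so the energy of a
  spline sum is the Toeplitz form of the autocorrelation.\<close>

lemma spline_sum_sq_integral:
  fixes f :: "real \<Rightarrow> real"
  assumes fm [measurable]: "f \<in> borel_measurable borel" and f: "\<And>x. \<bar>f x\<bar> \<le> indicator {-1..1} x"
    and a: "\<And>s. (\<integral>x. f x * f (x + s) \<partial>lborel) = a s"
  shows "sq_integrable lborel (spline_sum f h S c)"
    and "sqnorm lborel (spline_sum f h S c) = Re (toeplitz a h S c)"
proof -
  let ?f = "\<lambda>l y. complex_of_real (f (y - of_int l * h))"
  have f0: "sq_integrable lborel (\<lambda>x. complex_of_real (f x))"
    by (rule sq_integrable_unit_support) (use f in simp_all)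
  have fl: "sq_integrable lborel (?f l)" for l
    using sq_integrable_shift[OF f0, of "- (of_int l * h)"] by simp
  show sq: "sq_integrable lborel (spline_sum f h S c)"
    unfolding spline_sum_def[abs_def] by (intro sq_integrable_sum sq_integrable_cmult fl)
  have int: "integrable lborel (\<lambda>y. c l * cnj (c m) * (?f l y * cnj (?f m y)))" for l m
    by (intro integrable_mult_right sq_integrable_mult_cnj fl)
  have corr: "(\<integral>y. ?f l y * cnj (?f m y) \<partial>lborel) = of_real (a (of_int (l - m) * h))" for l m
  proof -
    have "(\<integral>y. ?f l y * cnj (?f m y) \<partial>lborel) = (\<integral>y. complex_of_real (f (y - of_int l * h) * f (y - of_int m * h)) \<partial>lborel)"
      by simp
    also have "\<dots> = of_real (\<integral>y. f (y - of_int l * h) * f (y - of_int m * h) \<partial>lborel)"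
      by (rule integral_complex_of_real)
    also have "(\<integral>y. f (y - of_int l * h) * f (y - of_int m * h) \<partial>lborel)
       = (\<integral>y. (f (y + of_int l * h - of_int l * h) * f (y + of_int l * h - of_int m * h)) \<partial>lborel)"
      by (rule integral_lborel_shift[symmetric])
    also have "\<dots> = a (of_int (l - m) * h)"
      using a[of "of_int (l - m) * h"] by (simp add: algebra_simps)
    finally show ?thesis .
  qed
  have "complex_of_real (sqnorm lborel (spline_sum f h S c)) = (\<integral>y. spline_sum f h S c y * cnj (spline_sum f h S c y) \<partial>lborel)"
    by (simp only: complex_norm_sq flip: integral_complex_of_real)
  also have "\<dots> = (\<integral>y. (\<Sum>l\<in>S. \<Sum>m\<in>S. c l * cnj (c m) * (?f l y * cnj (?f m y))) \<partial>lborel)"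
    unfolding spline_sum_def cnj_sum sum_product complex_cnj_mult
    by (simp only: mult_ac)
  also have "\<dots> = (\<Sum>l\<in>S. \<integral>y. (\<Sum>m\<in>S. c l * cnj (c m) * (?f l y * cnj (?f m y))) \<partial>lborel)"
    by (intro Bochner_Integration.integral_sum Bochner_Integration.integrable_sum int)
  also have "\<dots> = (\<Sum>l\<in>S. \<Sum>m\<in>S. \<integral>y. c l * cnj (c m) * (?f l y * cnj (?f m y)) \<partial>lborel)"
    by (intro sum.cong refl Bochner_Integration.integral_sum int)
  also have "\<dots> = toeplitz a h S c"
    unfolding toeplitz_def by (intro sum.cong refl) (subst integral_mult_right_zero, simp only: corr)
  finally show "sqnorm lborel (spline_sum f h S c) = Re (toeplitz a h S c)"
    by (rule arg_cong[where f = Re, THEN trans[OF Re_complex_of_real[symmetric]]])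
qed

lemma hat_sum_sq_integral:
  "sq_integrable lborel (spline_sum hat h S c)"
  "sqnorm lborel (spline_sum hat h S c) = Re (toeplitz (bspline 4) h S c)"
  by (rule spline_sum_sq_integral[OF hat_measurable hat_bounded hat_autocorrelation])+

lemma hat_deriv_sum_sq_integral:
  "sq_integrable lborel (spline_sum hat_deriv h S c)"
  "sqnorm lborel (spline_sum hat_deriv h S c) = Re (toeplitz deriv_corr h S c)"
  by (rule spline_sum_sq_integral[OF hat_deriv_measurable hat_deriv_bounded hat_deriv_autocorrelation[folded deriv_corr_def]])+

text \<open>The symbol of \<open>Q\<^sub>4\<close> minus its minimum \<open>D(\<pi>)\<close> is nonnegative, hence so is the Toeplitz form.\<close>

theorem riesz_lower_bound:
  assumes h: "h > 1/2" and S: "finite S"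
  shows "symbol (bspline 4) h pi * (\<Sum>l\<in>S. (norm (c l))\<^sup>2) \<le> sqnorm lborel (spline_sum hat h S c)"
proof -
  have "0 \<le> Re (toeplitz (\<lambda>s. 1 * bspline 4 s - delta_coeff (symbol (bspline 4) h pi) s) h S c)"
    by (intro toeplitz_nonneg h S band_supported_diff band_supported_bspline_4 band_supported_delta)
       (use symbols_extremal_at_pi(2)[OF h] h in \<open>simp add: symbol_diff[of 1, simplified] symbol_delta\<close>)
  then show ?thesis
    unfolding toeplitz_diff hat_sum_sq_integral using h S by (simp add: toeplitz_delta)
qed

text \<open>The symbol of \<open>u Q\<^sub>4 + Q\<^sub>4''\<close> with \<open>u = N(\<pi>) / D(\<pi>)\<close> is \<open>u D - N\<close>, nonnegative by extremality.\<close>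

theorem bernstein_inequality:
  assumes h: "h > 1/2" and S: "finite S"
  shows "sqnorm lborel (spline_sum hat_deriv h S c) \<le> 4 * pi\<^sup>2 * bandwidth h * sqnorm lborel (spline_sum hat h S c)"
proof -
  let ?u = "4 * pi\<^sup>2 * bandwidth h"
  have pos: "symbol (bspline 4) h pi > 0" by (rule symbols_extremal_at_pi(1)[OF h])
  have u: "?u = symbol deriv_corr h pi / symbol (bspline 4) h pi"
    unfolding bandwidth_def by simp
  have "0 \<le> Re (toeplitz (\<lambda>s. ?u * bspline 4 s - deriv_corr s) h S c)"
  proof (intro toeplitz_nonneg h S band_supported_diff band_supported_bspline_4 band_supported_deriv_corr)
    fix \<theta>
    have "symbol deriv_corr h \<theta> \<le> ?u * symbol (bspline 4) h \<theta>"
      unfolding u using pos symbols_extremal_at_pi(3)[OF h, of \<theta>] by (simp add: field_simps)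
    then show "0 \<le> symbol (\<lambda>s. ?u * bspline 4 s - deriv_corr s) h \<theta>"
      unfolding symbol_diff by simp
  qed
  then show ?thesis
    unfolding toeplitz_diff hat_sum_sq_integral hat_deriv_sum_sq_integral by simp
qed

section \<open>Wirtinger's inequality\<close>

lemma ennreal_norm_sq: "ennreal ((norm z)\<^sup>2) = (ennreal (norm z))\<^sup>2"
  by (simp add: ennreal_power)

text \<open>Let \<open>k = \<pi> / (2 b)\<close>. The Cauchy-Schwarz inequality with the weight \<open>cos (k t)\<close>, the derivative of the
  extremal function \<open>sin (k t) / k\<close>, gives
  \<open>\<bar>u(s)\<bar>\<^sup>2 \<le> (sin (k s) / k) \<integral> \<bar>v(t)\<bar>\<^sup>2 / cos (k t) dt\<close> over \<open>[0,s]\<close>. Integrating over \<open>s\<close> and exchanging the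
  integrals, \<open>\<integral> sin (k s) / k ds = cos (k t) / k\<^sup>2\<close> over \<open>[t,b]\<close> cancels the weight and leaves the sharp
  constant \<open>1 / k\<^sup>2\<close>. No pointwise derivative of \<open>u\<close> enters, so \<open>v\<close> may jump, as the derivative of a spline
  does.\<close>

theorem wirtinger_zero_start:
  fixes v :: "real \<Rightarrow> complex"
  assumes b: "b > 0" and v [measurable]: "v \<in> borel_measurable borel"
    and u: "\<And>s. 0 \<le> s \<Longrightarrow> s < b \<Longrightarrow> has_bochner_integral lborel (\<lambda>t. indicator {0..s} t *\<^sub>R v t) (u s)"
  shows "(\<integral>\<^sup>+s. ennreal ((norm (u s))\<^sup>2) * indicator {0..<b} s \<partial>lborel)
    \<le> ennreal ((2 * b / pi)\<^sup>2) * (\<integral>\<^sup>+t. ennreal ((norm (v t))\<^sup>2) * indicator {0..<b} t \<partial>lborel)"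
proof -
  define k where "k = pi / (2 * b)"
  have k: "k > 0" "k * b = pi / 2" "1 / k\<^sup>2 = (2 * b / pi)\<^sup>2"
    using b by (auto simp: k_def field_simps power2_eq_square)
  have cos_pos: "cos (k * t) > 0" if "0 \<le> t" "t < b" for t
  proof (rule cos_gt_zero_pi)
    have "0 \<le> k * t" "k * t < k * b" using that k by auto
    then show "- (pi / 2) < k * t" "k * t < pi / 2" using k pi_gt_zero by linarith+
  qed
  have sin_nonneg: "0 \<le> sin (k * t)" if "0 \<le> t" "t \<le> b" for t
  proof (rule sin_ge_zero)
    show "0 \<le> k * t" using that k by simp
    have "k * t \<le> k * b" using that k by simp
    then show "k * t \<le> pi" using k pi_gt_zero by linarith
  qed
  define W where "W t = ennreal ((norm (v t))\<^sup>2 / cos (k * t))" for t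
  have [measurable]: "W \<in> borel_measurable borel" unfolding W_def by measurable
  let ?P = "\<lambda>s t. ennreal (sin (k * s) / k) * W t * indicator {t..<b} s * indicator {0..<b} t"
  let ?J = "\<integral>\<^sup>+t. ennreal ((norm (v t))\<^sup>2) * indicator {0..<b} t \<partial>lborel"
  have pointwise: "ennreal ((norm (u s))\<^sup>2) \<le> ennreal (sin (k * s) / k) * (\<integral>\<^sup>+t. W t * indicator {0..s} t \<partial>lborel)"
    if s: "0 \<le> s" "s < b" for s
  proof -
    let ?f = "\<lambda>t. ennreal (norm (v t) / sqrt (cos (k * t))) * indicator {0..s} t"
    let ?g = "\<lambda>t. ennreal (sqrt (cos (k * t))) * indicator {0..s} t"
    have "ennreal (norm (u s)) \<le> (\<integral>\<^sup>+t. ennreal (norm (indicator {0..s} t *\<^sub>R v t)) \<partial>lborel)"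
      using u[OF s] by (rule has_bochner_integral_norm_bound)
    also have "\<dots> = (\<integral>\<^sup>+t. ?f t * ?g t \<partial>lborel)"
    proof (intro nn_integral_cong)
      fix t
      show "ennreal (norm (indicator {0..s} t *\<^sub>R v t)) = ?f t * ?g t"
      proof (cases "t \<in> {0..s}")
        case True
        then have "cos (k * t) > 0" using s by (intro cos_pos) auto
        then show ?thesis using True by (simp flip: ennreal_mult)
      qed simp
    qed
    finally have "ennreal ((norm (u s))\<^sup>2) \<le> (\<integral>\<^sup>+t. ?f t * ?g t \<partial>lborel)\<^sup>2"
      unfolding ennreal_norm_sq by (rule power_mono) simp
    also have "\<dots> \<le> (\<integral>\<^sup>+t. ?f t ^ 2 \<partial>lborel) * (\<integral>\<^sup>+t. ?g t ^ 2 \<partial>lborel)"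
      by (rule Cauchy_Schwarz_nn_integral) measurable
    also have "(\<integral>\<^sup>+t. ?f t ^ 2 \<partial>lborel) = (\<integral>\<^sup>+t. W t * indicator {0..s} t \<partial>lborel)"
    proof (intro nn_integral_cong)
      fix t
      show "?f t ^ 2 = W t * indicator {0..s} t"
      proof (cases "t \<in> {0..s}")
        case True
        then have "cos (k * t) > 0" using s by (intro cos_pos) auto
        then show ?thesis using True by (simp add: W_def ennreal_power power_divide)
      qed simp
    qed
    also have "(\<integral>\<^sup>+t. ?g t ^ 2 \<partial>lborel) = (\<integral>\<^sup>+t. ennreal (cos (k * t)) * indicator {0..s} t \<partial>lborel)"
    proof (intro nn_integral_cong)
      fix t
      show "?g t ^ 2 = ennreal (cos (k * t)) * indicator {0..s} t"
      proof (cases "t \<in> {0..s}")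
        case True
        then have "cos (k * t) > 0" using s by (intro cos_pos) auto
        then show ?thesis using True by (simp add: ennreal_power)
      qed simp
    qed
    also have "\<dots> = ennreal (sin (k * s) / k - sin (k * 0) / k)"
    proof (rule nn_integral_FTC_Icc[where F = "\<lambda>t. sin (k * t) / k"])
      fix t assume t: "t \<in> {0..s}"
      show "((\<lambda>t. sin (k * t) / k) has_real_derivative cos (k * t)) (at t)"
        using k by (auto intro!: derivative_eq_intros)
      show "0 \<le> cos (k * t)" using t s cos_pos[of t] by auto
    qed (use s in auto)
    finally show ?thesis by (simp add: mult.commute)
  qed
  have tail: "(\<integral>\<^sup>+s. ennreal (sin (k * s) / k) * indicator {t..<b} s \<partial>lborel) = ennreal (cos (k * t) / k\<^sup>2)"
    if t: "0 \<le> t" "t < b" for t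
  proof -
    have "(\<integral>\<^sup>+s. ennreal (sin (k * s) / k) * indicator {t..<b} s \<partial>lborel) = (\<integral>\<^sup>+s. ennreal (sin (k * s) / k) * indicator {t..b} s \<partial>lborel)"
      by (intro nn_integral_cong_AE, use AE_lborel_singleton[of b] in eventually_elim) (auto simp: indicator_def)
    also have "\<dots> = ennreal (- cos (k * b) / k\<^sup>2 - - cos (k * t) / k\<^sup>2)"
    proof (rule nn_integral_FTC_Icc[where F = "\<lambda>t. - cos (k * t) / k\<^sup>2"])
      fix s assume s: "s \<in> {t..b}"
      show "((\<lambda>t. - cos (k * t) / k\<^sup>2) has_real_derivative sin (k * s) / k) (at s)"
        using k by (auto intro!: derivative_eq_intros simp: power2_eq_square)
      show "0 \<le> sin (k * s) / k" using s t k sin_nonneg[of s] by auto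
    qed (use t in auto)
    finally show ?thesis by (simp add: k(2))
  qed
  have "(\<integral>\<^sup>+s. ennreal ((norm (u s))\<^sup>2) * indicator {0..<b} s \<partial>lborel)
    \<le> (\<integral>\<^sup>+s. (\<integral>\<^sup>+t. ?P s t \<partial>lborel) \<partial>lborel)"
  proof (intro nn_integral_mono)
    fix s
    show "ennreal ((norm (u s))\<^sup>2) * indicator {0..<b} s \<le> (\<integral>\<^sup>+t. ?P s t \<partial>lborel)"
    proof (cases "s \<in> {0..<b}")
      case True
      then have "ennreal ((norm (u s))\<^sup>2) * indicator {0..<b} s \<le> ennreal (sin (k * s) / k) * (\<integral>\<^sup>+t. W t * indicator {0..s} t \<partial>lborel)"
        using pointwise[of s] by simp
      also have "\<dots> = (\<integral>\<^sup>+t. ennreal (sin (k * s) / k) * (W t * indicator {0..s} t) \<partial>lborel)"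
        by (rule nn_integral_cmult[symmetric]) measurable
      also have "\<dots> = (\<integral>\<^sup>+t. ?P s t \<partial>lborel)"
        using True by (intro nn_integral_cong) (auto simp: indicator_def mult_ac)
      finally show ?thesis .
    qed simp
  qed
  also have "\<dots> = (\<integral>\<^sup>+t. (\<integral>\<^sup>+s. ?P s t \<partial>lborel) \<partial>lborel)"
  proof (rule lborel_pair.Fubini')
    have [measurable]: "(\<lambda>(t, s). indicator {t..<b} s :: ennreal) \<in> borel_measurable (lborel \<Otimes>\<^sub>M lborel)"
    proof -
      have "(\<lambda>(t, s). indicator {t..<b} s :: ennreal) = indicator {x. fst x \<le> snd x \<and> snd x < b}"
        by (auto simp: indicator_def fun_eq_iff)
      moreover have "{x \<in> space (lborel \<Otimes>\<^sub>M lborel). fst x \<le> snd x \<and> snd x < b} \<in> sets (lborel \<Otimes>\<^sub>M (lborel :: real measure))"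
        by measurable
      ultimately show ?thesis by (simp add: space_pair_measure)
    qed
    show "(\<lambda>(t, s). ?P s t) \<in> borel_measurable (lborel \<Otimes>\<^sub>M lborel)"
      by measurable
  qed
  also have "\<dots> = (\<integral>\<^sup>+t. ennreal ((2 * b / pi)\<^sup>2) * (ennreal ((norm (v t))\<^sup>2) * indicator {0..<b} t) \<partial>lborel)"
  proof (intro nn_integral_cong)
    fix t
    show "(\<integral>\<^sup>+s. ?P s t \<partial>lborel) = ennreal ((2 * b / pi)\<^sup>2) * (ennreal ((norm (v t))\<^sup>2) * indicator {0..<b} t)"
    proof (cases "t \<in> {0..<b}")
      case True
      then have t: "0 \<le> t" "t < b" by auto
      have "(\<integral>\<^sup>+s. ?P s t \<partial>lborel)
        = (\<integral>\<^sup>+s. W t * (ennreal (sin (k * s) / k) * indicator {t..<b} s) \<partial>lborel)"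
        using True by (intro nn_integral_cong) (simp add: mult_ac)
      also have "\<dots> = W t * ennreal (cos (k * t) / k\<^sup>2)"
        by (subst nn_integral_cmult) (auto simp: tail[OF t])
      also have "\<dots> = ennreal ((norm (v t))\<^sup>2 / cos (k * t) * (cos (k * t) / k\<^sup>2))"
        unfolding W_def using cos_pos[OF t] by (intro ennreal_mult'[symmetric]) simp
      also have "(norm (v t))\<^sup>2 / cos (k * t) * (cos (k * t) / k\<^sup>2) = (2 * b / pi)\<^sup>2 * (norm (v t))\<^sup>2"
        unfolding k(3)[symmetric] using cos_pos[OF t] by simp
      finally show ?thesis using True by (simp add: ennreal_mult')
    qed simp
  qed
  also have "\<dots> = ennreal ((2 * b / pi)\<^sup>2) * ?J"
    by (rule nn_integral_cmult) measurable
  finally show ?thesis .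
qed

section \<open>Sampling finite spline sums\<close>

lemma hat_decrement:
  assumes "0 \<le> s"
  shows "has_bochner_integral lborel (\<lambda>t. indicator {0..s} t * - hat_deriv (y - t)) (hat (y - s) - hat y)"
proof -
  have "hat_deriv (- y + t) = - hat_deriv (y - t)" for t
    by (auto simp: hat_deriv_def indicator_def)
  then show ?thesis
    using hat_increment[OF assms, of "- y"] hat_minus[of y] hat_minus[of "y - s"] by simp
qed

lemma spline_sum_increment:
  assumes s: "0 \<le> s" and \<sigma>: "\<sigma> = 1 \<or> \<sigma> = -1"
  shows "has_bochner_integral lborel (\<lambda>t. indicator {0..s} t *\<^sub>R (of_real \<sigma> * spline_sum hat_deriv h S c (y + \<sigma> * t)))
     (spline_sum hat h S c (y + \<sigma> * s) - spline_sum hat h S c y)"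
proof -
  have one: "has_bochner_integral lborel (\<lambda>t. indicator {0..s} t * (\<sigma> * hat_deriv (x + \<sigma> * t))) (hat (x + \<sigma> * s) - hat x)" for x
    using \<sigma> hat_increment[OF s, of x] hat_decrement[OF s, of x] by auto
  have "has_bochner_integral lborel (\<lambda>t. \<Sum>l\<in>S. c l * of_real (indicator {0..s} t * (\<sigma> * hat_deriv ((y - of_int l * h) + \<sigma> * t))))
    (\<Sum>l\<in>S. c l * of_real (hat ((y - of_int l * h) + \<sigma> * s) - hat (y - of_int l * h)))"
    by (intro has_bochner_integral_sum has_bochner_integral_mult_right has_bochner_integral_of_real one)
  moreover have "(\<lambda>t. \<Sum>l\<in>S. c l * of_real (indicator {0..s} t * (\<sigma> * hat_deriv ((y - of_int l * h) + \<sigma> * t))))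
    = (\<lambda>t. indicator {0..s} t *\<^sub>R (of_real \<sigma> * spline_sum hat_deriv h S c (y + \<sigma> * t)))"
    unfolding spline_sum_def by (simp add: fun_eq_iff sum_distrib_left scaleR_conv_of_real algebra_simps)
  moreover have "(\<Sum>l\<in>S. c l * of_real (hat ((y - of_int l * h) + \<sigma> * s) - hat (y - of_int l * h)))
    = spline_sum hat h S c (y + \<sigma> * s) - spline_sum hat h S c y"
    unfolding spline_sum_def sum_subtractf[symmetric] by (intro sum.cong refl) (simp add: algebra_simps)
  ultimately show ?thesis by (simp only:)
qed

lemma spline_sum_measurable [measurable]:
  assumes [measurable]: "f \<in> borel_measurable borel"
  shows "spline_sum f h S c \<in> borel_measurable borel"
  unfolding spline_sum_def[abs_def] by measurable

lemma nn_integral_reflect_split: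
  assumes [measurable]: "G \<in> borel_measurable borel" and b: "b > (0::real)"
  shows "(\<integral>\<^sup>+s. G s * indicator {-b..<b} s \<partial>lborel) =
    (\<integral>\<^sup>+s. G s * indicator {0..<b} s \<partial>lborel) + (\<integral>\<^sup>+s. G (- s) * indicator {0..<b} s \<partial>lborel)"
proof -
  have "(\<integral>\<^sup>+s. G (- s) * indicator {0..<b} s \<partial>lborel) = (\<integral>\<^sup>+s. G s * indicator {0..<b} (- s) \<partial>lborel)"
    using nn_integral_real_affine[of "\<lambda>s. G s * indicator {0..<b} (- s)" "-1" 0] by simp
  then have "(\<integral>\<^sup>+s. G s * indicator {0..<b} s \<partial>lborel) + (\<integral>\<^sup>+s. G (- s) * indicator {0..<b} s \<partial>lborel)
    = (\<integral>\<^sup>+s. G s * indicator {0..<b} s + G s * indicator {0..<b} (- s) \<partial>lborel)"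
    by (simp add: nn_integral_add)
  also have "\<dots> = (\<integral>\<^sup>+s. G s * indicator {-b..<b} s \<partial>lborel)"
  proof (intro nn_integral_cong_AE)
    show "AE s in lborel. G s * indicator {0..<b} s + G s * indicator {0..<b} (- s) = G s * indicator {-b..<b} s"
      using AE_lborel_singleton[of 0] AE_lborel_singleton[of "-b"]
      by eventually_elim (use b in \<open>auto simp: indicator_def\<close>)
  qed
  finally show ?thesis ..
qed

text \<open>The error \<open>g - g(y)\<close> vanishes at the sample, so Wirtinger's inequality bounds it by \<open>g'\<close>. The sign
  \<open>\<sigma>\<close> selects the half cell to the right or to the left of the sample.\<close>

lemma spline_sum_half_cell:
  assumes b: "b > 0" and e: "e > 0" and \<sigma>: "\<sigma> = 1 \<or> \<sigma> = -1"
  shows "(\<integral>\<^sup>+s. ennreal ((norm (spline_sum hat h S c (y + \<sigma> * s)))\<^sup>2) * indicator {0..<b} s \<partial>lborel) \<le>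
     ennreal ((1 + e) * (2 * b / pi)\<^sup>2) * (\<integral>\<^sup>+s. ennreal ((norm (spline_sum hat_deriv h S c (y + \<sigma> * s)))\<^sup>2) * indicator {0..<b} s \<partial>lborel)
     + ennreal ((1 + 1 / e) * b * (norm (spline_sum hat h S c y))\<^sup>2)"
proof -
  let ?g = "spline_sum hat h S c" and ?g' = "spline_sum hat_deriv h S c"
  let ?d = "\<lambda>s. (norm (?g (y + \<sigma> * s) - ?g y))\<^sup>2" and ?r = "(1 + 1 / e) * (norm (?g y))\<^sup>2"
  let ?I = "\<integral>\<^sup>+s. ennreal ((norm (?g' (y + \<sigma> * s)))\<^sup>2) * indicator {0..<b} s \<partial>lborel"
  have "(\<integral>\<^sup>+s. ennreal ((norm (?g (y + \<sigma> * s)))\<^sup>2) * indicator {0..<b} s \<partial>lborel) \<le>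
    (\<integral>\<^sup>+s. ennreal (1 + e) * (ennreal (?d s) * indicator {0..<b} s)
       + ennreal (?r) * indicator {0..<b} s \<partial>lborel)"
  proof (intro nn_integral_mono)
    fix s
    have "(norm (?g (y + \<sigma> * s)))\<^sup>2 \<le> (1 + e) * ?d s + ?r"
      using norm_add_sq_weighted[OF e, of "?g (y + \<sigma> * s) - ?g y" "?g y"] by simp
    then have "ennreal ((norm (?g (y + \<sigma> * s)))\<^sup>2) \<le> ennreal ((1 + e) * ?d s + ?r)"
      by (rule ennreal_leI)
    also have "\<dots> = ennreal (1 + e) * ennreal (?d s) + ennreal (?r)"
      using e by (subst ennreal_plus) (auto simp: ennreal_mult)
    finally show "ennreal ((norm (?g (y + \<sigma> * s)))\<^sup>2) * indicator {0..<b} s \<le> ennreal (1 + e) * (ennreal (?d s) * indicator {0..<b} s)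
       + ennreal (?r) * indicator {0..<b} s"
      by (auto simp: indicator_def)
  qed
  also have "\<dots> = ennreal (1 + e) * (\<integral>\<^sup>+s. ennreal (?d s) * indicator {0..<b} s \<partial>lborel)
      + ennreal (?r) * emeasure lborel {0..<b}"
    by (subst nn_integral_add) (auto simp: nn_integral_cmult)
  also have "(\<integral>\<^sup>+s. ennreal (?d s) * indicator {0..<b} s \<partial>lborel)
     \<le> ennreal ((2 * b / pi)\<^sup>2) * (\<integral>\<^sup>+s. ennreal ((norm (of_real \<sigma> * ?g' (y + \<sigma> * s)))\<^sup>2) * indicator {0..<b} s \<partial>lborel)"
    by (rule wirtinger_zero_start[OF b]) (use spline_sum_increment[OF _ \<sigma>] in auto)
  also have "(\<integral>\<^sup>+s. ennreal ((norm (of_real \<sigma> * ?g' (y + \<sigma> * s)))\<^sup>2) * indicator {0..<b} s \<partial>lborel) = ?I"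
    using \<sigma> by (auto simp: norm_mult)
  also have "ennreal (1 + e) * (ennreal ((2 * b / pi)\<^sup>2) * ?I) = ennreal ((1 + e) * (2 * b / pi)\<^sup>2) * ?I"
    using e by (subst ennreal_mult) (auto simp: mult.assoc)
  also have "ennreal (?r) * emeasure lborel {0..<b} = ennreal ((1 + 1 / e) * b * (norm (?g y))\<^sup>2)"
    using b e by (simp add: ennreal_mult[symmetric] mult_ac)
  finally show ?thesis by (simp add: add_mono mult_left_mono)
qed

lemma spline_sum_cell:
  assumes \<alpha>: "\<alpha> > 0" and e: "e > 0"
  shows "(\<integral>\<^sup>+s. ennreal ((norm (spline_sum hat h S c (s + y)))\<^sup>2) * indicator {-(\<alpha>/2)..<\<alpha>/2} s \<partial>lborel) \<le>
     ennreal ((1 + e) * (\<alpha> / pi)\<^sup>2) * (\<integral>\<^sup>+s. ennreal ((norm (spline_sum hat_deriv h S c (s + y)))\<^sup>2) * indicator {-(\<alpha>/2)..<\<alpha>/2} s \<partial>lborel)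
     + ennreal ((1 + 1 / e) * \<alpha>) * ennreal ((norm (spline_sum hat h S c y))\<^sup>2)"
proof -
  let ?g = "spline_sum hat h S c" and ?g' = "spline_sum hat_deriv h S c"
  let ?c = "ennreal ((1 + e) * (\<alpha> / pi)\<^sup>2)" and ?d = "ennreal ((1 + 1 / e) * (\<alpha>/2) * (norm (?g y))\<^sup>2)"
  let ?R = "\<lambda>g :: real \<Rightarrow> complex. \<integral>\<^sup>+s. ennreal ((norm (g (s + y)))\<^sup>2) * indicator {0..<\<alpha>/2} s \<partial>lborel"
  let ?L = "\<lambda>g :: real \<Rightarrow> complex. \<integral>\<^sup>+s. ennreal ((norm (g (- s + y)))\<^sup>2) * indicator {0..<\<alpha>/2} s \<partial>lborel"
  have b: "\<alpha>/2 > 0" using \<alpha> by simp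
  have right: "?R ?g
      \<le> ?c * ?R ?g' + ?d"
    using spline_sum_half_cell[OF b e, of 1 h S c y] by (simp add: add.commute[of y])
  have left: "?L ?g
      \<le> ?c * ?L ?g' + ?d"
    using spline_sum_half_cell[OF b e, of "-1" h S c y] by (simp add: add.commute[of y])
  have dd: "?d + ?d = ennreal ((1 + 1 / e) * \<alpha>) * ennreal ((norm (?g y))\<^sup>2)"
    using \<alpha> e by (simp add: ennreal_plus[symmetric] ennreal_mult[symmetric] del: ennreal_plus)
  have "(\<integral>\<^sup>+s. ennreal ((norm (?g (s + y)))\<^sup>2) * indicator {-(\<alpha>/2)..<\<alpha>/2} s \<partial>lborel)
     = ?R ?g
      + ?L ?g"
    using nn_integral_reflect_split[OF _ b, of "\<lambda>s. ennreal ((norm (?g (s + y)))\<^sup>2)"] by simp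
  also have "\<dots> \<le> (?c * ?R ?g' + ?d)
     + (?c * ?L ?g' + ?d)"
    by (rule add_mono[OF right left])
  also have "\<dots> = ?c * (?R ?g'
       + ?L ?g') + (?d + ?d)"
    by (simp only: distrib_left add_ac)
  also have "?R ?g'
       + ?L ?g'
     = (\<integral>\<^sup>+s. ennreal ((norm (?g' (s + y)))\<^sup>2) * indicator {-(\<alpha>/2)..<\<alpha>/2} s \<partial>lborel)"
    using nn_integral_reflect_split[OF _ b, of "\<lambda>s. ennreal ((norm (?g' (s + y)))\<^sup>2)"] by simp
  finally show ?thesis unfolding dd .
qed

lemma nn_integral_cells_shift:
  fixes F :: "real \<Rightarrow> ennreal"
  assumes "T > 0" and [measurable]: "F \<in> borel_measurable borel"
  shows "(\<integral>\<^sup>+x. F x \<partial>lborel) =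
    (\<integral>\<^sup>+k. (\<integral>\<^sup>+x. F (x + (of_int k * T - t)) * indicator {-(T/2)..<T/2} x \<partial>lborel) \<partial>count_space (UNIV::int set))"
proof -
  have "(\<integral>\<^sup>+x. F x \<partial>lborel) = (\<integral>\<^sup>+x. F (x + (- t)) \<partial>lborel)"
    by (rule nn_integral_lborel_shift[symmetric]) simp
  also have "\<dots> = (\<integral>\<^sup>+k. (\<integral>\<^sup>+x. F (x + of_int k * T + (- t)) * indicator {-(T/2)..<-(T/2) + T} x \<partial>lborel) \<partial>count_space (UNIV::int set))"
    by (rule nn_integral_cells[OF assms(1)]) measurable
  finally show ?thesis by (simp add: algebra_simps)
qed

lemma ennreal_le_cancel_summand:
  assumes "ennreal a \<le> ennreal b + X" "0 \<le> b" "b \<le> a"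
  shows "ennreal (a - b) \<le> X"
proof -
  have "ennreal (a - b) + ennreal b \<le> X + ennreal b"
    using assms by (simp add: ennreal_plus[symmetric] add.commute del: ennreal_plus)
  then show ?thesis by (simp add: ennreal_add_left_cancel_le add.commute[of _ "ennreal b"])
qed

text \<open>Summing over the cells reassembles \<open>\<parallel>g\<parallel>\<^sup>2\<close> and \<open>\<parallel>g'\<parallel>\<^sup>2\<close>; the Bernstein inequality lets the
  derivative term be absorbed into the left-hand side.\<close>

lemma sampling_energy_bound:
  assumes h: "h > 1/2" and \<alpha>: "\<alpha> > 0" and e: "e > 0"
    and small: "(1 + e) * (4 * \<alpha>\<^sup>2 * bandwidth h) < 1" and S: "finite S"
  shows "ennreal ((1 - (1 + e) * (4 * \<alpha>\<^sup>2 * bandwidth h)) * sqnorm lborel (spline_sum hat h S c))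
    \<le> ennreal ((1 + 1 / e) * \<alpha>) * sq_sum (\<lambda>k. spline_sum hat h S c (of_int k * \<alpha> - x))"
proof -
  let ?g = "spline_sum hat h S c" and ?g' = "spline_sum hat_deriv h S c"
  let ?E = "sqnorm lborel ?g" and ?E' = "sqnorm lborel ?g'"
  let ?q = "(1 + e) * (4 * \<alpha>\<^sup>2 * bandwidth h)"
  let ?y = "\<lambda>k. of_int k * \<alpha> - x"
  let ?cell = "\<lambda>g k. \<integral>\<^sup>+s. ennreal ((norm (g (s + ?y k)))\<^sup>2) * indicator {-(\<alpha>/2)..<\<alpha>/2} s \<partial>lborel"
  let ?c = "ennreal ((1 + e) * (\<alpha> / pi)\<^sup>2)" and ?d = "ennreal ((1 + 1 / e) * \<alpha>)"
  have E: "energy ?g = ennreal ?E" "energy ?g' = ennreal ?E'"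
    using hat_sum_sq_integral(1)[of h S c] hat_deriv_sum_sq_integral(1)[of h S c]
    by (auto simp: sq_integrable_def intro!: nn_integral_eq_integral)
  have "ennreal ?E = (\<integral>\<^sup>+k. (\<integral>\<^sup>+s. ennreal ((norm (?g (s + ?y k)))\<^sup>2) * indicator {-(\<alpha>/2)..<\<alpha>/2} s \<partial>lborel) \<partial>count_space (UNIV::int set))"
    unfolding E(1)[symmetric] by (rule nn_integral_cells_shift[OF \<alpha>]) measurable
  also have "\<dots> \<le> (\<integral>\<^sup>+k. ?c * ?cell ?g' k
     + ?d * ennreal ((norm (?g (?y k)))\<^sup>2) \<partial>count_space (UNIV::int set))"
    by (intro nn_integral_mono spline_sum_cell \<alpha> e)
  also have "\<dots> = ?c * (\<integral>\<^sup>+k. ?cell ?g' k \<partial>count_space (UNIV::int set))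
     + ?d * sq_sum (\<lambda>k. ?g (?y k))"
    by (simp add: nn_integral_add nn_integral_cmult)
  also have "(\<integral>\<^sup>+k. ?cell ?g' k \<partial>count_space (UNIV::int set)) = ennreal ?E'"
    unfolding E(2)[symmetric] by (rule nn_integral_cells_shift[OF \<alpha>, symmetric]) measurable
  also have "?c * ennreal ?E' \<le> ennreal (?q * ?E)"
  proof -
    have "(1 + e) * (\<alpha> / pi)\<^sup>2 * ?E' \<le> (1 + e) * (\<alpha> / pi)\<^sup>2 * (4 * pi\<^sup>2 * bandwidth h * ?E)"
      using e bernstein_inequality[OF h S] by (intro mult_left_mono) auto
    also have "\<dots> = ?q * ?E" by (simp add: power_divide)
    finally show ?thesis
      using e by (subst ennreal_mult[symmetric]) (auto intro: ennreal_leI)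
  qed
  finally have le: "ennreal ?E \<le> ennreal (?q * ?E) + ?d * sq_sum (\<lambda>k. ?g (?y k))"
    by (simp add: add_right_mono)
  have E0: "0 \<le> ?E" by simp
  have "0 \<le> ?q * ?E"
  proof -
    have "0 \<le> ?E'" by simp
    then have "0 \<le> 4 * pi\<^sup>2 * bandwidth h * ?E" using bernstein_inequality[OF h S, of c] by linarith
    then have "0 \<le> (1 + e) * (\<alpha> / pi)\<^sup>2 * (4 * pi\<^sup>2 * bandwidth h * ?E)" 
      by (rule mult_nonneg_nonneg[rotated]) (use e in simp)
    also have "\<dots> = ?q * ?E" by (simp add: power_divide)
    finally show ?thesis .
  qed
  moreover have "?q * ?E \<le> 1 * ?E" using small E0 by (intro mult_right_mono) auto
  ultimately have "ennreal (?E - ?q * ?E) \<le> ?d * sq_sum (\<lambda>k. ?g (?y k))"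
    by (intro ennreal_le_cancel_summand[OF le]) auto
  then show ?thesis by (simp add: algebra_simps)
qed

theorem sampling_lower_bound:
  assumes h: "h > 1/2" and \<alpha>: "\<alpha> > 0" "\<alpha> < 1 / (2 * sqrt (bandwidth h))"
  obtains A where "A > 0"
    "\<And>(S :: int set) c x. finite S \<Longrightarrow> ennreal (A * (\<Sum>l\<in>S. (norm (c l))\<^sup>2)) \<le>
       sq_sum (\<lambda>k. spline_sum hat h S c (of_int k * \<alpha> - x))"
proof -
  let ?\<kappa> = "symbol (bspline 4) h pi"
  define q where "q = 4 * \<alpha>\<^sup>2 * bandwidth h"
  have pos: "0 < sqrt (bandwidth h)"
  proof (rule ccontr)
    assume "\<not> 0 < sqrt (bandwidth h)"
    then have "1 / (2 * sqrt (bandwidth h)) \<le> 0" by (simp add: divide_le_0_iff)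
    with \<alpha> show False by linarith
  qed
  have "2 * \<alpha> * sqrt (bandwidth h) < 1" using \<alpha> pos by (simp add: field_simps)
  then have "(2 * \<alpha> * sqrt (bandwidth h))\<^sup>2 < 1" using \<alpha> pos by (simp add: power_less_one_iff abs_square_less_1)
  then have q1: "q < 1" using pos by (simp add: q_def power_mult_distrib)
  have q0: "0 < q" using pos \<alpha> by (simp add: q_def)
  \<comment> \<open>then \<open>(1 + e) q = (1 + q) / 2 < 1\<close>\<close>
  define e where "e = (1 - q) / (2 * q)"
  have e: "e > 0" using q0 q1 by (simp add: e_def)
  have small: "(1 + e) * q < 1" using q0 q1 by (simp add: e_def field_simps)
  define d where "d = (1 + 1 / e) * \<alpha>"
  have d: "d > 0" using e \<alpha> by (simp add: d_def add_pos_pos)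
  show ?thesis
  proof
    show "(1 - (1 + e) * q) * ?\<kappa> / d > 0" using small d symbols_extremal_at_pi(1)[OF h] by simp
    fix S :: "int set" and c :: "int \<Rightarrow> complex" and x assume S: "finite S"
    let ?X = "sq_sum (\<lambda>k. spline_sum hat h S c (of_int k * \<alpha> - x))"
    have "ennreal ((1 - (1 + e) * q) * (?\<kappa> * (\<Sum>l\<in>S. (norm (c l))\<^sup>2))) \<le> ennreal ((1 - (1 + e) * q) * sqnorm lborel (spline_sum hat h S c))"
      using small by (intro ennreal_leI mult_left_mono riesz_lower_bound h S) auto
    also have "\<dots> \<le> ennreal d * ?X"
      unfolding q_def d_def by (rule sampling_energy_bound[OF h \<alpha>(1) e small[unfolded q_def] S])
    finally have "ennreal (1 / d) * ennreal ((1 - (1 + e) * q) * (?\<kappa> * (\<Sum>l\<in>S. (norm (c l))\<^sup>2))) \<le> ennreal (1 / d) * (ennreal d * ?X)"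
      by (rule mult_left_mono) simp
    also have "ennreal (1 / d) * (ennreal d * ?X) = ?X"
      using d by (simp add: mult.assoc[symmetric] ennreal_mult[symmetric])
    also have "ennreal (1 / d) * ennreal ((1 - (1 + e) * q) * (?\<kappa> * (\<Sum>l\<in>S. (norm (c l))\<^sup>2))) = ennreal ((1 - (1 + e) * q) * ?\<kappa> / d * (\<Sum>l\<in>S. (norm (c l))\<^sup>2))"
      using d by (subst ennreal_mult'[symmetric]) (auto simp: mult_ac)
    finally show "ennreal ((1 - (1 + e) * q) * ?\<kappa> / d * (\<Sum>l\<in>S. (norm (c l))\<^sup>2)) \<le> ?X" .
  qed
qed

section \<open>Sampling with square-summable coefficients\<close>

text \<open>Both sides are suprema of finite partial sums. On the right this is seen along an enumeration
  of the index type.\<close>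

lemma infsum_ereal_eq_nn_integral:
  fixes f :: "'i::countable \<Rightarrow> real"
  assumes f: "\<And>i. 0 \<le> f i" and inf: "infinite (UNIV :: 'i set)"
  shows "(\<Sum>\<^sub>\<infinity>i. ereal (f i)) = enn2ereal (\<integral>\<^sup>+i. ennreal (f i) \<partial>count_space UNIV)"
proof (rule antisym)
  let ?S = "\<Sum>\<^sub>\<infinity>i. ereal (f i)" and ?I = "\<integral>\<^sup>+i. ennreal (f i) \<partial>count_space UNIV"
  have SUP: "?S = (SUP F\<in>{F. finite F \<and> F \<subseteq> UNIV}. \<Sum>i\<in>F. ereal (f i))"
    by (rule nonneg_infsum_complete) (simp add: f)
  have fin: "ereal (sum f F) \<le> ?S" if "finite F" for F
    unfolding SUP using that by (intro SUP_upper2[of F]) auto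
  show "?S \<le> enn2ereal ?I"
    unfolding SUP
  proof (rule SUP_least)
    fix F :: "'i set" assume F: "F \<in> {F. finite F \<and> F \<subseteq> UNIV}"
    have "ennreal (sum f F) = (\<Sum>i\<in>F. ennreal (f i))" using f by (simp add: sum_ennreal)
    also have "\<dots> = (\<integral>\<^sup>+i. ennreal (f i) * indicator F i \<partial>count_space UNIV)"
      using F by (subst nn_integral_count_space'[of F]) (auto simp: indicator_def)
    also have "\<dots> \<le> ?I"
      by (intro nn_integral_mono) (auto simp: indicator_def)
    finally have "enn2ereal (ennreal (sum f F)) \<le> enn2ereal ?I"
      by (simp only: less_eq_ennreal.rep_eq)
    then show "(\<Sum>i\<in>F. ereal (f i)) \<le> enn2ereal ?I"
      using f by (simp add: enn2ereal_ennreal sum_nonneg)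
  qed
  define e :: "nat \<Rightarrow> 'i" where "e = from_nat_into UNIV"
  have e: "bij_betw e UNIV UNIV"
    unfolding e_def by (rule bij_betw_from_nat_into) (use inf in auto)
  have nonneg: "0 \<le> ?S" using fin[of "{}"] by (simp add: zero_ereal_def)
  have "?I = (\<integral>\<^sup>+n. ennreal (f (e n)) \<partial>count_space UNIV)"
    by (rule nn_integral_bij_count_space[OF e, symmetric])
  also have "\<dots> = (SUP n. \<Sum>i<n. ennreal (f (e i)))"
    unfolding nn_integral_count_space_nat by (rule suminf_eq_SUP)
  also have "\<dots> \<le> e2ennreal ?S"
  proof (rule SUP_least)
    fix n
    have "(\<Sum>i<n. ennreal (f (e i))) = (\<Sum>i\<in>e ` {..<n}. ennreal (f i))"
      using e by (subst sum.reindex) (auto simp: bij_betw_def inj_on_def)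
    also have "\<dots> = ennreal (sum f (e ` {..<n}))" using f by (simp add: sum_ennreal)
    also have "\<dots> = e2ennreal (ereal (sum f (e ` {..<n})))" by (simp add: e2ennreal_ereal)
    also have "\<dots> \<le> e2ennreal ?S" by (intro e2ennreal_mono fin) simp
    finally show "(\<Sum>i<n. ennreal (f (e i))) \<le> e2ennreal ?S" .
  qed
  finally have "enn2ereal ?I \<le> enn2ereal (e2ennreal ?S)"
    by (simp only: less_eq_ennreal.rep_eq)
  then show "enn2ereal ?I \<le> ?S"
    using nonneg by (simp add: enn2ereal_e2ennreal)
qed

lemma nn_integral_of_has_sum:
  fixes f :: "int \<Rightarrow> real"
  assumes "(f has_sum s) UNIV" and f: "\<And>i. 0 \<le> f i"
  shows "(\<integral>\<^sup>+i. ennreal (f i) \<partial>count_space UNIV) = ennreal s"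
proof -
  have s: "0 \<le> s" using has_sum_nonneg[OF assms(1)] f by auto
  have "enn2ereal (\<integral>\<^sup>+i. ennreal (f i) \<partial>count_space UNIV) = enn2ereal (ennreal s)"
    using infsum_ereal_eq_nn_integral[of f, OF f infinite_UNIV_int] infsum_ereal_of_has_sum[OF assms(1)] s
    by (simp add: enn2ereal_ennreal)
  then show ?thesis by (simp only: enn2ereal_inject)
qed

text \<open>An interval of length \<open>2\<close> contains at most \<open>2 / T + 1\<close> points of a lattice of step \<open>T\<close>.\<close>

lemma hat_overlap:
  assumes T: "T > 0"
  shows "(\<integral>\<^sup>+l. ennreal (hat (y - of_int l * T)) \<partial>count_space (UNIV :: int set)) \<le> ennreal (2 / T + 1)"
proof -
  let ?A = "{\<lceil>(y - 1) / T\<rceil>..\<lfloor>(y + 1) / T\<rfloor>}"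
  have out: "hat (y - of_int l * T) = 0" if "l \<notin> ?A" for l
  proof (rule hat_eq_0, rule ccontr)
    assume "\<not> 1 \<le> \<bar>y - of_int l * T\<bar>"
    then have "y - 1 \<le> of_int l * T" "of_int l * T \<le> y + 1" by auto
    then have "(y - 1) / T \<le> of_int l" "of_int l \<le> (y + 1) / T" using T by (auto simp: field_simps)
    then have "l \<in> ?A" by (simp add: ceiling_le_iff le_floor_iff)
    with that show False by simp
  qed
  have "(\<integral>\<^sup>+l. ennreal (hat (y - of_int l * T)) \<partial>count_space (UNIV :: int set)) = (\<Sum>l\<in>?A. ennreal (hat (y - of_int l * T)))"
    by (rule nn_integral_count_space') (use out in auto)
  also have "\<dots> = ennreal (\<Sum>l\<in>?A. hat (y - of_int l * T))"
    by (rule sum_ennreal) (rule hat_nonneg)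
  also have "\<dots> \<le> ennreal (2 / T + 1)"
  proof (rule ennreal_leI)
    have "(\<Sum>l\<in>?A. hat (y - of_int l * T)) \<le> (\<Sum>l\<in>?A. 1)" by (intro sum_mono hat_le_1)
    also have "\<dots> = real (nat (\<lfloor>(y + 1) / T\<rfloor> + 1 - \<lceil>(y - 1) / T\<rceil>))" by simp
    also have "\<dots> \<le> 2 / T + 1"
    proof (cases "\<lfloor>(y + 1) / T\<rfloor> + 1 - \<lceil>(y - 1) / T\<rceil> \<ge> 0")
      case True
      have "real_of_int \<lfloor>(y + 1) / T\<rfloor> \<le> (y + 1) / T" "(y - 1) / T \<le> real_of_int \<lceil>(y - 1) / T\<rceil>"
        by (rule of_int_floor_le le_of_int_ceiling)+
      moreover have "(y + 1) / T - (y - 1) / T = 2 / T" by (simp add: diff_divide_distrib[symmetric])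
      moreover have "real (nat (\<lfloor>(y + 1) / T\<rfloor> + 1 - \<lceil>(y - 1) / T\<rceil>))
          = real_of_int \<lfloor>(y + 1) / T\<rfloor> + 1 - real_of_int \<lceil>(y - 1) / T\<rceil>"
        using True by simp
      ultimately show ?thesis by linarith
    next
      case False
      then show ?thesis using T by simp
    qed
    finally show "(\<Sum>l\<in>?A. hat (y - of_int l * T)) \<le> 2 / T + 1" .
  qed
  finally show ?thesis .
qed

lemma spline_sum_norm_sq_le:
  assumes h: "h > 0" and K: "finite K"
  shows "ennreal ((norm (spline_sum hat h K c y))\<^sup>2) \<le> ennreal (2 / h + 1) * (\<integral>\<^sup>+l. ennreal ((norm (c l))\<^sup>2) * ennreal (hat (y - of_int l * h)) \<partial>count_space UNIV)"
proof -
  let ?w = "\<lambda>l. hat (y - of_int l * h)"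
  have "norm (spline_sum hat h K c y) \<le> (\<Sum>l\<in>K. norm (c l) * ?w l)"
    unfolding spline_sum_def by (rule order_trans[OF norm_sum]) (simp add: norm_mult hat_nonneg)
  then have "ennreal ((norm (spline_sum hat h K c y))\<^sup>2) \<le> ennreal ((\<Sum>l\<in>K. norm (c l) * ?w l)\<^sup>2)"
    by (intro ennreal_leI power_mono) auto
  also have "(\<Sum>l\<in>K. norm (c l) * ?w l)\<^sup>2 = (\<Sum>l\<in>K. (norm (c l) * sqrt (?w l)) * sqrt (?w l))\<^sup>2"
    by (simp add: mult.assoc hat_nonneg)
  also have "\<dots> \<le> (\<Sum>l\<in>K. (norm (c l) * sqrt (?w l))\<^sup>2) * (\<Sum>l\<in>K. (sqrt (?w l))\<^sup>2)"
    by (rule Cauchy_Schwarz_ineq_sum)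
  also have "\<dots> = (\<Sum>l\<in>K. ?w l) * (\<Sum>l\<in>K. (norm (c l))\<^sup>2 * ?w l)"
    by (simp add: power_mult_distrib hat_nonneg)
  finally have "ennreal ((norm (spline_sum hat h K c y))\<^sup>2) \<le> ennreal ((\<Sum>l\<in>K. ?w l) * (\<Sum>l\<in>K. (norm (c l))\<^sup>2 * ?w l))"
    by (simp add: ennreal_leI)
  also have "\<dots> = ennreal (\<Sum>l\<in>K. ?w l) * ennreal (\<Sum>l\<in>K. (norm (c l))\<^sup>2 * ?w l)"
    by (intro ennreal_mult sum_nonneg mult_nonneg_nonneg hat_nonneg) simp
  also have "\<dots> \<le> ennreal (2 / h + 1) * (\<integral>\<^sup>+l. ennreal ((norm (c l))\<^sup>2) * ennreal (?w l) \<partial>count_space UNIV)"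
  proof (rule mult_mono)
    have "ennreal (\<Sum>l\<in>K. ?w l) = (\<integral>\<^sup>+l. ennreal (?w l) * indicator K l \<partial>count_space UNIV)"
      using K by (subst nn_integral_count_space'[of K]) (auto simp: indicator_def sum_ennreal hat_nonneg)
    also have "\<dots> \<le> (\<integral>\<^sup>+l. ennreal (?w l) \<partial>count_space UNIV)"
      by (intro nn_integral_mono) (auto simp: indicator_def)
    also have "\<dots> \<le> ennreal (2 / h + 1)" by (rule hat_overlap[OF h])
    finally show "ennreal (\<Sum>l\<in>K. ?w l) \<le> ennreal (2 / h + 1)" .
    have "ennreal (\<Sum>l\<in>K. (norm (c l))\<^sup>2 * ?w l) = (\<Sum>l\<in>K. ennreal ((norm (c l))\<^sup>2 * ?w l))"
      by (rule sum_ennreal[symmetric]) (simp add: hat_nonneg)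
    also have "\<dots> = (\<Sum>l\<in>K. ennreal ((norm (c l))\<^sup>2) * ennreal (?w l))"
      by (intro sum.cong refl ennreal_mult) (simp_all add: hat_nonneg)
    also have "\<dots> = (\<integral>\<^sup>+l. ennreal ((norm (c l))\<^sup>2) * ennreal (?w l) * indicator K l \<partial>count_space UNIV)"
      using K by (subst nn_integral_count_space'[of K]) (auto simp: indicator_def)
    also have "\<dots> \<le> (\<integral>\<^sup>+l. ennreal ((norm (c l))\<^sup>2) * ennreal (?w l) \<partial>count_space UNIV)"
      by (intro nn_integral_mono) (auto simp: indicator_def)
    finally show "ennreal (\<Sum>l\<in>K. (norm (c l))\<^sup>2 * ?w l) \<le> (\<integral>\<^sup>+l. ennreal ((norm (c l))\<^sup>2) * ennreal (?w l) \<partial>count_space UNIV)" .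
  qed auto
  finally show ?thesis .
qed

text \<open>A Schur test: the kernel \<open>\<phi>(\<alpha> k - x - l h)\<close> has row sums at most \<open>2 / h + 1\<close> and column sums at
  most \<open>2 / \<alpha> + 1\<close>.\<close>

theorem sampling_upper_bound:
  fixes K :: "int \<Rightarrow> int set"
  assumes h: "h > 0" and \<alpha>: "\<alpha> > 0" and K: "\<And>k. finite (K k)"
  shows "sq_sum (\<lambda>k. spline_sum hat h (K k) c (of_int k * \<alpha> - x))
    \<le> ennreal ((2 / h + 1) * (2 / \<alpha> + 1)) * sq_sum c"
proof -
  let ?r = "\<lambda>l. ennreal ((norm (c l))\<^sup>2)"
  let ?w = "\<lambda>k l. ennreal (hat (of_int k * \<alpha> - x - of_int l * h))"
  have "sq_sum (\<lambda>k. spline_sum hat h (K k) c (of_int k * \<alpha> - x))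
    \<le> (\<integral>\<^sup>+k. ennreal (2 / h + 1) * (\<integral>\<^sup>+l. ?r l * ?w k l \<partial>count_space UNIV) \<partial>count_space UNIV)"
    by (intro nn_integral_mono spline_sum_norm_sq_le h K)
  also have "\<dots> = ennreal (2 / h + 1) * (\<integral>\<^sup>+k. (\<integral>\<^sup>+l. ?r l * ?w k l \<partial>count_space UNIV) \<partial>count_space UNIV)"
    by (rule nn_integral_cmult) simp
  also have "(\<integral>\<^sup>+k. (\<integral>\<^sup>+l. ?r l * ?w k l \<partial>count_space UNIV) \<partial>count_space UNIV)
     = (\<integral>\<^sup>+l. (\<integral>\<^sup>+k. ?r l * ?w k l \<partial>count_space UNIV) \<partial>count_space UNIV)"
    by (rule nn_integral_count_space_nn_integral) auto
  also have "\<dots> = (\<integral>\<^sup>+l. ?r l * (\<integral>\<^sup>+k. ?w k l \<partial>count_space UNIV) \<partial>count_space UNIV)"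
    by (intro nn_integral_cong nn_integral_cmult) simp
  also have "\<dots> \<le> (\<integral>\<^sup>+l. ?r l * ennreal (2 / \<alpha> + 1) \<partial>count_space UNIV)"
  proof (intro nn_integral_mono mult_left_mono)
    fix l
    have "(\<integral>\<^sup>+k. ?w k l \<partial>count_space UNIV) = (\<integral>\<^sup>+k. ennreal (hat ((x + of_int l * h) - of_int k * \<alpha>)) \<partial>count_space UNIV)"
    proof (intro nn_integral_cong)
      fix k :: int
      show "?w k l = ennreal (hat ((x + of_int l * h) - of_int k * \<alpha>))"
        using hat_minus[of "(x + of_int l * h) - of_int k * \<alpha>"] by (simp add: algebra_simps)
    qed
    also have "\<dots> \<le> ennreal (2 / \<alpha> + 1)" by (rule hat_overlap[OF \<alpha>])
    finally show "(\<integral>\<^sup>+k. ?w k l \<partial>count_space UNIV) \<le> ennreal (2 / \<alpha> + 1)" .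
  qed simp
  also have "\<dots> = (\<integral>\<^sup>+l. ?r l \<partial>count_space UNIV) * ennreal (2 / \<alpha> + 1)"
    by (rule nn_integral_multc) simp
  finally have "sq_sum (\<lambda>k. spline_sum hat h (K k) c (of_int k * \<alpha> - x))
     \<le> ennreal (2 / h + 1) * ((\<integral>\<^sup>+l. ?r l \<partial>count_space UNIV) * ennreal (2 / \<alpha> + 1))"
    by (simp add: mult_left_mono)
  also have "\<dots> = ennreal ((2 / h + 1) * (2 / \<alpha> + 1)) * (\<integral>\<^sup>+l. ?r l \<partial>count_space UNIV)"
    using h \<alpha> by (subst ennreal_mult) (auto simp: mult_ac)
  finally show ?thesis .
qed

lemma small_tail:
  fixes c :: "int \<Rightarrow> complex"
  assumes fin: "sq_sum c < \<infinity>" and e: "e > 0"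
  obtains S where "finite S" "sq_sum (\<lambda>l. if l \<in> S then 0 else c l) < ennreal e"
proof -
  let ?r = "\<lambda>l. ennreal ((norm (c l))\<^sup>2)"
  let ?t = "\<lambda>n l. ennreal ((norm (if l \<in> {- int n..int n} then 0 else c l))\<^sup>2)"
  have "(\<lambda>n. \<integral>\<^sup>+l. ?t n l \<partial>count_space UNIV) \<longlonglongrightarrow> (\<integral>\<^sup>+l. 0 \<partial>count_space (UNIV::int set))"
  proof (rule nn_integral_dominated_convergence[where w = ?r])
    show "AE l in count_space UNIV. (\<lambda>n. ?t n l) \<longlonglongrightarrow> 0"
    proof (intro AE_I2 tendsto_eventually)
      fix l :: int
      show "eventually (\<lambda>n. ?t n l = 0) sequentially"
        using eventually_ge_at_top[of "nat \<bar>l\<bar>"] by eventually_elim auto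
    qed
    show "AE l in count_space UNIV. ?t n l \<le> ?r l" for n by (intro AE_I2) simp
  qed (use fin in auto)
  then have "(\<lambda>n. \<integral>\<^sup>+l. ?t n l \<partial>count_space UNIV) \<longlonglongrightarrow> 0" by simp
  then have "eventually (\<lambda>n. (\<integral>\<^sup>+l. ?t n l \<partial>count_space UNIV) < ennreal e) sequentially"
    using e by (intro order_tendstoD) auto
  then obtain n where "(\<integral>\<^sup>+l. ?t n l \<partial>count_space UNIV) < ennreal e"
    using eventually_happens'[OF sequentially_bot] by blast
  then show ?thesis by (intro that[of "{- int n..int n}"]) auto
qed

text \<open>The coefficients outside a large finite set \<open>S\<close> carry little energy, so by the upper bound they
  perturb the samples little. Splitting the samples into these two contributions costs a factor of two
  in the constant. The finite sets \<open>K k\<close> have to contain all translates that are active at the sample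
  point of index \<open>k\<close>.\<close>

theorem sampling_lower_bound_l2:
  assumes h: "h > 1/2" and \<alpha>: "\<alpha> > 0" "\<alpha> < 1 / (2 * sqrt (bandwidth h))"
  obtains A where "A > 0"
    "\<And>(K :: int \<Rightarrow> int set) c x. (\<And>k. finite (K k)) \<Longrightarrow> (\<And>k l. hat (of_int k * \<alpha> - x - of_int l * h) \<noteq> 0 \<Longrightarrow> l \<in> K k) \<Longrightarrow>
       sq_sum c < \<infinity> \<Longrightarrow>
       ennreal A * sq_sum c \<le>
       sq_sum (\<lambda>k. spline_sum hat h (K k) c (of_int k * \<alpha> - x))"
proof -
  obtain A where A: "A > 0"
    "\<And>(S :: int set) c x. finite S \<Longrightarrow> ennreal (A * (\<Sum>l\<in>S. (norm (c l))\<^sup>2)) \<le>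
       sq_sum (\<lambda>k. spline_sum hat h S c (of_int k * \<alpha> - x))"
    by (rule sampling_lower_bound[OF h \<alpha>]) blast
  define C where "C = (2 / h + 1) * (2 / \<alpha> + 1)"
  have C: "C > 0" unfolding C_def using h \<alpha> by (intro mult_pos_pos add_pos_pos) auto
  show ?thesis
  proof
    show "A / 2 > 0" using A by simp
    fix K :: "int \<Rightarrow> int set" and c :: "int \<Rightarrow> complex" and x
    assume K: "\<And>k. finite (K k)" and supp: "\<And>k l. hat (of_int k * \<alpha> - x - of_int l * h) \<noteq> 0 \<Longrightarrow> l \<in> K k"
      and fin: "sq_sum c < \<infinity>"
    let ?g = "\<lambda>S c k. spline_sum hat h S c (of_int k * \<alpha> - x)"
    let ?N = "sq_sum c"
    let ?X = "sq_sum (\<lambda>k. ?g (K k) c k)"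
    have "ennreal A * ?N \<le> 2 * ?X"
    proof (rule ennreal_le_epsilon)
      fix e :: real assume e: "e > 0"
      define e' where "e' = e / (2 * C + A)"
      have e': "e' > 0" "(2 * C + A) * e' = e" using e C A(1) by (auto simp: e'_def add_pos_pos)
      obtain S where S: "finite S" and tail: "sq_sum (\<lambda>l. if l \<in> S then 0 else c l) < ennreal e'"
        using small_tail[OF fin e'(1)] by blast
      let ?c' = "\<lambda>l. if l \<in> S then 0 else c l"
      let ?R = "sq_sum ?c'"
      have split: "?g S c k =
         ?g (K k) c k + - ?g (K k) ?c' k" for k
      proof -
        let ?w = "\<lambda>l. complex_of_real (hat (of_int k * \<alpha> - x - of_int l * h))"
        have "?g S c k = (\<Sum>l\<in>S \<union> K k. (c l - ?c' l) * ?w l)"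
          unfolding spline_sum_def using S K by (intro sum.mono_neutral_cong_left) auto
        also have "\<dots> = (\<Sum>l\<in>K k. (c l - ?c' l) * ?w l)"
          using S K supp by (intro sum.mono_neutral_right) auto
        also have "\<dots> = (\<Sum>l\<in>K k. c l * ?w l) - (\<Sum>l\<in>K k. ?c' l * ?w l)"
          unfolding left_diff_distrib by (rule sum_subtractf)
        finally show ?thesis unfolding spline_sum_def by simp
      qed
      have N: "?N = ennreal (\<Sum>l\<in>S. (norm (c l))\<^sup>2) + ?R"
      proof -
        have "?N = (\<integral>\<^sup>+l. ennreal ((norm (c l))\<^sup>2) * indicator S l + ennreal ((norm (?c' l))\<^sup>2) \<partial>count_space UNIV)"
          by (intro nn_integral_cong) (simp add: indicator_def)
        also have "\<dots> = (\<integral>\<^sup>+l. ennreal ((norm (c l))\<^sup>2) * indicator S l \<partial>count_space UNIV) + ?R"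
          by (rule nn_integral_add) auto
        also have "(\<integral>\<^sup>+l. ennreal ((norm (c l))\<^sup>2) * indicator S l \<partial>count_space UNIV) = (\<Sum>l\<in>S. ennreal ((norm (c l))\<^sup>2))"
          using S by (subst nn_integral_count_space'[of S]) (auto simp: indicator_def)
        also have "\<dots> = ennreal (\<Sum>l\<in>S. (norm (c l))\<^sup>2)" by (rule sum_ennreal) simp
        finally show ?thesis .
      qed
      have "ennreal (A * (\<Sum>l\<in>S. (norm (c l))\<^sup>2)) \<le> sq_sum (\<lambda>k. ?g S c k)"
        by (rule A(2)[OF S])
      also have "\<dots> \<le> (\<integral>\<^sup>+k. 2 * ennreal ((norm (?g (K k) c k))\<^sup>2)
          + 2 * ennreal ((norm (?g (K k) ?c' k))\<^sup>2) \<partial>count_space UNIV)"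
      proof (intro nn_integral_mono)
        fix k :: int
        have "ennreal ((norm (?g S c k))\<^sup>2) \<le>
          ennreal (2 * (norm (?g (K k) c k))\<^sup>2 + 2 * (norm (- ?g (K k) ?c' k))\<^sup>2)"
          unfolding split by (intro ennreal_leI norm_add_sq_le)
        then show "ennreal ((norm (?g S c k))\<^sup>2) \<le> 2 * ennreal ((norm (?g (K k) c k))\<^sup>2)
          + 2 * ennreal ((norm (?g (K k) ?c' k))\<^sup>2)"
          unfolding norm_minus_cancel by (simp add: ennreal_plus ennreal_mult)
      qed
      also have "\<dots> = 2 * ?X + 2 * sq_sum (\<lambda>k. ?g (K k) ?c' k)"
        by (simp add: nn_integral_add nn_integral_cmult)
      also have "\<dots> \<le> 2 * ?X + 2 * (ennreal C * ?R)"
        unfolding C_def using h \<alpha> K by (intro add_left_mono mult_left_mono sampling_upper_bound) auto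
      finally have main: "ennreal (A * (\<Sum>l\<in>S. (norm (c l))\<^sup>2)) \<le> 2 * ?X + 2 * (ennreal C * ?R)" .
      have "ennreal A * ?N = ennreal (A * (\<Sum>l\<in>S. (norm (c l))\<^sup>2)) + ennreal A * ?R"
        unfolding N using A(1) by (simp add: distrib_left ennreal_mult sum_nonneg)
      also have "\<dots> \<le> (2 * ?X + 2 * (ennreal C * ?R)) + ennreal A * ?R"
        by (rule add_right_mono[OF main])
      also have "\<dots> = 2 * ?X + ennreal (2 * C + A) * ?R"
        using C A(1) by (simp add: ennreal_plus ennreal_mult distrib_right mult.assoc add.assoc)
      also have "\<dots> \<le> 2 * ?X + ennreal (2 * C + A) * ennreal e'"
        using tail by (intro add_left_mono mult_left_mono) auto
      also have "ennreal (2 * C + A) * ennreal e' = ennreal e"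
        using e' C A(1) by (subst ennreal_mult[symmetric]) auto
      finally show "ennreal A * ?N \<le> 2 * ?X + ennreal e" .
    qed
    then have "ennreal (1/2) * (ennreal A * ?N) \<le> ennreal (1/2) * (2 * ?X)" by (rule mult_left_mono) simp
    also have "ennreal (1/2) * (2 * ?X) = ?X"
    proof -
      have "ennreal (1/2) * ennreal 2 = 1" by (subst ennreal_mult[symmetric]) auto
      then show ?thesis by (simp add: mult.assoc[symmetric])
    qed
    also have "ennreal (1/2) * (ennreal A * ?N) = ennreal (A / 2) * ?N"
    proof -
      have "ennreal (1/2) * ennreal A = ennreal (A / 2)"
        using A(1) by (subst ennreal_mult[symmetric]) auto
      then show ?thesis by (simp only: mult.assoc[symmetric])
    qed
    finally show "ennreal (A / 2) * ?N \<le> ?X" .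
  qed
qed

section \<open>The Gabor system\<close>

lemma sq_integrable_mult_hat:
  assumes f: "sq_integrable M f" and u [measurable]: "u \<in> borel_measurable M"
  shows "sq_integrable M (\<lambda>x. f x * of_real (hat (u x)))"
proof -
  note [measurable] = sq_integrable_measurable[OF f]
  have meas: "(\<lambda>x. f x * of_real (hat (u x))) \<in> borel_measurable M" by measurable
  have "integrable M (\<lambda>x. (norm (f x * of_real (hat (u x))))\<^sup>2)"
  proof (rule Bochner_Integration.integrable_bound)
    show "integrable M (\<lambda>x. (norm (f x))\<^sup>2)" using f by (simp add: sq_integrable_def)
    show "(\<lambda>x. (norm (f x * of_real (hat (u x))))\<^sup>2) \<in> borel_measurable M" by measurable
    show "AE x in M. norm ((norm (f x * of_real (hat (u x))))\<^sup>2) \<le> norm ((norm (f x))\<^sup>2)"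
    proof (intro AE_I2)
      fix x
      have "norm (f x * of_real (hat (u x))) \<le> norm (f x) * 1"
        unfolding norm_mult using hat_nonneg[of "u x"] hat_le_1[of "u x"]
        by (intro mult_left_mono) auto
      then have "(norm (f x * of_real (hat (u x))))\<^sup>2 \<le> (norm (f x))\<^sup>2"
        by (intro power_mono) auto
      then show "norm ((norm (f x * of_real (hat (u x))))\<^sup>2) \<le> norm ((norm (f x))\<^sup>2)"
        by simp
    qed
  qed
  with meas show ?thesis by (simp add: sq_integrable_def)
qed

lemma L2_iff_sq_integrable: "f \<in> L2 \<longleftrightarrow> sq_integrable lborel f"
  by (simp add: L2_def sq_integrable_def)

lemma gabor_in_L2: "gabor (cbspline 2) \<alpha> \<beta> i \<in> L2"
proof (cases i)
  case (Pair k m)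
  have [measurable]: "(\<lambda>x. exp (2 * complex_of_real pi * \<i> * of_real (\<beta> * of_int m * x))) \<in> borel_measurable borel"
    by (intro borel_measurable_continuous_onI continuous_intros)
  have norm: "norm (gabor (cbspline 2) \<alpha> \<beta> (k, m) x) = hat (x + - (\<alpha> * of_int k))" for x
    by (simp add: gabor_def bspline_2 norm_mult norm_exp_eq_Re hat_nonneg)
  have "integrable lborel (\<lambda>x. (hat x)\<^sup>2)"
    using hat_sum_sq_integral(1)[of 0 "{0}" "\<lambda>_. 1"] by (simp add: sq_integrable_def spline_sum_def)
  then have "integrable lborel (\<lambda>x. (hat (x + - (\<alpha> * of_int k)))\<^sup>2)"
    by (subst integrable_lborel_shift)
  moreover have "gabor (cbspline 2) \<alpha> \<beta> (k, m) \<in> borel_measurable borel"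
    unfolding gabor_def bspline_2 prod.case by measurable
  ultimately show ?thesis unfolding Pair L2_def by (simp only: norm mem_Collect_eq) simp
qed

text \<open>Contains the index \<open>l\<close> of every cell \<open>[l h, (l + 1) h)\<close> that meets the support of the window shifted by \<open>\<alpha> k\<close>.\<close>

definition overlapping :: "real \<Rightarrow> real \<Rightarrow> int \<Rightarrow> int set" where
  "overlapping \<alpha> h k = {\<lfloor>(\<alpha> * of_int k - 1) / h\<rfloor>..\<lfloor>(\<alpha> * of_int k + 1) / h\<rfloor>}"

lemma finite_overlapping: "finite (overlapping \<alpha> h k)"
  by (simp add: overlapping_def)

lemma floor_in_overlapping:
  assumes h: "h > 0" and x: "hat (x - \<alpha> * of_int k) \<noteq> 0"
  shows "\<lfloor>x / h\<rfloor> \<in> overlapping \<alpha> h k"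
proof -
  have "\<bar>x - \<alpha> * of_int k\<bar> < 1" using x hat_eq_0[of "x - \<alpha> * of_int k"] by linarith
  then have "(\<alpha> * of_int k - 1) / h \<le> x / h" "x / h \<le> (\<alpha> * of_int k + 1) / h"
    using h by (auto intro!: divide_right_mono)
  then show ?thesis unfolding overlapping_def by (auto intro: floor_mono)
qed

text \<open>For fixed \<open>x\<close>, the values of \<open>f\<close> on the fibre \<open>x + h \<int>\<close> are the coefficients of a spline, and
  the periodisation of \<open>f\<close> times the shifted window is a sample of that spline.\<close>

definition fibre_sample :: "real \<Rightarrow> real \<Rightarrow> (real \<Rightarrow> complex) \<Rightarrow> int \<Rightarrow> real \<Rightarrow> complex" where
  "fibre_sample \<alpha> h f k x =
     spline_sum hat h (overlapping \<alpha> h k) (\<lambda>l. f (x + of_int l * h)) (of_int k * \<alpha> - x)"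

lemma fibre_sample_eq:
  "fibre_sample \<alpha> h f k x =
    (\<Sum>l\<in>overlapping \<alpha> h k. f (x + of_int l * h) * of_real (hat (x + of_int l * h - \<alpha> * of_int k)))"
  unfolding fibre_sample_def spline_sum_def
proof (intro sum.cong refl)
  fix l
  have "of_int k * \<alpha> - x - of_int l * h = - (x + of_int l * h - \<alpha> * of_int k)" by simp
  then show "f (x + of_int l * h) * of_real (hat (of_int k * \<alpha> - x - of_int l * h)) =
      f (x + of_int l * h) * of_real (hat (x + of_int l * h - \<alpha> * of_int k))"
    by (simp only: hat_minus)
qed

lemma sq_integrable_fibre_sample:
  assumes "f \<in> L2" shows "sq_integrable lborel (fibre_sample \<alpha> h f k)"
  unfolding fibre_sample_eq[abs_def] using assms
  by (intro sq_integrable_sum sq_integrable_mult_hat sq_integrable_shift) (simp_all add: L2_iff_sq_integrable)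

lemma fibre_sample_measurable:
  assumes "f \<in> L2" shows "fibre_sample \<alpha> h f k \<in> borel_measurable borel"
  using sq_integrable_measurable[OF sq_integrable_fibre_sample[OF assms]] by simp

lemma gabor_modulation_energy:
  assumes h: "h > 0" and f: "f \<in> L2"
  shows "sq_sum (\<lambda>m. L2_inner f (gabor (cbspline 2) \<alpha> (1/h) (k, m)))
    = ennreal h * (\<integral>\<^sup>+x. ennreal ((norm (fibre_sample \<alpha> h f k x))\<^sup>2) \<partial>period_space h)"
proof -
  let ?F = "\<lambda>x. f x * of_real (hat (x - \<alpha> * of_int k))"
  let ?I = "sqnorm (period_space h) (fibre_sample \<alpha> h f k)"
  have F: "sq_integrable lborel ?F"
    using f by (intro sq_integrable_mult_hat) (simp_all add: L2_iff_sq_integrable)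
  have supp: "\<lfloor>x / h\<rfloor> \<in> overlapping \<alpha> h k" if "?F x \<noteq> 0" for x
    using that by (intro floor_in_overlapping[OF h]) simp
  have inner: "L2_inner f (gabor (cbspline 2) \<alpha> (1/h) (k, m)) = (\<integral>x. ?F x * cnj (trig h m x) \<partial>lborel)" for m
    unfolding L2_inner_def
  proof (rule Bochner_Integration.integral_cong[OF refl])
    fix x
    have "exp (2 * complex_of_real pi * \<i> * of_real (1 / h * of_int m * x)) = trig h m x"
      unfolding trig_def cis_conv_exp by (rule arg_cong[where f = exp]) (simp add: complex_eq_iff)
    then show "f x * cnj (gabor (cbspline 2) \<alpha> (1/h) (k, m) x) = ?F x * cnj (trig h m x)"
      by (simp add: gabor_def bspline_2)
  qed
  have "((\<lambda>m. (norm (L2_inner f (gabor (cbspline 2) \<alpha> (1/h) (k, m))))\<^sup>2) has_sum h * ?I) UNIV"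
    unfolding inner fibre_sample_eq by (rule parseval_fold[OF h F finite_overlapping supp])
  then have "sq_sum (\<lambda>m. L2_inner f (gabor (cbspline 2) \<alpha> (1/h) (k, m))) = ennreal (h * ?I)"
    by (rule nn_integral_of_has_sum) simp
  also have "\<dots> = ennreal h * ennreal ?I"
    using h by (intro ennreal_mult) auto
  also have "ennreal ?I = (\<integral>\<^sup>+x. ennreal ((norm (fibre_sample \<alpha> h f k x))\<^sup>2) \<partial>period_space h)"
    using sq_integrable_period_space[OF sq_integrable_fibre_sample[OF f]]
    by (intro nn_integral_eq_integral[symmetric]) (simp_all add: sq_integrable_def)
  finally show ?thesis .
qed

abbreviation gabor_sum :: "real \<Rightarrow> real \<Rightarrow> (real \<Rightarrow> complex) \<Rightarrow> ennreal" where
  "gabor_sum \<alpha> h f \<equiv> sq_sum (\<lambda>i. L2_inner f (gabor (cbspline 2) \<alpha> (1/h) i))"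

theorem gabor_energy:
  assumes h: "h > 0" and f: "f \<in> L2"
  shows "gabor_sum \<alpha> h f
    = ennreal h * (\<integral>\<^sup>+x. sq_sum (\<lambda>k. fibre_sample \<alpha> h f k x) \<partial>period_space h)"
proof -
  note [measurable] = fibre_sample_measurable[OF f]
  have meas: "(\<lambda>x. ennreal ((norm (fibre_sample \<alpha> h f k x))\<^sup>2)) \<in> borel_measurable (period_space h)" for k
    by (rule measurable_restrict_space1) measurable
  have "gabor_sum \<alpha> h f
    = (\<integral>\<^sup>+k. sq_sum (\<lambda>m. L2_inner f (gabor (cbspline 2) \<alpha> (1/h) (k, m))) \<partial>count_space UNIV)"
    by (rule nn_integral_fst_count_space[symmetric])
  also have "\<dots> = ennreal h * (\<integral>\<^sup>+k. (\<integral>\<^sup>+x. ennreal ((norm (fibre_sample \<alpha> h f k x))\<^sup>2) \<partial>period_space h) \<partial>count_space UNIV)"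
    unfolding gabor_modulation_energy[OF h f] by (rule nn_integral_cmult) simp
  also have "(\<integral>\<^sup>+k. (\<integral>\<^sup>+x. ennreal ((norm (fibre_sample \<alpha> h f k x))\<^sup>2) \<partial>period_space h) \<partial>count_space UNIV)
    = (\<integral>\<^sup>+x. sq_sum (\<lambda>k. fibre_sample \<alpha> h f k x) \<partial>period_space h)"
    by (rule nn_integral_count_space_nn_integral[symmetric]) (simp_all add: meas)
  finally show ?thesis .
qed

definition fibre_energy :: "real \<Rightarrow> (real \<Rightarrow> complex) \<Rightarrow> real \<Rightarrow> ennreal" where
  "fibre_energy h f x = sq_sum (\<lambda>l. f (x + of_int l * h))"

lemma fibre_energy_measurable:
  assumes [measurable]: "f \<in> borel_measurable borel"
  shows "fibre_energy h f \<in> borel_measurable (period_space T)"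
proof (rule measurable_restrict_space1)
  have "fibre_energy h f = (\<lambda>x. \<Sum>n. ennreal ((norm (f (x + of_int (int_decode n) * h)))\<^sup>2))"
    unfolding fibre_energy_def nn_integral_bij_count_space[OF bij_int_decode, symmetric]
      nn_integral_count_space_nat ..
  then show "fibre_energy h f \<in> borel_measurable lborel" by simp
qed

lemma nn_integral_fibre_energy:
  assumes h: "h > 0" and [measurable]: "f \<in> borel_measurable borel"
  shows "(\<integral>\<^sup>+x. fibre_energy h f x \<partial>period_space h) = energy f"
proof -
  have meas: "(\<lambda>x. ennreal ((norm (f (x + of_int l * h)))\<^sup>2)) \<in> borel_measurable (period_space h)" for l :: int
    by (rule measurable_restrict_space1) measurable
  have "(\<integral>\<^sup>+x. fibre_energy h f x \<partial>period_space h)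
    = (\<integral>\<^sup>+l. (\<integral>\<^sup>+x. ennreal ((norm (f (x + of_int l * h)))\<^sup>2) \<partial>period_space h) \<partial>count_space (UNIV::int set))"
    unfolding fibre_energy_def by (rule nn_integral_count_space_nn_integral) (simp_all add: meas)
  also have "\<dots> = (\<integral>\<^sup>+l. (\<integral>\<^sup>+x. ennreal ((norm (f (x + of_int l * h)))\<^sup>2) * indicator {0..<0 + h} x \<partial>lborel) \<partial>count_space (UNIV::int set))"
    by (intro nn_integral_cong) (subst nn_integral_restrict_space, simp_all)
  also have "\<dots> = energy f"
    by (rule nn_integral_cells[OF h, symmetric]) measurable
  finally show ?thesis .
qed

text \<open>The energy of almost every fibre of a square-integrable function is finite, so the sampling bounds
  hold on almost every fibre; integration over the fibres gives the frame bounds.\<close>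

theorem gabor_energy_bounds:
  assumes h: "h > 1/2" and \<alpha>: "\<alpha> > 0" "\<alpha> < 1 / (2 * sqrt (bandwidth h))"
  obtains A B where "A > 0" "B > 0"
    "\<And>f. f \<in> L2 \<Longrightarrow> ennreal A * energy f
        \<le> gabor_sum \<alpha> h f"
    "\<And>f. f \<in> L2 \<Longrightarrow> gabor_sum \<alpha> h f
        \<le> ennreal B * energy f"
proof -
  let ?M = "period_space h"
  have h0: "h > 0" using h by simp
  have sp: "space ?M = {0..<h}" by (simp add: space_restrict_space)
  obtain A where A: "A > 0"
    "\<And>(K :: int \<Rightarrow> int set) c x. (\<And>k. finite (K k)) \<Longrightarrow> (\<And>k l. hat (of_int k * \<alpha> - x - of_int l * h) \<noteq> 0 \<Longrightarrow> l \<in> K k) \<Longrightarrow>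
       sq_sum c < \<infinity> \<Longrightarrow>
       ennreal A * sq_sum c \<le>
       sq_sum (\<lambda>k. spline_sum hat h (K k) c (of_int k * \<alpha> - x))"
    by (rule sampling_lower_bound_l2[OF h \<alpha>]) blast
  define C where "C = (2 / h + 1) * (2 / \<alpha> + 1)"
  have C: "C > 0" unfolding C_def using h0 \<alpha> by (intro mult_pos_pos add_pos_pos) auto
  let ?S = "\<lambda>f x. sq_sum (\<lambda>k. fibre_sample \<alpha> h f k x)"
  have scale: "ennreal (h * c) * energy f = ennreal h * (\<integral>\<^sup>+x. ennreal c * fibre_energy h f x \<partial>?M)"
    if f: "f \<in> L2" and c: "c > 0" for f c
  proof -
    have fm: "f \<in> borel_measurable borel" using f by (simp add: L2_def)
    have "(\<integral>\<^sup>+x. ennreal c * fibre_energy h f x \<partial>?M) = ennreal c * energy f"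
      unfolding nn_integral_fibre_energy[OF h0 fm, symmetric]
      by (rule nn_integral_cmult) (rule fibre_energy_measurable[OF fm])
    then show ?thesis using h0 c by (simp add: ennreal_mult mult.assoc)
  qed
  show ?thesis
  proof
    show "h * A > 0" "h * C > 0" using h0 A(1) C by simp_all
    fix f assume f: "f \<in> L2"
    then have fm: "f \<in> borel_measurable borel" by (simp add: L2_def)
    have finite_energy: "AE x in ?M. fibre_energy h f x < \<infinity>"
    proof -
      have "energy f < \<infinity>"
        using f by (auto simp: L2_def nn_integral_eq_integral)
      then have "(\<integral>\<^sup>+x. fibre_energy h f x \<partial>?M) \<noteq> \<infinity>" unfolding nn_integral_fibre_energy[OF h0 fm] by simp
      from nn_integral_PInf_AE[OF fibre_energy_measurable[OF fm] this] show ?thesis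
        by eventually_elim (simp add: less_top)
    qed
    have lower_at: "ennreal A * fibre_energy h f x \<le> ?S f x"
      if x: "x \<in> space ?M" and fin: "fibre_energy h f x < \<infinity>" for x
      unfolding fibre_energy_def fibre_sample_def
    proof (rule A(2)[OF finite_overlapping])
      show "sq_sum (\<lambda>l. f (x + of_int l * h)) < \<infinity>"
        using fin unfolding fibre_energy_def .
      fix k l assume nz: "hat (of_int k * \<alpha> - x - of_int l * h) \<noteq> 0"
      have "of_int k * \<alpha> - x - of_int l * h = - (x + of_int l * h - \<alpha> * of_int k)" by simp
      with nz have "hat (x + of_int l * h - \<alpha> * of_int k) \<noteq> 0" by (simp only: hat_minus not_False_eq_True)
      then have "\<lfloor>(x + of_int l * h) / h\<rfloor> \<in> overlapping \<alpha> h k" by (rule floor_in_overlapping[OF h0])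
      moreover have "\<lfloor>(x + of_int l * h) / h\<rfloor> = l"
        using x unfolding sp by (subst in_cell_iff_floor[OF h0, symmetric]) auto
      ultimately show "l \<in> overlapping \<alpha> h k" by simp
    qed
    have lower: "AE x in ?M. ennreal A * fibre_energy h f x \<le> ?S f x"
      using AE_space[of ?M] finite_energy by eventually_elim (rule lower_at)
    show "ennreal (h * A) * energy f
        \<le> gabor_sum \<alpha> h f"
      unfolding scale[OF f A(1)] gabor_energy[OF h0 f]
      by (intro mult_left_mono nn_integral_mono_AE lower) simp
    have upper: "?S f x \<le> ennreal C * fibre_energy h f x" for x
      unfolding fibre_sample_def fibre_energy_def C_def
      by (rule sampling_upper_bound[OF h0 \<alpha>(1) finite_overlapping])
    show "gabor_sum \<alpha> h f
        \<le> ennreal (h * C) * energy f"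
      unfolding scale[OF f C] gabor_energy[OF h0 f]
      by (intro mult_left_mono nn_integral_mono upper) simp
  qed
qed

theorem gabor_frame:
  assumes h: "h > 1/2" and \<alpha>: "\<alpha> > 0" "\<alpha> < 1 / (2 * sqrt (bandwidth h))"
  shows "L2_frame (gabor (cbspline 2) \<alpha> (1/h))"
proof -
  obtain A B where AB: "A > 0" "B > 0"
    "\<And>f. f \<in> L2 \<Longrightarrow> ennreal A * energy f \<le> gabor_sum \<alpha> h f"
    "\<And>f. f \<in> L2 \<Longrightarrow> gabor_sum \<alpha> h f \<le> ennreal B * energy f"
    by (rule gabor_energy_bounds[OF h \<alpha>]) blast
  have infsum: "(\<Sum>\<^sub>\<infinity>i. ereal ((norm (L2_inner f (gabor (cbspline 2) \<alpha> (1/h) i)))\<^sup>2)) = enn2ereal (gabor_sum \<alpha> h f)" for f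
    by (rule infsum_ereal_eq_nn_integral) (auto simp: finite_prod)
  have norm: "ereal (c * (L2_norm f)\<^sup>2) = enn2ereal (ennreal c * energy f)"
    if f: "f \<in> L2" and c: "c > 0" for f c
  proof -
    have "energy f = ennreal (sqnorm lborel f)"
      using f by (intro nn_integral_eq_integral) (auto simp: L2_def)
    also have "\<dots> = ennreal ((L2_norm f)\<^sup>2)"
      unfolding L2_norm_def by simp
    finally have "ennreal c * energy f = ennreal (c * (L2_norm f)\<^sup>2)"
      using c by (simp add: ennreal_mult)
    then show ?thesis using c by (simp add: enn2ereal_ennreal)
  qed
  show ?thesis
    unfolding L2_frame_def
  proof (rule conjI, rule allI, rule gabor_in_L2, rule exI[of _ A], rule exI[of _ B], intro conjI ballI AB(1,2))
    fix f assume f: "f \<in> L2"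
    show "ereal (A * (L2_norm f)\<^sup>2) \<le> (\<Sum>\<^sub>\<infinity>i. ereal ((norm (L2_inner f (gabor (cbspline 2) \<alpha> (1/h) i)))\<^sup>2))"
      unfolding infsum norm[OF f AB(1)] using AB(3)[OF f] by (simp only: less_eq_ennreal.rep_eq)
    show "(\<Sum>\<^sub>\<infinity>i. ereal ((norm (L2_inner f (gabor (cbspline 2) \<alpha> (1/h) i)))\<^sup>2)) \<le> ereal (B * (L2_norm f)\<^sup>2)"
      unfolding infsum norm[OF f AB(2)] using AB(4)[OF f] by (simp only: less_eq_ennreal.rep_eq)
  qed
qed

theorem theorem3p2:
  fixes \<beta> :: real
  assumes "0 < \<beta>" and "\<beta> < 2"
  shows "(\<forall>w\<in>{0..\<beta>}. B_quot (cbspline 2) (1/\<beta>) w \<le> B_quot (cbspline 2) (1/\<beta>) (\<beta>/2)) \<and>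
    M_sup (cbspline 2) (1/\<beta>) =
      ereal (1 / (4 * pi\<^sup>2) *
        ((1 - 2 * bspline 2 (1/\<beta>) + bspline 2 (1 - 1/\<beta>) - bspline 2 (1 - 2/\<beta>)
            + bspline 2 (1 - 3/\<beta>)) /
         (1/3 - bspline 4 (1/\<beta>) + bspline 4 (2/\<beta>) - bspline 4 (3/\<beta>)))) \<and>
    (\<forall>\<alpha>::real. 0 < \<alpha> \<and> \<alpha> < 1 / (2 * sqrt (real_of_ereal (M_sup (cbspline 2) (1/\<beta>)))) \<longrightarrow>
       L2_frame (gabor (cbspline 2) \<alpha> \<beta>))"
proof (intro conjI ballI allI impI)
  have h: "1 / \<beta> > 1 / 2" using assms by (simp add: field_simps)
  have M: "M_sup (cbspline 2) (1/\<beta>) = ereal (bandwidth (1/\<beta>))" by (rule M_sup_hat[OF h])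
  show "B_quot (cbspline 2) (1/\<beta>) w \<le> B_quot (cbspline 2) (1/\<beta>) (\<beta>/2)" for w
    using B_quot_hat_le[OF h, of w] B_quot_hat_half[OF h] by simp
  show "M_sup (cbspline 2) (1/\<beta>) =
      ereal (1 / (4 * pi\<^sup>2) *
        ((1 - 2 * bspline 2 (1/\<beta>) + bspline 2 (1 - 1/\<beta>) - bspline 2 (1 - 2/\<beta>)
            + bspline 2 (1 - 3/\<beta>)) /
         (1/3 - bspline 4 (1/\<beta>) + bspline 4 (2/\<beta>) - bspline 4 (3/\<beta>))))"
    unfolding M bandwidth_eq[OF h] by simp
  fix \<alpha> :: real
  assume "0 < \<alpha> \<and> \<alpha> < 1 / (2 * sqrt (real_of_ereal (M_sup (cbspline 2) (1/\<beta>))))"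
  then show "L2_frame (gabor (cbspline 2) \<alpha> \<beta>)"
    using gabor_frame[OF h, of \<alpha>] unfolding M by simp
qed

end
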